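(* For each positive integer $n$, let $D_2(n)$ denote the proportion of pairs $(\lambda,\mu)$ of partitions of $n$ for which the character value $\chi^{\lambda}_{\mu}$ is odd. Then $D_2(n)\to 0$ as $n\to\infty$.
   Context: For partitions $\lambda,\mu$ of $n$, $\chi^{\lambda}_{\mu}$ denotes the value of the irreducible character of the symmetric group $S_n$ indexed by $\lambda$ on the conjugacy class of permutations of cycle type $\mu$. Thus $D_2(n)$ is the proportion of odd entries in the character table of $S_n$. *)

theory Defs
  imports
    Complex_Main
    "HOL-Library.Function_Algebras"
    "HOL-Library.Multiset"
    "HOL-Combinatorics.Permutations"
    "HOL-Combinatorics.Orbits"
begin

definition partitions :: "nat \<Rightarrow> nat list set" where
  "partitions n = {lam. sorted_wrt (\<ge>) lam \<and> 0 \<notin> set lam \<and> sum_list lam = n}"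

text \<open>The symmetric group of degree \<open>n\<close> is the set of all \<open>p\<close> with \<open>p permutes {..<n}\<close>;
  fixed points count as cycles of length 1.\<close>

definition cycle_type :: "nat \<Rightarrow> (nat \<Rightarrow> nat) \<Rightarrow> nat multiset" where
  "cycle_type n p = image_mset card (mset_set (orbit p ` {..<n}))"

definition fun_scale :: "complex \<Rightarrow> ('a \<Rightarrow> complex) \<Rightarrow> ('a \<Rightarrow> complex)" where
  "fun_scale c f = (\<lambda>x. c * f x)"

interpretation fun_space: vector_space "fun_scale :: complex \<Rightarrow> ('a \<Rightarrow> complex) \<Rightarrow> ('a \<Rightarrow> complex)"
  by unfold_locales (auto simp: fun_scale_def fun_eq_iff algebra_simps)

text \<open>Trace of a linear map \<open>T\<close> on a finite-dimensional \<open>T\<close>-invariant subspace \<open>V\<close>; the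
  value does not depend on the chosen basis \<open>B\<close>.\<close>

definition trace_on :: "('a \<Rightarrow> complex) set \<Rightarrow> (('a \<Rightarrow> complex) \<Rightarrow> ('a \<Rightarrow> complex)) \<Rightarrow> complex" where
  "trace_on V T =
    (let B = (SOME B. fun_space.independent B \<and> fun_space.span B = V)
     in \<Sum>b\<in>B. fun_space.representation B (T b) b)"

definition young_diagram :: "nat list \<Rightarrow> (nat \<times> nat) set" where
  "young_diagram lam = {(i, j). i < length lam \<and> j < lam ! i}"

text \<open>A tableau is a bijective filling of the Young diagram; it need not be standard.\<close>

definition tableaux :: "nat list \<Rightarrow> (nat \<times> nat \<Rightarrow> nat) set" where
  "tableaux lam = {t. bij_betw t (young_diagram lam) {..<sum_list lam}}"

text \<open>The row equivalence class of a tableau, encoded as the list of the sets of entries of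
  its rows.\<close>

definition tabloid :: "nat list \<Rightarrow> (nat \<times> nat \<Rightarrow> nat) \<Rightarrow> nat set list" where
  "tabloid lam t = map (\<lambda>i. {t (i, j) | j. (i, j) \<in> young_diagram lam}) [0..<length lam]"

definition column_stabilizer :: "nat list \<Rightarrow> (nat \<times> nat \<Rightarrow> nat) \<Rightarrow> (nat \<Rightarrow> nat) set" where
  "column_stabilizer lam t =
    {p. p permutes {..<sum_list lam} \<and>
        (\<forall>j. p ` {t (i, j) | i. (i, j) \<in> young_diagram lam} =
             {t (i, j) | i. (i, j) \<in> young_diagram lam})}"

text \<open>Formal complex linear combinations of tabloids are functions from tabloids to the complex
  numbers; the permutation \<open>p\<close> sends the basis vector of a tabloid \<open>R\<close> to the basis vector
  of \<open>map ((`) p) R\<close>.\<close>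

definition tabloid_vec :: "nat set list \<Rightarrow> (nat set list \<Rightarrow> complex)" where
  "tabloid_vec R = (\<lambda>R'. if R' = R then 1 else 0)"

definition perm_act :: "(nat \<Rightarrow> nat) \<Rightarrow> (nat set list \<Rightarrow> complex) \<Rightarrow> (nat set list \<Rightarrow> complex)" where
  "perm_act p f = (\<lambda>R. f (map ((`) (inv p)) R))"

definition polytabloid :: "nat list \<Rightarrow> (nat \<times> nat \<Rightarrow> nat) \<Rightarrow> (nat set list \<Rightarrow> complex)" where
  "polytabloid lam t =
    (\<Sum>p\<in>column_stabilizer lam t.
       fun_scale (of_int (sign p)) (perm_act p (tabloid_vec (tabloid lam t))))"

definition specht_module :: "nat list \<Rightarrow> (nat set list \<Rightarrow> complex) set" where
  "specht_module lam = fun_space.span (polytabloid lam ` tableaux lam)"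

text \<open>The irreducible character indexed by \<open>lam\<close> is the character of the Specht module of
  \<open>lam\<close>; in particular \<open>[n]\<close> indexes the trivial character.\<close>

definition irr_character :: "nat list \<Rightarrow> (nat \<Rightarrow> nat) \<Rightarrow> complex" where
  "irr_character lam p = trace_on (specht_module lam) (perm_act p)"

text \<open>A character is constant on conjugacy classes, so any permutation of cycle type \<open>mu\<close> will
  do.\<close>

definition char_value :: "nat list \<Rightarrow> nat list \<Rightarrow> complex" where
  "char_value lam mu =
    irr_character lam
      (SOME p. p permutes {..<sum_list mu} \<and> cycle_type (sum_list mu) p = mset mu)"

text \<open>Character values of symmetric groups are integers, but live in the complex numbers here.\<close>

definition odd_value :: "complex \<Rightarrow> bool" where
  "odd_value z \<longleftrightarrow> (\<exists>k::int. odd k \<and> z = of_int k)"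

definition D2 :: "nat \<Rightarrow> real" where
  "D2 n =
    real (card {(lam, mu). lam \<in> partitions n \<and> mu \<in> partitions n \<and> odd_value (char_value lam mu)})
    / real (card (partitions n \<times> partitions n))"

end

theory Submission
  imports Defs "HOL-Analysis.Analysis" "HOL-Real_Asymp.Real_Asymp" "HOL-Computational_Algebra.Primes"
begin

text \<open>
  Squaring a permutation does not change the parity of a character value, because
  \<open>tr (A\<^sup>2) \<equiv> (tr A)\<^sup>2\<close> modulo 2 for integral matrices. If some parts of \<open>mu\<close> are of the form
  \<open>2\<^sup>k * m\<close> with \<open>k \<le> j\<close> and \<open>m\<close> odd and add up to \<open>t = 2\<^sup>j * m\<close>, they may therefore be merged into
  one part \<open>t\<close>: after squaring \<open>j\<close> times both permutations have the same cycle type.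

  For fixed \<open>t\<close>, the function \<open>\<tau> \<mapsto> chi lam (c \<circ> \<tau>)\<close>, with \<open>c\<close> a \<open>t\<close>-cycle disjoint from
  \<open>\<tau> \<in> S\<^sub>N\<close>, \<open>N = n - t\<close>, is a generalized character, so its squared norm is an integer; by the
  column orthogonality relations these norms add up, over all \<open>lam\<close>, to roughly \<open>t * p (n - t)\<close>.
  Hence at most that many \<open>lam\<close> have an odd value at such a \<open>mu\<close>, which is a negligible proportion
  once \<open>t\<close> exceeds \<open>(1 + \<epsilon>) * sqrt n * ln n / (2 * \<gamma>)\<close>, \<open>\<gamma> = pi / sqrt 6\<close>, since
  \<open>p (n - k) / p n\<close> is close to \<open>exp (- \<gamma> * k / sqrt n)\<close>. On the other hand, for a typical \<open>mu\<close> and a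
  fixed small \<open>m\<close> the parts \<open>2\<^sup>k * m\<close> add up to about \<open>sqrt n * ln n / (2 * \<gamma> * ln 2)\<close> by a second
  moment argument; as \<open>1 / ln 2 > 4 / 3\<close>, one of \<open>m = 1, 3, 5\<close> admits a power \<open>2\<^sup>j * m\<close> in between.
\<close>

section \<open>Counting integer partitions\<close>

text \<open>Two classical inputs get elementary substitutes. The decay of p (n - k) / p n comes
  without the Hardy-Ramanujan formula: summing n = sum of d * multiplicity over all partitions of n
  gives an approximate difference equation n * y'' = zeta(2) * y for the twice summed partition
  function, and its energy forces y' / y to be close to \<gamma> / sqrt n. Integrality and parity of
  characters come without a basis of standard polytabloids: over the localization of the integers at
  one prime, Gaussian elimination with a pivot of least valuation yields an echelon basis with
  integral entries, and a number that is integral at every prime is an integer. The multipliers 1,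
  3, 5 answer a tight budget. The merged part must exceed half of X = sqrt n * ln n / \<gamma>, the
  available weight is X / (2 * ln 2) > 7 / 10 * X, and powers of 2 alone are a factor 2 apart. With
  1, 3, 5 the gap is 4 / 3, and 3 / 4 * 7 / 10 = 21 / 40 still exceeds 1 / 2; with 1 and 3 alone the
  gap 3 / 2 would leave only 1 / (3 * ln 2) < 1 / 2.\<close>

definition mset_partitions :: "nat \<Rightarrow> nat multiset set" where
  "mset_partitions n = {M. 0 \<notin># M \<and> sum_mset M = n}"

definition num_partitions :: "nat \<Rightarrow> nat" where
  "num_partitions n = card (mset_partitions n)"

lemma bij_betw_mset_partitions: "bij_betw mset (partitions n) (mset_partitions n)"
proof (rule bij_betwI[where g = "\<lambda>M. rev (sorted_list_of_multiset M)"])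
  show "mset \<in> partitions n \<rightarrow> mset_partitions n"
    by (auto simp: partitions_def mset_partitions_def sum_mset_sum_list)
  show "(\<lambda>M. rev (sorted_list_of_multiset M)) \<in> mset_partitions n \<rightarrow> partitions n"
  proof (rule Pi_I)
    fix M assume "M \<in> mset_partitions n"
    moreover have "sorted_wrt (\<ge>) (rev (sorted_list_of_multiset M))"
      by (simp add: sorted_wrt_rev)
    moreover have "sum_list (rev (sorted_list_of_multiset M)) = sum_mset M"
      by (metis mset_rev mset_sorted_list_of_multiset sum_mset_sum_list)
    ultimately show "rev (sorted_list_of_multiset M) \<in> partitions n"
      by (auto simp: partitions_def mset_partitions_def)
  qed
  show "rev (sorted_list_of_multiset (mset lam)) = lam" if "lam \<in> partitions n" for lam
  proof -
    have "sorted (rev lam)"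
      using that by (simp add: partitions_def sorted_wrt_rev)
    then have "sort lam = rev lam"
      by (intro properties_for_sort) auto
    then show ?thesis by simp
  qed
qed auto

lemma finite_partitions: "finite (partitions n)"
proof (rule finite_subset)
  have "length lam \<le> n \<and> set lam \<subseteq> {..n}" if "lam \<in> partitions n" for lam
  proof -
    have "length xs \<le> sum_list xs" if "0 \<notin> set xs" for xs :: "nat list"
      using that by (induction xs) auto
    then show ?thesis
      using that member_le_sum_list[of _ lam] by (auto simp: partitions_def)
  qed
  then show "partitions n \<subseteq> {lam. set lam \<subseteq> {..n} \<and> length lam \<le> n}" by auto
qed (auto intro: finite_lists_length_le)

lemma finite_mset_partitions: "finite (mset_partitions n)"
  using bij_betw_mset_partitions finite_partitions bij_betw_finite by blast

lemma card_partitions: "card (partitions n) = num_partitions n"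
  unfolding num_partitions_def by (rule bij_betw_same_card[OF bij_betw_mset_partitions])

text \<open>Removing the copies of \<open>A\<close> is a bijection onto the partitions of the
  remaining sum, so containing a fixed multiset of parts is an event with an exact count. All
  moments of multiplicities rest on this.\<close>

lemma card_mset_partitions_supset:
  assumes "0 \<notin># A"
  shows "card {M \<in> mset_partitions n. A \<subseteq># M} =
    (if sum_mset A \<le> n then num_partitions (n - sum_mset A) else 0)"
proof (cases "sum_mset A \<le> n")
  case True
  have "bij_betw (\<lambda>M. M + A) (mset_partitions (n - sum_mset A)) {M \<in> mset_partitions n. A \<subseteq># M}"
    by (rule bij_betwI[where g = "\<lambda>M. M - A"])
      (use assms True in \<open>auto simp: mset_partitions_def sum_mset_diff dest: in_diffD\<close>)
  then show ?thesis
    using True by (simp add: num_partitions_def bij_betw_same_card)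
next
  case False
  have "sum_mset A \<le> sum_mset M" if "A \<subseteq># M" for M
    using that by (metis le_add1 subset_mset.add_diff_inverse sum_mset.union)
  then have "{M \<in> mset_partitions n. A \<subseteq># M} = {}"
    using False by (auto simp: mset_partitions_def)
  then show ?thesis using False by (simp only: card.empty if_False)
qed

lemma num_partitions_Suc_ge: "num_partitions n \<le> num_partitions (Suc n)"
proof -
  have "num_partitions n = card {M \<in> mset_partitions (Suc n). {#1#} \<subseteq># M}"
    by (subst card_mset_partitions_supset) auto
  also have "\<dots> \<le> num_partitions (Suc n)"
    unfolding num_partitions_def by (intro card_mono finite_mset_partitions) auto
  finally show ?thesis .
qed

lemma num_partitions_mono: "m \<le> n \<Longrightarrow> num_partitions m \<le> num_partitions n"
  using num_partitions_Suc_ge by (rule lift_Suc_mono_le)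

lemma num_partitions_0: "num_partitions 0 = 1"
proof -
  have "mset_partitions 0 = {{#}}"
    by (auto simp: mset_partitions_def) (metis multiset_nonemptyE)
  then show ?thesis by (simp add: num_partitions_def)
qed

lemma num_partitions_pos: "num_partitions n > 0"
  using num_partitions_mono[of 0 n] num_partitions_0 by simp

text \<open>Continuing by 0 beyond \<open>n\<close> keeps the function antitone on all naturals and
  lets sums over multiples run past \<open>n\<close>.\<close>

definition partitions_shift :: "nat \<Rightarrow> nat \<Rightarrow> real" where
  "partitions_shift n k = (if k \<le> n then real (num_partitions (n - k)) else 0)"

lemma partitions_shift_nonneg: "partitions_shift n k \<ge> 0"
  by (simp add: partitions_shift_def)

lemma partitions_shift_antimono: "k \<le> l \<Longrightarrow> partitions_shift n l \<le> partitions_shift n k"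
  by (auto simp: partitions_shift_def intro: num_partitions_mono)

lemma card_multiplicity_ge:
  assumes "d > 0"
  shows "real (card {M \<in> mset_partitions n. r \<le> count M d}) = partitions_shift n (r * d)"
proof -
  have "{M \<in> mset_partitions n. r \<le> count M d} = {M \<in> mset_partitions n. replicate_mset r d \<subseteq># M}"
    by (simp add: count_le_replicate_mset_subset_eq)
  then show ?thesis
    using assms by (simp add: card_mset_partitions_supset partitions_shift_def)
qed

lemma card_multiplicity2_ge:
  assumes "d > 0" "e > 0" "d \<noteq> e"
  shows "real (card {M \<in> mset_partitions n. r \<le> count M d \<and> s \<le> count M e}) =
    partitions_shift n (r * d + s * e)"
proof -
  have "r \<le> count M d \<and> s \<le> count M e \<longleftrightarrow> replicate_mset r d + replicate_mset s e \<subseteq># M" for M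
  proof
    show "r \<le> count M d \<and> s \<le> count M e" if "replicate_mset r d + replicate_mset s e \<subseteq># M"
      using mset_subset_eq_count[OF that, of d] mset_subset_eq_count[OF that, of e] assms by auto
  qed (use assms in \<open>auto simp: subseteq_mset_def\<close>)
  then have "{M \<in> mset_partitions n. r \<le> count M d \<and> s \<le> count M e} =
      {M \<in> mset_partitions n. replicate_mset r d + replicate_mset s e \<subseteq># M}" by auto
  then show ?thesis
    using assms by (simp add: card_mset_partitions_supset partitions_shift_def)
qed

lemma sum_mset_eq_sum_count:
  fixes M :: "nat multiset"
  assumes "finite S" "set_mset M \<subseteq> S"
  shows "sum_mset M = (\<Sum>d\<in>S. d * count M d)"
  using assms(2)
proof (induction M)
  case (add x M)
  have "(\<Sum>d\<in>S. d * count (add_mset x M) d) = (\<Sum>d\<in>S. d * count M d + (if d = x then x else 0))"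
    by (intro sum.cong) auto
  also have "\<dots> = sum_mset M + x" using add assms(1) by (simp add: sum.distrib)
  finally show ?case by simp
qed simp

lemma sum_mset_partition_eq:
  assumes "M \<in> mset_partitions n"
  shows "n = (\<Sum>d=1..n. d * count M d)" and "count M d \<le> n"
proof -
  have sub: "set_mset M \<subseteq> {1..n}"
  proof
    fix x assume x: "x \<in># M"
    then have "x \<le> sum_mset M" by (metis le_add1 multi_member_split sum_mset.add_mset)
    moreover have "x \<noteq> 0"
      using x assms unfolding mset_partitions_def by (metis (mono_tags) mem_Collect_eq)
    ultimately show "x \<in> {1..n}" using assms by (auto simp: mset_partitions_def)
  qed
  have "n = sum_mset M" using assms by (simp add: mset_partitions_def)
  also have "\<dots> = (\<Sum>d=1..n. d * count M d)"
    using sub by (intro sum_mset_eq_sum_count) auto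
  finally show eq: "n = (\<Sum>d=1..n. d * count M d)" .
  show "count M d \<le> n"
  proof (cases "d \<in># M")
    case True
    then have "d \<in> {1..n}" using sub by auto
    then have "d * count M d \<le> (\<Sum>d=1..n. d * count M d)" by (intro member_le_sum) auto
    then have "d * count M d \<le> n" using eq by simp
    moreover have "1 * count M d \<le> d * count M d"
      using \<open>d \<in> {1..n}\<close> by (intro mult_right_mono) auto
    ultimately show ?thesis by linarith
  qed (simp add: not_in_iff)
qed

text \<open>Layer-cake summation: a multiplicity is the number of \<open>r \<ge> 1\<close> with
  \<open>r \<le> count M d\<close>, and each of these events has an exact count.\<close>

lemma sum_multiplicity:
  assumes "d > 0"
  shows "(\<Sum>M\<in>mset_partitions n. real (count M d)) = (\<Sum>r=1..n. partitions_shift n (r * d))"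
proof -
  have "real (count M d) = (\<Sum>r=1..n. if r \<le> count M d then 1 else 0)"
    if "M \<in> mset_partitions n" for M
  proof -
    have "{r \<in> {1..n}. r \<le> count M d} = {1..count M d}"
      using sum_mset_partition_eq(2)[OF that, of d] by auto
    then show ?thesis by (simp add: sum.If_cases Int_def conj_commute)
  qed
  then have "(\<Sum>M\<in>mset_partitions n. real (count M d)) =
      (\<Sum>M\<in>mset_partitions n. \<Sum>r=1..n. if r \<le> count M d then 1 else 0)"
    by (intro sum.cong) auto
  also have "\<dots> = (\<Sum>r=1..n. \<Sum>M\<in>mset_partitions n. if r \<le> count M d then 1 else 0)"
    by (rule sum.swap)
  also have "\<dots> = (\<Sum>r=1..n. partitions_shift n (r * d))"
    using assms finite_mset_partitions[of n]
    by (intro sum.cong refl) (simp add: card_multiplicity_ge[symmetric] sum.If_cases Int_def)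
  finally show ?thesis .
qed

text \<open>Every partition of n is weighed by n = sum of d * multiplicity. Grouping by k = r * d
  would give Euler's recurrence with the divisor sum; keeping r outside exposes, for each r, a sum
  along the multiples of r that can be compared with the sum over all k.\<close>

lemma num_partitions_recurrence:
  "real n * real (num_partitions n) = (\<Sum>r=1..n. \<Sum>d=1..n. real d * partitions_shift n (r * d))"
proof -
  have "real n * real (num_partitions n) = (\<Sum>M\<in>mset_partitions n. real n)"
    by (simp add: num_partitions_def)
  also have "\<dots> = (\<Sum>M\<in>mset_partitions n. \<Sum>d=1..n. real d * real (count M d))"
  proof (intro sum.cong refl)
    fix M assume "M \<in> mset_partitions n"
    from arg_cong[OF sum_mset_partition_eq(1)[OF this], of real]
    show "real n = (\<Sum>d=1..n. real d * real (count M d))" by simp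
  qed
  also have "\<dots> = (\<Sum>d=1..n. real d * (\<Sum>M\<in>mset_partitions n. real (count M d)))"
    by (subst sum.swap) (simp add: sum_distrib_left)
  also have "\<dots> = (\<Sum>d=1..n. \<Sum>r=1..n. real d * partitions_shift n (r * d))"
    by (intro sum.cong refl) (simp add: sum_multiplicity sum_distrib_left)
  also have "\<dots> = (\<Sum>r=1..n. \<Sum>d=1..n. real d * partitions_shift n (r * d))"
    by (rule sum.swap)
  finally show ?thesis .
qed

section \<open>Sums of an antitone function along the multiples of \<open>r\<close>\<close>

lemma block_le_sum:
  fixes \<phi> :: "nat \<Rightarrow> real"
  assumes "\<And>k l. k \<le> l \<Longrightarrow> \<phi> l \<le> \<phi> k"
  shows "real r * \<phi> (r * Suc m) \<le> (\<Sum>k=m*r..<m*r+r. \<phi> (Suc k))"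
proof -
  have "(\<Sum>k=m*r..<m*r+r. \<phi> (r * Suc m)) \<le> (\<Sum>k=m*r..<m*r+r. \<phi> (Suc k))"
    by (intro sum_mono assms) (auto simp: algebra_simps)
  then show ?thesis by simp
qed

text \<open>Cut the range into blocks m * r + 1, ..., m * r + r: on each, the weight k is at least m
  * r and \<phi> is at least its value at the right end. The weight wanted there is (m + 1) * r; the
  missing r per term is paid for by the plain sum of \<phi>.\<close>

lemma block_sum_upper:
  fixes \<phi> :: "nat \<Rightarrow> real"
  assumes anti: "\<And>k l. k \<le> l \<Longrightarrow> \<phi> l \<le> \<phi> k" and nonneg: "\<And>k. 0 \<le> \<phi> k"
    and zero: "\<And>k. n < k \<Longrightarrow> \<phi> k = 0" and r: "r > 0"
  shows "real r ^ 2 * (\<Sum>d=1..n. real d * \<phi> (r * d)) \<le> (\<Sum>k=1..n. real k * \<phi> k) + real r * (\<Sum>k=1..n. \<phi> k)"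
proof -
  have ext: "(\<Sum>k<n*r. f (Suc k) * \<phi> (Suc k)) = (\<Sum>k=1..n. f k * \<phi> k)" for f :: "nat \<Rightarrow> real"
  proof -
    have "(\<Sum>k<n*r. f (Suc k) * \<phi> (Suc k)) = (\<Sum>k=1..n*r. f k * \<phi> k)"
      by (simp add: sum.atLeast1_atMost_eq)
    also have "\<dots> = (\<Sum>k=1..n. f k * \<phi> k)"
      using zero r by (intro sum.mono_neutral_right) (auto intro: order_trans[of _ n])
    finally show ?thesis .
  qed
  have blk2: "real r ^ 2 * real m * \<phi> (r * Suc m) \<le> (\<Sum>k=m*r..<m*r+r. real (Suc k) * \<phi> (Suc k))" for m
  proof -
    have "real m * real r \<le> real (Suc k)" if "k \<ge> m * r" for k
      using that by (metis le_SucI of_nat_mono of_nat_mult)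
    then have "(\<Sum>k=m*r..<m*r+r. (real m * real r) * \<phi> (r * Suc m)) \<le> (\<Sum>k=m*r..<m*r+r. real (Suc k) * \<phi> (Suc k))"
      by (intro sum_mono mult_mono anti nonneg) (auto simp: algebra_simps)
    then show ?thesis by (simp add: power2_eq_square mult_ac)
  qed
  have "(\<Sum>d=1..n. real d * \<phi> (r * d)) = (\<Sum>m<n. real (Suc m) * \<phi> (r * Suc m))"
    by (simp add: sum.atLeast1_atMost_eq)
  then have "real r ^ 2 * (\<Sum>d=1..n. real d * \<phi> (r * d)) =
      (\<Sum>m<n. real r ^ 2 * real m * \<phi> (r * Suc m)) + real r * (\<Sum>m<n. real r * \<phi> (r * Suc m))"
    by (simp add: sum_distrib_left sum.distrib[symmetric] algebra_simps power2_eq_square)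
  also have "\<dots> \<le> (\<Sum>m<n. \<Sum>k=m*r..<m*r+r. real (Suc k) * \<phi> (Suc k)) + real r * (\<Sum>m<n. \<Sum>k=m*r..<m*r+r. \<phi> (Suc k))"
    by (intro add_mono mult_left_mono sum_mono block_le_sum blk2 anti) auto
  also have "\<dots> = (\<Sum>k=1..n. real k * \<phi> k) + real r * (\<Sum>k=1..n. \<phi> k)"
    using ext[of real] ext[of "\<lambda>_. 1"] by (simp add: sum.nat_group del: of_nat_Suc)
  finally show ?thesis .
qed

text \<open>Blocks now start at a multiple d * r, where \<phi> is largest, and k stays below (d + 1)
  * r. The block d = 0 has no counterpart among r, 2 * r, ... and is estimated directly.\<close>

lemma block_sum_lower:
  fixes \<phi> :: "nat \<Rightarrow> real"
  assumes anti: "\<And>k l. k \<le> l \<Longrightarrow> \<phi> l \<le> \<phi> k" and nonneg: "\<And>k. 0 \<le> \<phi> k"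
    and zero: "\<And>k. n < k \<Longrightarrow> \<phi> k = 0" and r: "r > 0"
  shows "(\<Sum>k=1..n. real k * \<phi> k) \<le> real r ^ 2 * (\<Sum>d=1..n. real d * \<phi> (r * d)) + 2 * real r * (\<Sum>k=1..n. \<phi> k)"
proof -
  have blk0: "(\<Sum>k=1..<r. real k * \<phi> k) \<le> real r * (\<Sum>k=1..n. \<phi> k)"
  proof -
    have "(\<Sum>k=1..<r. real k * \<phi> k) \<le> (\<Sum>k=1..<r. real r * \<phi> k)"
      by (intro sum_mono mult_right_mono nonneg) auto
    also have "\<dots> \<le> (\<Sum>k\<in>{1..<r} \<union> {1..n}. real r * \<phi> k)"
      by (intro sum_mono2) (auto simp: nonneg)
    also have "\<dots> = (\<Sum>k=1..n. real r * \<phi> k)"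
      by (intro sum.mono_neutral_right) (auto simp: zero)
    finally show ?thesis by (simp add: sum_distrib_left)
  qed
  have blk: "(\<Sum>k=d*r..<d*r+r. real k * \<phi> k) \<le> real r ^ 2 * real (Suc d) * \<phi> (r * d)" for d
  proof -
    have "(\<Sum>k=d*r..<d*r+r. real k * \<phi> k) \<le> (\<Sum>k=d*r..<d*r+r. real (Suc d * r) * \<phi> (r * d))"
      by (intro sum_mono mult_mono anti nonneg, simp_all only: of_nat_le_iff)
        (auto simp: mult.commute)
    then show ?thesis by (simp add: power2_eq_square algebra_simps)
  qed
  have small: "real r * (\<Sum>d=1..n. \<phi> (r * d)) \<le> (\<Sum>k=1..n. \<phi> k)"
  proof -
    have "real r * (\<Sum>d=1..n. \<phi> (r * d)) = (\<Sum>m<n. real r * \<phi> (r * Suc m))"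
      by (simp add: sum_distrib_left sum.atLeast1_atMost_eq)
    also have "\<dots> \<le> (\<Sum>m<n. \<Sum>k=m*r..<m*r+r. \<phi> (Suc k))" by (intro sum_mono block_le_sum anti)
    also have "\<dots> = (\<Sum>k=1..n*r. \<phi> k)"
      by (simp add: sum.nat_group sum.atLeast1_atMost_eq)
    also have "\<dots> = (\<Sum>k=1..n. \<phi> k)"
      using zero r by (intro sum.mono_neutral_right) (auto intro: order_trans[of _ n])
    finally show ?thesis .
  qed
  have "(\<Sum>k=1..n. real k * \<phi> k) = (\<Sum>k=1..<Suc n * r. real k * \<phi> k)"
  proof (intro sum.mono_neutral_left)
    have "n < Suc n * r" using r by (cases r) auto
    then show "{1..n} \<subseteq> {1..<Suc n * r}" by auto
  qed (auto simp: zero)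
  also have "\<dots> = (\<Sum>k<Suc n * r. real k * \<phi> k)"
    by (intro sum.mono_neutral_left) auto
  also have "\<dots> = (\<Sum>d<Suc n. \<Sum>k=d*r..<d*r+r. real k * \<phi> k)"
    by (rule sum.nat_group[symmetric])
  also have "\<dots> = (\<Sum>k<r. real k * \<phi> k) + (\<Sum>d=1..n. \<Sum>k=d*r..<d*r+r. real k * \<phi> k)"
    by (subst sum.lessThan_Suc_shift) (simp add: sum.atLeast1_atMost_eq lessThan_atLeast0)
  also have "(\<Sum>k<r. real k * \<phi> k) = (\<Sum>k=1..<r. real k * \<phi> k)"
    by (intro sum.mono_neutral_right) auto
  also have "\<dots> + (\<Sum>d=1..n. \<Sum>k=d*r..<d*r+r. real k * \<phi> k) \<le>
      real r * (\<Sum>k=1..n. \<phi> k) + (\<Sum>d=1..n. real r ^ 2 * real (Suc d) * \<phi> (r * d))"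
    by (intro add_mono blk0 sum_mono blk)
  also have "(\<Sum>d=1..n. real r ^ 2 * real (Suc d) * \<phi> (r * d)) =
      real r ^ 2 * (\<Sum>d=1..n. real d * \<phi> (r * d)) + real r * (real r * (\<Sum>d=1..n. \<phi> (r * d)))"
    by (simp add: sum_distrib_left sum.distrib[symmetric] algebra_simps power2_eq_square)
  also have "real r * (real r * (\<Sum>d=1..n. \<phi> (r * d))) \<le> real r * (\<Sum>k=1..n. \<phi> k)"
    by (intro mult_left_mono small) auto
  finally show ?thesis by simp
qed

definition zeta2 :: real where
  "zeta2 = pi ^ 2 / 6"

text \<open>The tail is dominated by the telescoping series of 1 / x - 1 / (x + 1) = 1 / (x * (x +
  1)).\<close>

lemma zeta2_tail:
  "(\<Sum>r=1..n. 1 / real r ^ 2) \<le> zeta2" (is ?A)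
  "n > 0 \<Longrightarrow> zeta2 \<le> (\<Sum>r=1..n. 1 / real r ^ 2) + 1 / real n" (is "_ \<Longrightarrow> ?B")
proof -
  let ?f = "\<lambda>k. 1 / real (Suc k) ^ 2"
  have sums: "?f sums zeta2" using inverse_squares_sums by (simp add: zeta2_def add.commute)
  then have sm: "summable ?f" and z: "zeta2 = suminf ?f" by (simp_all add: sums_iff)
  have eq: "(\<Sum>r=1..n. 1 / real r ^ 2) = (\<Sum>k<n. ?f k)" for n
    by (simp add: sum.atLeast1_atMost_eq)
  show ?A unfolding eq z by (intro sum_le_suminf sm) auto
  show ?B if "n > 0"
  proof -
    have "(\<Sum>k<n+m. ?f k) \<le> (\<Sum>k<n. ?f k) + (1 / real n - 1 / real (n + m))" for m
    proof (induction m)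
      case (Suc m)
      have "?f (n + m) \<le> 1 / real (n + m) - 1 / real (Suc (n + m))"
      proof -
        have "1 / (x + 1) ^ 2 \<le> 1 / x - 1 / (x + 1)" if "x > 0" for x :: real
        proof -
          have "1 / x - 1 / (x + 1) = 1 / (x * (x + 1))" using that by (simp add: field_simps)
          moreover have "1 / (x + 1) ^ 2 \<le> 1 / (x * (x + 1))"
            using that by (intro divide_left_mono) (auto simp: power2_eq_square)
          ultimately show ?thesis by simp
        qed
        from this[of "real (n + m)"] that show ?thesis by (simp add: add_ac)
      qed
      with Suc show ?case by simp
    qed simp
    then have *: "(\<Sum>k<n+m. ?f k) \<le> (\<Sum>k<n. ?f k) + 1 / real n" for m
      by (smt (verit) divide_nonneg_nonneg of_nat_0_le_iff)
    have "(\<Sum>k<m. ?f k) \<le> (\<Sum>k<n. ?f k) + 1 / real n" for m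
    proof -
      have "(\<Sum>k<m. ?f k) \<le> (\<Sum>k<n+m. ?f k)" by (intro sum_mono2) auto
      with *[of m] show ?thesis by linarith
    qed
    then show ?thesis unfolding eq z by (intro suminf_le_const sm) 
  qed
qed

lemma zeta2_ge_1: "zeta2 \<ge> 1"
  using zeta2_tail(1)[of 1] by simp

section \<open>Iterated sums of the partition function and their difference equation\<close>

definition cum1 :: "nat \<Rightarrow> real" where
  "cum1 n = (\<Sum>j\<le>n. real (num_partitions j))"

text \<open>Shifted by one index, so that the forward difference of \<open>cum2\<close> is
  \<open>cum1\<close> and \<open>cum2 n\<close> equals the sum of k * p (n - k), the quantity that
  the recurrence produces.\<close>

definition cum2 :: "nat \<Rightarrow> real" where
  "cum2 n = (\<Sum>j<n. cum1 j)"

lemma cum1_pos: "cum1 n > 0"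
  unfolding cum1_def by (intro sum_pos) (auto simp: num_partitions_pos)

lemma cum1_Suc: "cum1 (Suc n) = cum1 n + real (num_partitions (Suc n))"
  by (simp add: cum1_def)

lemma cum2_Suc: "cum2 (Suc n) = cum2 n + cum1 n"
  by (simp add: cum2_def)

lemma cum2_pos: "n > 0 \<Longrightarrow> cum2 n > 0"
  unfolding cum2_def by (intro sum_pos) (auto simp: cum1_pos)

lemma sum_partitions_shift: "(\<Sum>k=1..n. partitions_shift n k) = cum1 n - real (num_partitions n)"
proof -
  have "(\<Sum>k\<le>n. real (num_partitions k)) = (\<Sum>k\<le>n. real (num_partitions (n - k)))"
    by (rule sum.nat_diff_reindex[symmetric, of _ "Suc n", unfolded lessThan_Suc_atMost, simplified])
  also have "\<dots> = (\<Sum>k\<le>n. partitions_shift n k)" by (simp add: partitions_shift_def)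
  also have "\<dots> = partitions_shift n 0 + (\<Sum>k=1..n. partitions_shift n k)"
    by (simp add: atMost_atLeast0 sum.atLeast_Suc_atMost)
  finally show ?thesis by (simp add: cum1_def partitions_shift_def)
qed

lemma sum_mult_partitions_shift: "(\<Sum>k=1..n. real k * partitions_shift n k) = cum2 n"
proof (induction n)
  case (Suc n)
  have sh: "partitions_shift (Suc n) (Suc k) = partitions_shift n k" for k
    by (simp add: partitions_shift_def)
  have "(\<Sum>k=1..Suc n. real k * partitions_shift (Suc n) k) = (\<Sum>k=0..n. real (Suc k) * partitions_shift n k)"
    by (simp only: One_nat_def sum.shift_bounds_cl_Suc_ivl sh)
  also have "\<dots> = partitions_shift n 0 + (\<Sum>k=1..n. real k * partitions_shift n k + partitions_shift n k)"
    by (simp add: sum.atLeast_Suc_atMost algebra_simps)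
  also have "\<dots> = cum2 n + cum1 n"
    using sum_partitions_shift[of n] Suc by (simp add: sum.distrib) (simp add: partitions_shift_def)
  finally show ?case by (simp add: cum2_Suc)
qed (simp add: cum2_def)

lemma sum_inverse_le_ln:
  assumes "n > 0" shows "(\<Sum>r=1..n. 1 / real r) \<le> 1 + ln (real n)"
  using assms
proof (induction n rule: nat_induct_non_zero)
  case (Suc n)
  have "ln (real n / real (Suc n)) \<le> real n / real (Suc n) - 1"
    using Suc by (intro ln_le_minus_one) auto
  then have "1 / real (Suc n) \<le> ln (real (Suc n)) - ln (real n)"
    using Suc by (simp add: ln_div field_simps)
  with Suc show ?case by simp
qed simp

text \<open>In the recurrence each inner sum is \<open>cum2 n\<close> / r^2 up to a multiple of
  \<open>cum1 n\<close> / r. The errors add up to a harmonic sum, hence the logarithm; completing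
  the truncated zeta(2) costs at most \<open>cum1 n\<close>, because
  \<open>cum2 n \<le> n * cum1 n\<close>.\<close>

lemma num_partitions_approx:
  assumes "n > 0"
  shows "\<bar>real n * real (num_partitions n) - zeta2 * cum2 n\<bar> \<le> (3 + 2 * ln (real n)) * cum1 n"
proof -
  let ?\<phi> = "partitions_shift n"
  define F where "F = (\<Sum>k=1..n. ?\<phi> k)"
  have F: "F \<le> cum1 n" "F \<ge> 0"
    using sum_partitions_shift[of n] unfolding F_def
    by (linarith, intro sum_nonneg partitions_shift_nonneg)
  have zero: "n < k \<Longrightarrow> ?\<phi> k = 0" for k by (simp add: partitions_shift_def)
  have one: "\<bar>(\<Sum>d=1..n. real d * ?\<phi> (r * d)) - cum2 n / real r ^ 2\<bar> \<le> 2 * F * (1 / real r)"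
    if "r \<in> {1..n}" for r
  proof -
    have r: "r > 0" using that by auto
    have "\<bar>real r ^ 2 * (\<Sum>d=1..n. real d * ?\<phi> (r * d)) - cum2 n\<bar> \<le> 2 * real r * F"
      using block_sum_upper[of ?\<phi> n r, OF partitions_shift_antimono partitions_shift_nonneg zero r]
        block_sum_lower[of ?\<phi> n r, OF partitions_shift_antimono partitions_shift_nonneg zero r]
        mult_nonneg_nonneg[of "real r" F] F(2)
      unfolding sum_mult_partitions_shift F_def[symmetric] by linarith
    then have "\<bar>real r ^ 2 * (\<Sum>d=1..n. real d * ?\<phi> (r * d)) - cum2 n\<bar> / real r ^ 2 \<le> 2 * real r * F / real r ^ 2"
      by (intro divide_right_mono) auto
    also have "\<bar>real r ^ 2 * (\<Sum>d=1..n. real d * ?\<phi> (r * d)) - cum2 n\<bar> / real r ^ 2 =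
        \<bar>(real r ^ 2 * (\<Sum>d=1..n. real d * ?\<phi> (r * d)) - cum2 n) / real r ^ 2\<bar>"
      by simp
    also have "(real r ^ 2 * (\<Sum>d=1..n. real d * ?\<phi> (r * d)) - cum2 n) / real r ^ 2 =
        (\<Sum>d=1..n. real d * ?\<phi> (r * d)) - cum2 n / real r ^ 2"
      using r by (simp add: field_simps)
    finally show ?thesis using r by (simp add: power2_eq_square)
  qed
  have "\<bar>real n * real (num_partitions n) - (\<Sum>r=1..n. cum2 n / real r ^ 2)\<bar> =
      \<bar>\<Sum>r=1..n. (\<Sum>d=1..n. real d * ?\<phi> (r * d)) - cum2 n / real r ^ 2\<bar>"
    by (simp add: num_partitions_recurrence sum_subtractf)
  also have "\<dots> \<le> (\<Sum>r=1..n. 2 * F * (1 / real r))"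
    by (intro order_trans[OF sum_abs] sum_mono one)
  also have "\<dots> = 2 * F * (\<Sum>r=1..n. 1 / real r)" by (rule sum_distrib_left[symmetric])
  also have "\<dots> \<le> 2 * F * (1 + ln (real n))"
    using assms F by (intro mult_left_mono sum_inverse_le_ln) auto
  also have "\<dots> \<le> 2 * cum1 n * (1 + ln (real n))"
    using assms F by (intro mult_right_mono) auto
  finally have 1: "\<bar>real n * real (num_partitions n) - cum2 n * (\<Sum>r=1..n. 1 / real r ^ 2)\<bar> \<le> 2 * cum1 n * (1 + ln (real n))"
    by (simp add: sum_distrib_left)
  have c2: "cum2 n \<le> real n * cum1 n"
  proof -
    have "cum2 n \<le> (\<Sum>j<n. cum1 n)"
      unfolding cum2_def by (intro sum_mono) (auto simp: cum1_def intro!: sum_mono2)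
    then show ?thesis by simp
  qed
  have "\<bar>zeta2 - (\<Sum>r=1..n. 1 / real r ^ 2)\<bar> \<le> 1 / real n"
    using zeta2_tail[of n] assms by auto
  then have "cum2 n * \<bar>zeta2 - (\<Sum>r=1..n. 1 / real r ^ 2)\<bar> \<le> (real n * cum1 n) * (1 / real n)"
    using c2 cum2_pos[OF assms] cum1_pos[of n] by (intro mult_mono) auto
  then have "\<bar>cum2 n * (zeta2 - (\<Sum>r=1..n. 1 / real r ^ 2))\<bar> \<le> cum1 n"
    using assms cum2_pos[OF assms] by (simp add: abs_mult)
  moreover have "real n * real (num_partitions n) - zeta2 * cum2 n =
      (real n * real (num_partitions n) - cum2 n * (\<Sum>r=1..n. 1 / real r ^ 2))
      - cum2 n * (zeta2 - (\<Sum>r=1..n. 1 / real r ^ 2))"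
    by (simp add: right_diff_distrib mult.commute)
  moreover have "(3 + 2 * ln (real n)) * cum1 n = 2 * cum1 n * (1 + ln (real n)) + cum1 n"
    by (simp add: algebra_simps)
  ultimately show ?thesis using 1 by linarith
qed

text \<open>The discrete form of multiplying n * y'' = zeta(2) * y by 2 * y'. The cross term
  \<open>zeta2 * cum2 n * cum1 n\<close> is what summation by parts demands: with it the increment
  is exactly \<open>e * (2 * a + p) + a ^ 2\<close>, where \<open>e\<close> is the error of the
  difference equation. Fixing \<open>N\<close> lets one logarithm serve all steps.\<close>

lemma cum_energy_aux:
  assumes "N > 0" "n \<le> N"
  shows "\<bar>real n * cum1 n ^ 2 - zeta2 * cum2 n ^ 2 - zeta2 * cum2 n * cum1 n\<bar>
    \<le> (7 + 4 * ln (real N)) * (\<Sum>j\<le>n. cum1 j ^ 2)"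
  using assms(2)
proof (induction n)
  case 0
  have "ln (real N) \<ge> 0" using assms by simp
  then show ?case by (simp add: cum2_def)
next
  case (Suc n)
  define p where "p = real (num_partitions (Suc n))"
  define e where "e = real (Suc n) * p - zeta2 * cum2 (Suc n)"
  define a where "a = cum1 n"
  define b where "b = cum2 n"
  have a: "cum1 (Suc n) = a + p" by (simp add: a_def p_def cum1_Suc)
  have b: "cum2 (Suc n) = b + a" by (simp add: a_def b_def cum2_Suc)
  have pos: "a > 0" "p \<ge> 0" by (auto simp: a_def p_def cum1_pos)
  have "ln (real (Suc n)) \<le> ln (real N)" using Suc.prems by (subst ln_le_cancel_iff) auto
  then have "\<bar>e\<bar> \<le> (3 + 2 * ln (real N)) * (a + p)"
    using num_partitions_approx[of "Suc n"] pos unfolding e_def p_def[symmetric] a b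
    by (smt (verit) mult_right_mono zero_less_Suc)
  then have "\<bar>e * (2 * a + p)\<bar> \<le> ((3 + 2 * ln (real N)) * (a + p)) * (2 * (a + p))"
    unfolding abs_mult using pos by (intro mult_mono) auto
  also have "\<dots> = (6 + 4 * ln (real N)) * (a + p) ^ 2" by (simp add: algebra_simps power2_eq_square)
  finally have 1: "\<bar>e * (2 * a + p)\<bar> \<le> (6 + 4 * ln (real N)) * (a + p) ^ 2" .
  have 2: "a ^ 2 \<le> (a + p) ^ 2" "0 \<le> a ^ 2" using pos by (auto intro: power_mono)
  have "real (Suc n) * (a + p) ^ 2 - zeta2 * (b + a) ^ 2 - zeta2 * (b + a) * (a + p) =
     (real n * a ^ 2 - zeta2 * b ^ 2 - zeta2 * b * a) + (e * (2 * a + p) + a ^ 2)"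
    unfolding e_def b by (simp add: algebra_simps power2_eq_square)
  moreover have "\<bar>real n * a ^ 2 - zeta2 * b ^ 2 - zeta2 * b * a\<bar> \<le> (7 + 4 * ln (real N)) * (\<Sum>j\<le>n. cum1 j ^ 2)"
    using Suc unfolding a_def b_def by auto
  moreover have "(7 + 4 * ln (real N)) * (\<Sum>j\<le>Suc n. cum1 j ^ 2) =
      (7 + 4 * ln (real N)) * (\<Sum>j\<le>n. cum1 j ^ 2) + ((6 + 4 * ln (real N)) * (a + p) ^ 2 + (a + p) ^ 2)"
    by (simp add: a algebra_simps)
  ultimately show ?case unfolding a b using 1 2 by linarith
qed

text \<open>The quantity \<open>n * cum1 n ^ 2 - zeta2 * cum2 n ^ 2\<close> is a conserved energy, up to lower order
  terms, of the difference equation \<open>n * cum2'' = zeta2 * cum2\<close>.\<close>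

lemma cum_energy:
  assumes "n > 0"
  shows "\<bar>real n * (cum1 n / cum2 n) ^ 2 - zeta2\<bar>
    \<le> (zeta2 + 7 + 4 * ln (real n)) * (cum1 n / cum2 n + (cum1 n / cum2 n) ^ 2)"
proof -
  have pos: "cum1 n > 0" "cum2 n > 0" using cum1_pos cum2_pos assms by auto
  have ln: "ln (real n) \<ge> 0" using assms by simp
  have "(\<Sum>j\<le>n. cum1 j ^ 2) \<le> (\<Sum>j\<le>n. cum1 n * cum1 j)"
    unfolding power2_eq_square
    by (intro sum_mono mult_right_mono) (auto simp: cum1_def intro!: sum_mono2 sum_nonneg)
  also have "\<dots> = cum1 n * (cum2 n + cum1 n)"
    by (simp add: sum_distrib_left[symmetric] cum2_def lessThan_Suc_atMost[symmetric])
  finally have "\<bar>real n * cum1 n ^ 2 - zeta2 * cum2 n ^ 2 - zeta2 * cum2 n * cum1 n\<bar>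
      \<le> (7 + 4 * ln (real n)) * (cum1 n * (cum2 n + cum1 n))"
    using ln by (intro order_trans[OF cum_energy_aux[OF assms order.refl]] mult_left_mono) auto
  moreover have "0 \<le> zeta2 * (cum2 n * cum1 n)" "0 \<le> zeta2 * (cum1 n * cum1 n)"
    using zeta2_ge_1 pos by auto
  moreover have "(zeta2 + 7 + 4 * ln (real n)) * (cum1 n * cum2 n + cum1 n ^ 2) =
    (7 + 4 * ln (real n)) * (cum1 n * (cum2 n + cum1 n)) + zeta2 * (cum2 n * cum1 n) + zeta2 * (cum1 n * cum1 n)"
    by (simp add: algebra_simps power2_eq_square)
  ultimately have "\<bar>real n * cum1 n ^ 2 - zeta2 * cum2 n ^ 2\<bar>
      \<le> (zeta2 + 7 + 4 * ln (real n)) * (cum1 n * cum2 n + cum1 n ^ 2)"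
    by (simp add: mult.assoc)
  then have "\<bar>real n * cum1 n ^ 2 - zeta2 * cum2 n ^ 2\<bar> / cum2 n ^ 2
      \<le> (zeta2 + 7 + 4 * ln (real n)) * (cum1 n * cum2 n + cum1 n ^ 2) / cum2 n ^ 2"
    by (intro divide_right_mono) auto
  moreover have "\<bar>real n * cum1 n ^ 2 - zeta2 * cum2 n ^ 2\<bar> / cum2 n ^ 2 =
      \<bar>(real n * cum1 n ^ 2 - zeta2 * cum2 n ^ 2) / cum2 n ^ 2\<bar>" by simp
  moreover have "(real n * cum1 n ^ 2 - zeta2 * cum2 n ^ 2) / cum2 n ^ 2 = real n * (cum1 n / cum2 n) ^ 2 - zeta2"
    using pos by (simp add: field_simps power2_eq_square)
  moreover have "(cum1 n * cum2 n + cum1 n ^ 2) / cum2 n ^ 2 = cum1 n / cum2 n + (cum1 n / cum2 n) ^ 2"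
    using pos by (simp add: field_simps power2_eq_square)
  ultimately show ?thesis by (metis times_divide_eq_right)
qed

lemma cum_ratio_tendsto: "(\<lambda>n. sqrt (real n) * (cum1 n / cum2 n)) \<longlonglongrightarrow> sqrt zeta2"
proof -
  define z where "z = (\<lambda>n. sqrt (real n) * (cum1 n / cum2 n))"
  define \<epsilon> where "\<epsilon> = (\<lambda>n. (zeta2 + 7 + 4 * ln (real n)) / sqrt (real n))"
  have \<epsilon>0: "\<epsilon> \<longlonglongrightarrow> 0" unfolding \<epsilon>_def by real_asymp
  have bound: "\<bar>z n ^ 2 - zeta2\<bar> \<le> \<epsilon> n * (z n + z n ^ 2)" and znn: "z n \<ge> 0" and enn: "\<epsilon> n \<ge> 0"
    if "n > 0" for n
  proof -
    define y where "y = cum1 n / cum2 n"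
    define s where "s = sqrt (real n)"
    have s: "s \<ge> 1" "s ^ 2 = real n" using that by (auto simp: s_def)
    have y: "y \<ge> 0" using cum1_pos[of n] cum2_pos[OF that] by (simp add: y_def)
    have D: "zeta2 + 7 + 4 * ln (real n) \<ge> 0" using zeta2_ge_1 that by (smt (verit) ln_ge_zero of_nat_1 of_nat_mono Suc_leI One_nat_def)
    have z: "z n = s * y" by (simp add: z_def s_def y_def)
    show "z n \<ge> 0" using s y z by simp
    show "\<epsilon> n \<ge> 0" using D by (simp add: \<epsilon>_def)
    have "\<bar>z n ^ 2 - zeta2\<bar> \<le> (zeta2 + 7 + 4 * ln (real n)) * (y + y ^ 2)"
      using cum_energy[OF that] s(2) unfolding z y_def[symmetric] by (simp add: power_mult_distrib)
    also have "y + y ^ 2 \<le> (z n + z n ^ 2) / s"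
    proof -
      have "y ^ 2 * 1 \<le> y ^ 2 * s" using s by (intro mult_left_mono) auto
      then show ?thesis using s unfolding z by (simp add: field_simps power2_eq_square)
    qed
    finally show "\<bar>z n ^ 2 - zeta2\<bar> \<le> \<epsilon> n * (z n + z n ^ 2)"
      using D by (simp add: \<epsilon>_def s_def mult_left_mono)
  qed
  \<comment> \<open>Bootstrapping: once \<epsilon> is below 1 / 4, the estimate itself bounds z^2 by
    2 * (zeta2 + 1), and reinserting this makes the right-hand side tend to 0.\<close>
  have ev: "\<forall>\<^sub>F n in sequentially. \<bar>z n ^ 2 - zeta2\<bar> \<le> \<epsilon> n * (1 + 4 * (zeta2 + 1))"
    using eventually_gt_at_top[of 0] order_tendstoD(2)[OF \<epsilon>0, of "1/4", simplified]
  proof eventually_elim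
    case (elim n)
    have z1: "z n \<le> (1 + z n ^ 2) / 2" using zero_le_power2[of "z n - 1"] by (simp add: power2_eq_square algebra_simps)
    have "\<epsilon> n * (z n + z n ^ 2) \<le> \<epsilon> n * (1 + 2 * z n ^ 2)"
    proof (rule mult_left_mono[OF _ enn[OF elim(1)]])
      show "z n + z n ^ 2 \<le> 1 + 2 * z n ^ 2" using z1 zero_le_power2[of "z n"] by argo
    qed
    then have 1: "\<bar>z n ^ 2 - zeta2\<bar> \<le> \<epsilon> n * (1 + 2 * z n ^ 2)" using bound[OF elim(1)] by linarith
    also have "\<dots> \<le> (1 / 4) * (1 + 2 * z n ^ 2)" using elim by (intro mult_right_mono) auto
    finally have "z n ^ 2 \<le> 2 * (zeta2 + 1)" by (simp add: algebra_simps)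
    then have "\<epsilon> n * (1 + 2 * z n ^ 2) \<le> \<epsilon> n * (1 + 4 * (zeta2 + 1))"
      using enn[OF elim(1)] by (intro mult_left_mono) auto
    with 1 show ?case by linarith
  qed
  have "(\<lambda>n. z n ^ 2 - zeta2) \<longlonglongrightarrow> 0"
    by (rule Lim_null_comparison[of _ "\<lambda>n. \<epsilon> n * (1 + 4 * (zeta2 + 1))"])
      (use ev \<epsilon>0 in \<open>auto intro: tendsto_mult_left_zero\<close>)
  then have "(\<lambda>n. z n ^ 2) \<longlonglongrightarrow> zeta2" by (simp add: LIM_zero_iff)
  then have "(\<lambda>n. sqrt (z n ^ 2)) \<longlonglongrightarrow> sqrt zeta2" by (rule tendsto_real_sqrt)
  moreover have "\<forall>\<^sub>F n in sequentially. sqrt (z n ^ 2) = z n"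
    using eventually_gt_at_top[of 0] by eventually_elim (use znn in auto)
  ultimately show ?thesis unfolding z_def by (rule Lim_transform_eventually)
qed

text \<open>Dividing the difference equation by \<open>cum2 n\<close> leaves an error of order ln n
  * \<open>cum1 n\<close> / \<open>cum2 n\<close>, that is ln n / sqrt n. From here on p n may be
  replaced by zeta2 * \<open>cum2 n\<close> / n.\<close>

lemma num_partitions_cum2_tendsto: "(\<lambda>n. real n * real (num_partitions n) / cum2 n) \<longlonglongrightarrow> zeta2"
proof -
  have "(\<lambda>n. real n * real (num_partitions n) / cum2 n - zeta2) \<longlonglongrightarrow> 0"
  proof (rule Lim_null_comparison)
    show "\<forall>\<^sub>F n in sequentially. norm (real n * real (num_partitions n) / cum2 n - zeta2)
        \<le> (3 + 2 * ln (real n)) / sqrt (real n) * (sqrt (real n) * (cum1 n / cum2 n))"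
      using eventually_gt_at_top[of 0]
    proof eventually_elim
      case (elim n)
      have pos: "cum2 n > 0" using cum2_pos elim by auto
      have "\<bar>real n * real (num_partitions n) / cum2 n - zeta2\<bar> = \<bar>(real n * real (num_partitions n) - zeta2 * cum2 n) / cum2 n\<bar>"
        using pos by (simp add: field_simps)
      also have "\<dots> = \<bar>real n * real (num_partitions n) - zeta2 * cum2 n\<bar> / cum2 n"
        using pos by simp
      also have "\<dots> \<le> (3 + 2 * ln (real n)) * cum1 n / cum2 n"
        using pos num_partitions_approx[OF elim] by (intro divide_right_mono) auto
      finally show ?case using elim by simp
    qed
    have "(\<lambda>n. (3 + 2 * ln (real n)) / sqrt (real n)) \<longlonglongrightarrow> 0" by real_asymp
    from tendsto_mult[OF this cum_ratio_tendsto]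
    show "(\<lambda>n. (3 + 2 * ln (real n)) / sqrt (real n) * (sqrt (real n) * (cum1 n / cum2 n))) \<longlonglongrightarrow> 0" by simp
  qed
  then show ?thesis by (simp add: LIM_zero_iff)
qed

text \<open>The constant \<gamma> = pi / sqrt 6 of the overview.\<close>

definition part_rate :: real where
  "part_rate = sqrt zeta2"

lemma part_rate_ge_1: "part_rate \<ge> 1"
  using zeta2_ge_1 by (simp add: part_rate_def)

text \<open>\<open>cum2 (n + 1)\<close> is \<open>cum2 n\<close> times 1 + \<open>cum1 n\<close> /
  \<open>cum2 n\<close>, so the logarithm is one step of ln \<open>cum2\<close>. Adding such steps
  takes the place of an explicit asymptotic formula.\<close>

lemma cum2_log_step_tendsto: "(\<lambda>n. sqrt (real n) * ln (1 + cum1 n / cum2 n)) \<longlonglongrightarrow> part_rate"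
proof -
  define y where "y = (\<lambda>n. cum1 n / cum2 n)"
  have t: "(\<lambda>n. sqrt (real n) * y n) \<longlonglongrightarrow> part_rate"
    using cum_ratio_tendsto by (simp add: y_def part_rate_def)
  have "(\<lambda>n. 1 / sqrt (real n)) \<longlonglongrightarrow> 0" by real_asymp
  from tendsto_mult[OF this t] have "(\<lambda>n. (1 / sqrt (real n)) * (sqrt (real n) * y n)) \<longlonglongrightarrow> 0" by simp
  then have y0: "y \<longlonglongrightarrow> 0"
  proof (rule Lim_transform_eventually)
    show "\<forall>\<^sub>F n in sequentially. (1 / sqrt (real n)) * (sqrt (real n) * y n) = y n"
      using eventually_gt_at_top[of 0] by eventually_elim auto
  qed
  have t2: "(\<lambda>n. sqrt (real n) * y n - sqrt (real n) * y n * y n) \<longlonglongrightarrow> part_rate"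
    using tendsto_diff[OF t tendsto_mult[OF t y0]] by simp
  have pos: "y n > 0" if "n > 0" for n using cum1_pos cum2_pos that by (simp add: y_def)
  have lo: "\<forall>\<^sub>F n in sequentially. sqrt (real n) * y n - sqrt (real n) * y n * y n \<le> sqrt (real n) * ln (1 + y n)"
    using eventually_gt_at_top[of 0] order_tendstoD(2)[OF y0, of 1, simplified]
  proof eventually_elim
    case (elim n)
    then have "y n - y n ^ 2 \<le> ln (1 + y n)"
      using pos[OF elim(1)] by (intro ln_one_plus_pos_lower_bound) auto
    from mult_left_mono[OF this, of "sqrt (real n)"] show ?case
      by (simp add: algebra_simps power2_eq_square)
  qed
  have hi: "\<forall>\<^sub>F n in sequentially. sqrt (real n) * ln (1 + y n) \<le> sqrt (real n) * y n"
    using eventually_gt_at_top[of 0]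
    by eventually_elim (intro mult_left_mono ln_add_one_self_le_self less_imp_le[OF pos], auto)
  show ?thesis using tendsto_sandwich[OF lo hi t2 t] by (simp add: y_def)
qed

text \<open>Replace p by \<open>cum2\<close> and telescope the logarithmic steps from m = n - k to
  n. Up to \<delta> each step lies between \<gamma> / sqrt n and \<gamma> / sqrt m, which is why the
  two bounds carry different square roots. Only n - k must be large, so k may be of order sqrt n *
  ln n, as the decay estimate requires.\<close>

lemma num_partitions_ratio_bounds:
  assumes \<delta>: "0 < \<delta>" "\<delta> < 1"
  obtains n0 where "n0 > 0"
    and "\<And>n k. k \<le> n \<Longrightarrow> n0 \<le> n - k \<Longrightarrow> real (num_partitions (n - k)) / real (num_partitions n)
      \<le> (1 + \<delta>) * (real n / real (n - k)) * exp (- ((part_rate - \<delta>) * real k / sqrt (real n)))"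
    and "\<And>n k. k \<le> n \<Longrightarrow> n0 \<le> n - k \<Longrightarrow> real (num_partitions (n - k)) / real (num_partitions n)
      \<ge> (1 - \<delta>) * exp (- ((part_rate + \<delta>) * real k / sqrt (real (n - k))))"
proof -
  \<comment> \<open>A third of \<delta> suffices: (1 + \<eta>) / (1 - \<eta>) stays below 1 +
    \<delta> and its reciprocal above 1 - \<delta>.\<close>
  define \<eta> where "\<eta> = \<delta> / 3"
  have \<eta>: "0 < \<eta>" "\<eta> < 1" using \<delta> by (auto simp: \<eta>_def)
  define u where "u = (\<lambda>n. real n * real (num_partitions n) / cum2 n)"
  have Z: "zeta2 > 0" using zeta2_ge_1 by simp
  have "\<forall>\<^sub>F n in sequentially. n > 0 \<and> part_rate - \<delta> < sqrt (real n) * ln (1 + cum1 n / cum2 n) \<and>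
      sqrt (real n) * ln (1 + cum1 n / cum2 n) < part_rate + \<delta> \<and>
      zeta2 * (1 - \<eta>) < u n \<and> u n < zeta2 * (1 + \<eta>)"
    unfolding u_def
    by (intro eventually_conj eventually_gt_at_top order_tendstoD[OF cum2_log_step_tendsto]
        order_tendstoD[OF num_partitions_cum2_tendsto]) (use \<delta> \<eta> Z in auto)
  then obtain n0 where n0: "\<And>n. n \<ge> n0 \<Longrightarrow> n > 0 \<and> part_rate - \<delta> < sqrt (real n) * ln (1 + cum1 n / cum2 n) \<and>
      sqrt (real n) * ln (1 + cum1 n / cum2 n) < part_rate + \<delta> \<and>
      zeta2 * (1 - \<eta>) < u n \<and> u n < zeta2 * (1 + \<eta>)"
    unfolding eventually_sequentially by blast
  have step: "cum2 (Suc n) = cum2 n * exp (ln (1 + cum1 n / cum2 n))" if "n \<ge> n0" for n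
  proof -
    have p: "cum1 n > 0" "cum2 n > 0" using cum1_pos cum2_pos n0[OF that] by auto
    then have "1 + cum1 n / cum2 n > 0" by (simp add: add_pos_pos)
    then show ?thesis using p by (simp add: cum2_Suc distrib_left)
  qed
  have up: "cum2 (m + j) \<ge> cum2 m * exp ((part_rate - \<delta>) * real j / sqrt (real (m + k)))"
    if "m \<ge> n0" "j \<le> k" for m j k
    using that(2)
  proof (induction j)
    case (Suc j)
    have pos: "m + j > 0" "cum2 (m + j) > 0" "cum2 m > 0" using n0[of m] that cum2_pos[of "m+j"] cum2_pos[of m] by auto
    have "(part_rate - \<delta>) / sqrt (real (m + k)) \<le> (part_rate - \<delta>) / sqrt (real (m + j))"
      using pos Suc.prems part_rate_ge_1 \<delta> by (intro divide_left_mono) auto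
    also have "\<dots> \<le> ln (1 + cum1 (m + j) / cum2 (m + j))"
      using n0[of "m + j"] that pos by (subst pos_divide_le_eq) (auto simp: mult.commute)
    finally have st: "(part_rate - \<delta>) / sqrt (real (m + k)) \<le> ln (1 + cum1 (m + j) / cum2 (m + j))" .
    have "cum2 m * exp ((part_rate - \<delta>) * real (Suc j) / sqrt (real (m + k))) =
       (cum2 m * exp ((part_rate - \<delta>) * real j / sqrt (real (m + k)))) * exp ((part_rate - \<delta>) / sqrt (real (m + k)))"
      by (simp add: exp_add[symmetric] add_divide_distrib[symmetric] algebra_simps)
    also have "\<dots> \<le> cum2 (m + j) * exp (ln (1 + cum1 (m + j) / cum2 (m + j)))"
      using st Suc pos by (intro mult_mono) auto
    also have "\<dots> = cum2 (m + Suc j)" using step[of "m + j"] that by simp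
    finally show ?case .
  qed simp
  have lo: "cum2 (m + j) \<le> cum2 m * exp ((part_rate + \<delta>) * real j / sqrt (real m))"
    if "m \<ge> n0" for m j
  proof (induction j)
    case (Suc j)
    have pos: "m > 0" "m + j > 0" "cum2 (m + j) > 0" "cum2 m > 0" using n0[of m] that cum2_pos[of "m+j"] cum2_pos[of m] by auto
    have "ln (1 + cum1 (m + j) / cum2 (m + j)) \<le> (part_rate + \<delta>) / sqrt (real (m + j))"
      using n0[of "m + j"] that pos by (subst pos_le_divide_eq) (auto simp: mult.commute)
    also have "\<dots> \<le> (part_rate + \<delta>) / sqrt (real m)"
      using pos part_rate_ge_1 \<delta> by (intro divide_left_mono) auto
    finally have st: "ln (1 + cum1 (m + j) / cum2 (m + j)) \<le> (part_rate + \<delta>) / sqrt (real m)" .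
    have "cum2 (m + Suc j) = cum2 (m + j) * exp (ln (1 + cum1 (m + j) / cum2 (m + j)))"
      using step[of "m + j"] that by simp
    also have "\<dots> \<le> (cum2 m * exp ((part_rate + \<delta>) * real j / sqrt (real m))) * exp ((part_rate + \<delta>) / sqrt (real m))"
      using st Suc pos by (intro mult_mono) auto
    also have "\<dots> = cum2 m * exp ((part_rate + \<delta>) * real (Suc j) / sqrt (real m))"
      by (simp add: exp_add[symmetric] add_divide_distrib[symmetric] algebra_simps)
    finally show ?case .
  qed simp
  have ratio: "real (num_partitions m) / real (num_partitions (m + k)) =
      (u m / u (m + k)) * (real (m + k) / real m) * (cum2 m / cum2 (m + k))" if "m \<ge> n0" for m k
  proof -
    have "p / P = ((a * p / c) / (b * P / d)) * (b / a) * (c / d)"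
      if "a > 0" "b > 0" "c > 0" "d > 0" "P > 0" for a b c d p P :: real
      using that by simp
    then show ?thesis
      unfolding u_def by this
        (use n0[of m] that cum2_pos[of m] cum2_pos[of "m + k"] num_partitions_pos[of "m + k"] in auto)
  qed
  have \<eta>1: "(1 + \<eta>) / (1 - \<eta>) \<le> 1 + \<delta>"
  proof -
    have "\<delta> * \<delta> \<le> \<delta> * 1" using \<delta> by (intro mult_left_mono) auto
    then show ?thesis using \<delta> by (simp add: \<eta>_def field_simps)
  qed
  have \<eta>2: "1 - \<delta> \<le> (1 - \<eta>) / (1 + \<eta>)"
    using \<delta> by (simp add: \<eta>_def field_simps)
  have inv1: "x / y \<le> inverse E" if "x * E \<le> y" "y > 0" "E > 0" for x y E :: real
    using that by (simp add: field_simps)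
  have inv2: "x / y \<ge> inverse E" if "y \<le> x * E" "y > 0" "E > 0" for x y E :: real
    using that by (simp add: field_simps)
  show thesis
  proof
    show "n0 + 1 > 0" by simp
  next
    fix n k assume k: "k \<le> n" "n0 + 1 \<le> n - k"
    define m where "m = n - k"
    have n: "n = m + k" "m \<ge> n0" "m > 0" "m + k \<ge> n0" using k by (auto simp: m_def)
    have c: "cum2 m > 0" "cum2 (m + k) > 0" using n cum2_pos by auto
    have u: "u m > 0" "u (m + k) > 0" using n0[OF n(2)] n0[OF n(4)] Z \<eta> by (smt (verit) mult_pos_pos)+
    have "u m / u (m + k) \<le> (zeta2 * (1 + \<eta>)) / (zeta2 * (1 - \<eta>))"
      using n0[OF n(2)] n0[OF n(4)] u Z \<eta> by (intro frac_le) auto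
    then have u1: "u m / u (m + k) \<le> 1 + \<delta>" using Z \<eta>1 by simp
    have "u m / u (m + k) \<ge> (zeta2 * (1 - \<eta>)) / (zeta2 * (1 + \<eta>))"
      using n0[OF n(2)] n0[OF n(4)] u Z \<eta> by (intro frac_le) auto
    then have u2: "u m / u (m + k) \<ge> 1 - \<delta>" using Z \<eta>2 by simp
    have "cum2 m / cum2 (m + k) \<le> exp (- ((part_rate - \<delta>) * real k / sqrt (real (m + k))))"
      unfolding exp_minus by (rule inv1[OF up[OF n(2) order.refl] c(2)]) simp
    then have "(u m / u (m + k)) * (real (m + k) / real m) * (cum2 m / cum2 (m + k)) \<le>
        (1 + \<delta>) * (real (m + k) / real m) * exp (- ((part_rate - \<delta>) * real k / sqrt (real (m + k))))"
      using u c \<delta> u1 by (intro mult_mono) auto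
    then show "real (num_partitions (n - k)) / real (num_partitions n)
      \<le> (1 + \<delta>) * (real n / real (n - k)) * exp (- ((part_rate - \<delta>) * real k / sqrt (real n)))"
      using ratio[OF n(2), of k] by (simp add: n(1))
    have "cum2 m / cum2 (m + k) \<ge> exp (- ((part_rate + \<delta>) * real k / sqrt (real m)))"
      unfolding exp_minus by (rule inv2[OF lo[OF n(2)] c(2)]) simp
    moreover have "real (m + k) / real m \<ge> 1" using n by simp
    ultimately have "(u m / u (m + k)) * (real (m + k) / real m) * (cum2 m / cum2 (m + k)) \<ge>
        (1 - \<delta>) * 1 * exp (- ((part_rate + \<delta>) * real k / sqrt (real m)))"
      using u c \<delta> u2 by (intro mult_mono) auto
    then show "real (num_partitions (n - k)) / real (num_partitions n)
      \<ge> (1 - \<delta>) * exp (- ((part_rate + \<delta>) * real k / sqrt (real (n - k))))"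
      using ratio[OF n(2), of k] by (simp add: n(1))
  qed
qed

section \<open>Doubling blocks in random partitions\<close>

text \<open>The probability that a uniformly random partition of \<open>n\<close> contains a
  prescribed multiset of positive parts with sum \<open>k\<close>; it depends on \<open>k\<close>
  alone.\<close>

definition part_ratio :: "nat \<Rightarrow> nat \<Rightarrow> real" where
  "part_ratio n k = partitions_shift n k / real (num_partitions n)"

text \<open>For k of order sqrt n the ratio n / (n - k) tends to 1 uniformly in k, so both bounds
  can be written with sqrt n.\<close>

lemma part_ratio_window:
  assumes \<delta>: "0 < \<delta>" "\<delta> < 1" and K: "K > 0"
  shows "\<forall>\<^sub>F n in sequentially. \<forall>k. real k \<le> K * sqrt (real n) \<longrightarrow>
    (1 - \<delta>) * exp (- ((part_rate + \<delta>) * real k / sqrt (real n))) \<le> part_ratio n k \<and>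
    part_ratio n k \<le> (1 + \<delta>) * exp (- ((part_rate - \<delta>) * real k / sqrt (real n)))"
proof -
  define c where "c = part_rate"
  have c: "c \<ge> 1" using part_rate_ge_1 by (simp add: c_def)
  \<comment> \<open>Chosen so that (c + \<delta> / 3) * (1 + \<epsilon>) stays below c + \<delta>,
    which absorbs the passage from sqrt (n - k) to sqrt n.\<close>
  define \<epsilon> where "\<epsilon> = \<delta> / (3 * (c + 1))"
  have \<epsilon>: "0 < \<epsilon>" "\<epsilon> \<le> \<delta> / 3" "\<epsilon> \<le> 1" "\<epsilon> * (c + 1) = \<delta> / 3"
  proof -
    show "0 < \<epsilon>" using \<delta> c by (simp add: \<epsilon>_def)
    show "\<epsilon> \<le> \<delta> / 3" unfolding \<epsilon>_def using \<delta> c by (intro divide_left_mono) auto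
    then show "\<epsilon> \<le> 1" using \<delta> by auto
    show "\<epsilon> * (c + 1) = \<delta> / 3" using c by (simp add: \<epsilon>_def field_simps)
  qed
  from \<delta> have "0 < \<delta> / 3" "\<delta> / 3 < 1" by auto
  then obtain n0 where n0: "n0 > 0"
    and up: "\<And>n k. k \<le> n \<Longrightarrow> n0 \<le> n - k \<Longrightarrow> real (num_partitions (n - k)) / real (num_partitions n)
      \<le> (1 + \<delta> / 3) * (real n / real (n - k)) * exp (- ((c - \<delta> / 3) * real k / sqrt (real n)))"
    and lo: "\<And>n k. k \<le> n \<Longrightarrow> n0 \<le> n - k \<Longrightarrow> real (num_partitions (n - k)) / real (num_partitions n)
      \<ge> (1 - \<delta> / 3) * exp (- ((c + \<delta> / 3) * real k / sqrt (real (n - k))))"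
    unfolding c_def using num_partitions_ratio_bounds[of "\<delta> / 3"] by metis
  have "\<forall>\<^sub>F n in sequentially. 2 * (K * sqrt (real n)) \<le> \<epsilon> * real n"
    using \<epsilon>(1) K by real_asymp
  moreover have "\<forall>\<^sub>F n in sequentially. real n0 + K * sqrt (real n) \<le> real n"
    using K by real_asymp
  ultimately show ?thesis using eventually_gt_at_top[of 0]
  proof eventually_elim
    case (elim n)
    show ?case
    proof (intro allI impI)
      fix k :: nat assume k: "real k \<le> K * sqrt (real n)"
      have kn: "n0 + k \<le> n" using elim(2) k by linarith
      then have m: "k \<le> n" "n0 \<le> n - k" "n - k > 0" using n0 by auto
      define m' where "m' = real (n - k)"
      have m': "m' = real n - real k" "m' > 0" "m' \<le> real n" using m by (auto simp: m'_def)
      define s where "s = sqrt (real n)"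
      have s: "s > 0" using elim(3) by (simp add: s_def)
      have "2 * real k \<le> \<epsilon> * real n" using k elim(1) by linarith
      moreover have "\<epsilon> * real k \<le> 1 * real k" using \<epsilon> by (intro mult_right_mono) auto
      moreover have "\<epsilon> * m' = \<epsilon> * real n - \<epsilon> * real k" by (simp add: m'(1) right_diff_distrib)
      ultimately have "real n \<le> (1 + \<epsilon>) * m'" using m'(1) by (simp add: distrib_right)
      then have r1: "real n / m' \<le> 1 + \<epsilon>" using m'(2) by (simp add: pos_divide_le_eq)
      have r0: "real n / m' \<ge> 1" using m' by simp
      have "sqrt (real n / m') \<le> real n / m'" using r0
        by (metis abs_of_nonneg order.trans real_sqrt_le_iff real_sqrt_abs self_le_power zero_le_one pos2)
      then have r2: "s / sqrt m' \<le> 1 + \<epsilon>" using r1 by (simp add: s_def real_sqrt_divide)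
      have q: "part_ratio n k = real (num_partitions (n - k)) / real (num_partitions n)"
        using m by (simp add: part_ratio_def partitions_shift_def)
      have "(1 + \<delta> / 3) * (real n / m') \<le> (1 + \<delta> / 3) * (1 + \<delta> / 3)"
        using r1 \<epsilon> \<delta> by (intro mult_left_mono) auto
      also have "\<dots> \<le> 1 + \<delta>"
      proof -
        have "\<delta> * \<delta> \<le> \<delta> * 1" using \<delta> by (intro mult_left_mono) auto
        then show ?thesis using \<delta> by (simp add: field_simps)
      qed
      finally have u1: "(1 + \<delta> / 3) * (real n / m') \<le> 1 + \<delta>" .
      have u2: "(c - \<delta>) * real k / s \<le> (c - \<delta> / 3) * real k / s"
        using \<delta> s by (intro divide_right_mono mult_right_mono) auto
      have "part_ratio n k \<le> (1 + \<delta> / 3) * (real n / m') * exp (- ((c - \<delta> / 3) * real k / s))"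
        using up[OF m(1,2)] unfolding q m'_def s_def .
      also have "\<dots> \<le> (1 + \<delta>) * exp (- ((c - \<delta>) * real k / s))"
        using u1 u2 \<delta> by (intro mult_mono) auto
      finally have upper: "part_ratio n k \<le> (1 + \<delta>) * exp (- ((c - \<delta>) * real k / s))" .
      have "(c + \<delta> / 3) * (s / sqrt m') \<le> (c + \<delta> / 3) * (1 + \<epsilon>)"
        using r2 c \<delta> by (intro mult_left_mono) auto
      also have "\<dots> \<le> c + \<delta>"
      proof -
        have "(c + \<delta> / 3) * \<epsilon> \<le> (c + 1) * \<epsilon>" using \<delta> \<epsilon> by (intro mult_right_mono) auto
        moreover have "(c + \<delta> / 3) * (1 + \<epsilon>) = c + \<delta> / 3 + (c + \<delta> / 3) * \<epsilon>" by (simp add: distrib_left)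
        moreover have "(c + 1) * \<epsilon> = \<delta> / 3" using \<epsilon>(4) by (simp add: mult.commute)
        ultimately show ?thesis using \<delta> by linarith
      qed
      finally have "(c + \<delta> / 3) * (s / sqrt m') * (real k / s) \<le> (c + \<delta>) * (real k / s)"
        using s by (intro mult_right_mono) auto
      then have l2: "(c + \<delta> / 3) * real k / sqrt m' \<le> (c + \<delta>) * real k / s"
        using s by simp
      have "(1 - \<delta>) * exp (- ((c + \<delta>) * real k / s)) \<le> (1 - \<delta> / 3) * exp (- ((c + \<delta> / 3) * real k / sqrt m'))"
        using l2 \<delta> by (intro mult_mono) auto
      also have "\<dots> \<le> part_ratio n k" using lo[OF m(1,2)] unfolding q m'_def .
      finally show "(1 - \<delta>) * exp (- ((part_rate + \<delta>) * real k / sqrt (real n))) \<le> part_ratio n k \<and>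
        part_ratio n k \<le> (1 + \<delta>) * exp (- ((part_rate - \<delta>) * real k / sqrt (real n)))"
        using upper unfolding c_def s_def by simp
    qed
  qed
qed

text \<open>A Riemann sum of mesh x for the integral of exp (- u) over the positive half-line; right
  endpoints underestimate it.\<close>

lemma geometric_exp_sum_upper:
  assumes "x > (0::real)" shows "x * (\<Sum>r=1..R. exp (- (x * real r))) \<le> 1"
proof -
  define q where "q = exp (- x)"
  have q: "0 < q" "q < 1" using assms by (auto simp: q_def)
  have e: "exp (- (x * real r)) = q ^ r" for r by (simp add: q_def exp_of_nat_mult[symmetric] mult.commute)
  have "(\<Sum>r=1..R. q ^ r) = q * (\<Sum>r<R. q ^ r)"
    by (simp add: sum.atLeast1_atMost_eq sum_distrib_left)
  also have "\<dots> = q * (1 - q ^ R) / (1 - q)" using q by (simp add: sum_gp_strict)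
  also have "\<dots> \<le> q * 1 / (1 - q)" using q by (intro divide_right_mono mult_left_mono) auto
  finally have "x * (\<Sum>r=1..R. q ^ r) \<le> x * (q / (1 - q))"
    using assms by (intro mult_left_mono) auto
  also have "\<dots> \<le> 1"
  proof -
    have "(1 + x) * q \<le> exp x * q" using q exp_ge_add_one_self by (intro mult_right_mono) auto
    also have "\<dots> = 1" by (simp add: q_def exp_minus)
    finally have "x * q \<le> 1 - q" by (simp add: algebra_simps)
    then show ?thesis using q by simp
  qed
  finally show ?thesis by (simp add: e)
qed

text \<open>The loss x is one mesh cell, and the exponential is the tail cut off after
  \<open>R\<close> terms.\<close>

lemma geometric_exp_sum_lower:
  assumes "x > (0::real)"
  shows "x * (\<Sum>r=1..R. exp (- (x * real r))) \<ge> 1 - x - exp (- (x * real (R + 1)))"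
proof -
  define q where "q = exp (- x)"
  have q: "0 < q" "q < 1" using assms by (auto simp: q_def)
  have e: "exp (- (x * real r)) = q ^ r" for r by (simp add: q_def exp_of_nat_mult[symmetric] mult.commute)
  have "1 - q \<le> x" using exp_ge_add_one_self[of "- x"] by (simp add: q_def)
  then have 1: "(1 - q) * (\<Sum>r=1..R. q ^ r) \<le> x * (\<Sum>r=1..R. q ^ r)"
    using q by (intro mult_right_mono sum_nonneg) auto
  have "(\<Sum>r=1..R. q ^ r) = q * (\<Sum>r<R. q ^ r)"
    by (simp add: sum.atLeast1_atMost_eq sum_distrib_left)
  also have "\<dots> = q * (1 - q ^ R) / (1 - q)" using q by (simp add: sum_gp_strict)
  finally have "(1 - q) * (\<Sum>r=1..R. q ^ r) = q * (1 - q ^ R)" using q by simp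
  also have "\<dots> = q - q ^ (R + 1)" by (simp add: right_diff_distrib)
  finally have "(1 - q) * (\<Sum>r=1..R. q ^ r) = q - q ^ (R + 1)" .
  with 1 have "q - q ^ (R + 1) \<le> x * (\<Sum>r=1..R. q ^ r)" by simp
  moreover have "q \<ge> 1 - x" using exp_ge_add_one_self[of "- x"] by (simp add: q_def)
  ultimately show ?thesis unfolding e by linarith
qed

text \<open>The weight contributed by part size \<open>d\<close>, truncated at \<open>w\<close> of
  order sqrt n. The moments then involve only part sums inside the window where
  \<open>part_ratio\<close> is controlled, and the bound \<open>w\<close> takes care of the diagonal
  of the second moment.\<close>

definition trunc_mult :: "real \<Rightarrow> nat \<Rightarrow> nat multiset \<Rightarrow> real" where
  "trunc_mult w d M = real d * real (min (count M d) (nat \<lfloor>w / real d\<rfloor>))"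

lemma trunc_mult_sum:
  "trunc_mult w d M = (\<Sum>r=1..nat \<lfloor>w / real d\<rfloor>. if r \<le> count M d then real d else 0)"
proof -
  define R where "R = nat \<lfloor>w / real d\<rfloor>"
  have "{r \<in> {1..R}. r \<le> count M d} = {1..min (count M d) R}" by auto
  then have "(\<Sum>r=1..R. if r \<le> count M d then real d else 0) = real (min (count M d) R) * real d"
    by (simp add: sum.If_cases Int_def conj_commute)
  then show ?thesis by (simp add: trunc_mult_def R_def mult.commute)
qed

lemma trunc_mult_bounds:
  assumes "d > 0" "w \<ge> 0"
  shows "0 \<le> trunc_mult w d M" "trunc_mult w d M \<le> w" "trunc_mult w d M \<le> real d * real (count M d)"
proof -
  have "real (min (count M d) (nat \<lfloor>w / real d\<rfloor>)) \<le> real (nat \<lfloor>w / real d\<rfloor>)" by simp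
  also have "\<dots> \<le> w / real d" using assms by simp
  finally have "real d * real (min (count M d) (nat \<lfloor>w / real d\<rfloor>)) \<le> real d * (w / real d)"
    by (intro mult_left_mono) auto
  then show "trunc_mult w d M \<le> w" using assms by (simp add: trunc_mult_def)
qed (auto simp: trunc_mult_def intro!: mult_left_mono)

lemma trunc_mult_mean:
  assumes "d > 0"
  shows "(\<Sum>M\<in>mset_partitions n. trunc_mult w d M) =
    real (num_partitions n) * (real d * (\<Sum>r=1..nat \<lfloor>w / real d\<rfloor>. part_ratio n (r * d)))"
proof -
  have "(\<Sum>M\<in>mset_partitions n. trunc_mult w d M) =
      (\<Sum>r=1..nat \<lfloor>w / real d\<rfloor>. \<Sum>M\<in>mset_partitions n. if r \<le> count M d then real d else 0)"
    unfolding trunc_mult_sum by (rule sum.swap)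
  also have "\<dots> = (\<Sum>r=1..nat \<lfloor>w / real d\<rfloor>. real d * partitions_shift n (r * d))"
    using finite_mset_partitions[of n]
    by (intro sum.cong refl) (simp add: card_multiplicity_ge[OF assms, symmetric] sum.If_cases Int_def)
  finally show ?thesis
    using num_partitions_pos[of n] by (simp add: part_ratio_def sum_distrib_left)
qed

lemma trunc_mult_mean2:
  assumes "d > 0" "e > 0" "d \<noteq> e"
  shows "(\<Sum>M\<in>mset_partitions n. trunc_mult w d M * trunc_mult w e M) =
    real (num_partitions n) * (\<Sum>r=1..nat \<lfloor>w / real d\<rfloor>. \<Sum>r'=1..nat \<lfloor>w / real e\<rfloor>.
      real d * real e * part_ratio n (r * d + r' * e))"
proof -
  have "(\<Sum>M\<in>mset_partitions n. trunc_mult w d M * trunc_mult w e M) =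
      (\<Sum>M\<in>mset_partitions n. \<Sum>r=1..nat \<lfloor>w / real d\<rfloor>. \<Sum>r'=1..nat \<lfloor>w / real e\<rfloor>.
        if r \<le> count M d \<and> r' \<le> count M e then real d * real e else 0)"
    unfolding trunc_mult_sum sum_product by (intro sum.cong refl) auto
  also have "\<dots> = (\<Sum>r=1..nat \<lfloor>w / real d\<rfloor>. \<Sum>M\<in>mset_partitions n. \<Sum>r'=1..nat \<lfloor>w / real e\<rfloor>.
        if r \<le> count M d \<and> r' \<le> count M e then real d * real e else 0)"
    by (rule sum.swap)
  also have "\<dots> = (\<Sum>r=1..nat \<lfloor>w / real d\<rfloor>. \<Sum>r'=1..nat \<lfloor>w / real e\<rfloor>. \<Sum>M\<in>mset_partitions n.
        if r \<le> count M d \<and> r' \<le> count M e then real d * real e else 0)"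
    by (intro sum.cong refl sum.swap)
  also have "\<dots> = (\<Sum>r=1..nat \<lfloor>w / real d\<rfloor>. \<Sum>r'=1..nat \<lfloor>w / real e\<rfloor>. real d * real e * partitions_shift n (r * d + r' * e))"
    using finite_mset_partitions[of n]
    by (intro sum.cong refl) (simp add: card_multiplicity2_ge[OF assms, symmetric] sum.If_cases Int_def)
  finally show ?thesis
    using num_partitions_pos[of n] by (simp add: part_ratio_def sum_distrib_left)
qed

text \<open>Deviations are measured from a free centre \<open>a0\<close>, so the mean enters only
  through a lower bound and the mixed moments only through an upper bound. For d small against sqrt
  n the mean weight is close to s / \<gamma> whatever d is, and for d \<noteq> e the mixed moment is
  close to its square because the window bound factorizes. \<kappa> controls the mesh of the Riemann
  sums and \<open>K\<close> their tail.\<close>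

lemma sum_trunc_mult_second_moment:
  fixes n :: nat and \<delta> K \<kappa> a0 :: real and D :: "nat set"
  defines "s \<equiv> sqrt (real n)" and "a \<equiv> part_rate + \<delta>" and "b \<equiv> part_rate - \<delta>"
  assumes n: "n > 0" and \<delta>: "0 < \<delta>" "\<delta> < 1" and K: "K > 0" and \<kappa>: "a * \<kappa> + exp (- (a * K)) \<le> 1"
    and window: "\<And>k. real k \<le> 2 * K * s \<Longrightarrow>
      (1 - \<delta>) * exp (- (a * real k / s)) \<le> part_ratio n k \<and>
      part_ratio n k \<le> (1 + \<delta>) * exp (- (b * real k / s))"
    and D: "finite D" "\<And>d. d \<in> D \<Longrightarrow> 0 < d \<and> real d \<le> \<kappa> * s" and a0: "a0 \<ge> 0"
  shows "(\<Sum>M\<in>mset_partitions n. ((\<Sum>d\<in>D. trunc_mult (K * s) d M) - a0) ^ 2) \<le>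
    real (num_partitions n) * ((real (card D) * s / b) ^ 2 * (1 + \<delta>) + real (card D) * (K * s) ^ 2
      - 2 * a0 * (real (card D) * ((1 - \<delta>) * (s / a) * (1 - a * \<kappa> - exp (- (a * K))))) + a0 ^ 2)"
proof -
  have s: "s > 0" using n by (simp add: s_def)
  have ab: "a > 0" "b > 0" using part_rate_ge_1 \<delta> by (auto simp: a_def b_def)
  define w where "w = K * s"
  have w: "w > 0" using K s by (simp add: w_def)
  define R where "R = (\<lambda>d. nat \<lfloor>w / real d\<rfloor>)"
  define p where "p = real (num_partitions n)"
  have p: "p > 0" using num_partitions_pos by (simp add: p_def)
  define Y where "Y = (\<lambda>d M. trunc_mult w d M)"
  have Rw: "real r * real d \<le> w" if "r \<le> R d" "d > 0" for r d
  proof -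
    have "real r \<le> real (R d)" using that by simp
    also have "\<dots> \<le> w / real d" using w by (simp add: R_def)
    finally show ?thesis using that by (simp add: field_simps)
  qed
  have mean: "(\<Sum>M\<in>mset_partitions n. Y d M) \<ge> p * ((1 - \<delta>) * (s / a) * (1 - a * \<kappa> - exp (- (a * K))))"
    if "d \<in> D" for d
  proof -
    have d: "d > 0" "real d \<le> \<kappa> * s" using D that by auto
    define x where "x = a * real d / s"
    have x: "x > 0" using ab d s by (simp add: x_def)
    have x1: "x \<le> a * \<kappa>" using d s ab by (simp add: x_def field_simps)
    have "w / real d < real (R d) + 1" unfolding R_def using w by linarith
    then have "K * s < real (R d + 1) * real d" using d by (simp add: w_def field_simps)
    then have "a * (K * s) \<le> a * (real (R d + 1) * real d)" using ab by (intro mult_left_mono) auto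
    then have x2: "a * K \<le> x * real (R d + 1)" using s by (simp add: x_def field_simps)
    have "1 - a * \<kappa> - exp (- (a * K)) \<le> 1 - x - exp (- (x * real (R d + 1)))"
      using x1 x2 by (simp add: diff_mono)
    also have "\<dots> \<le> x * (\<Sum>r=1..R d. exp (- (x * real r)))"
      by (rule geometric_exp_sum_lower[OF x])
    finally have "(1 - \<delta>) * (s / a) * (1 - a * \<kappa> - exp (- (a * K))) \<le> (1 - \<delta>) * (s / a) * (x * (\<Sum>r=1..R d. exp (- (x * real r))))"
      using \<delta> s ab by (intro mult_left_mono) auto
    also have "\<dots> = real d * (\<Sum>r=1..R d. (1 - \<delta>) * exp (- (x * real r)))"
      using s ab by (simp add: x_def sum_distrib_left[symmetric])
    also have "\<dots> \<le> real d * (\<Sum>r=1..R d. part_ratio n (r * d))"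
    proof (intro mult_left_mono sum_mono)
      fix r assume r: "r \<in> {1..R d}"
      have "real (r * d) \<le> w" using Rw[of r d] r d by simp
      also have "\<dots> \<le> 2 * K * s" using w by (simp add: w_def)
      finally have "(1 - \<delta>) * exp (- (a * real (r * d) / s)) \<le> part_ratio n (r * d)" using window by blast
      then show "(1 - \<delta>) * exp (- (x * real r)) \<le> part_ratio n (r * d)" by (simp add: x_def mult_ac)
    qed auto
    finally have "(1 - \<delta>) * (s / a) * (1 - a * \<kappa> - exp (- (a * K))) \<le> real d * (\<Sum>r=1..R d. part_ratio n (r * d))" .
    from mult_left_mono[OF this, of p] show ?thesis
      unfolding Y_def trunc_mult_mean[OF d(1)] p_def[symmetric] R_def using p by simp
  qed
  have cross: "(\<Sum>M\<in>mset_partitions n. Y d M * Y e M) \<le> p * ((s / b) ^ 2 * (1 + \<delta>))"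
    if "d \<in> D" "e \<in> D" "d \<noteq> e" for d e
  proof -
    have d: "d > 0" "e > 0" using D that by auto
    define x where "x = b * real d / s"
    define y where "y = b * real e / s"
    have xy: "x > 0" "y > 0" using ab d s by (auto simp: x_def y_def)
    have "(\<Sum>r=1..R d. \<Sum>r'=1..R e. real d * real e * part_ratio n (r * d + r' * e)) \<le>
        (\<Sum>r=1..R d. \<Sum>r'=1..R e. ((s / b) ^ 2 * (1 + \<delta>)) * ((x * exp (- (x * real r))) * (y * exp (- (y * real r')))))"
    proof (intro sum_mono)
      fix r r' assume r: "r \<in> {1..R d}" "r' \<in> {1..R e}"
      have "real (r * d + r' * e) \<le> 2 * K * s" using Rw[of r d] Rw[of r' e] r d by (simp add: w_def)
      then have "part_ratio n (r * d + r' * e) \<le> (1 + \<delta>) * exp (- (b * real (r * d + r' * e) / s))"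
        using window by blast
      also have "b * real (r * d + r' * e) / s = x * real r + y * real r'"
        by (simp add: x_def y_def add_divide_distrib algebra_simps)
      finally have "real d * real e * part_ratio n (r * d + r' * e) \<le>
          real d * real e * ((1 + \<delta>) * exp (- (x * real r + y * real r')))"
        by (intro mult_left_mono) auto
      also have "exp (- (x * real r + y * real r')) = exp (- (x * real r)) * exp (- (y * real r'))"
        by (simp add: exp_add[symmetric])
      also have "real d * real e * ((1 + \<delta>) * (exp (- (x * real r)) * exp (- (y * real r')))) =
          ((s / b) ^ 2 * (1 + \<delta>)) * ((x * exp (- (x * real r))) * (y * exp (- (y * real r'))))"
      proof -
        have "real d = s / b * x" "real e = s / b * y" using s ab by (auto simp: x_def y_def)
        then show ?thesis by (simp add: power2_eq_square)
      qed
      finally show "real d * real e * part_ratio n (r * d + r' * e) \<le>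
          ((s / b) ^ 2 * (1 + \<delta>)) * ((x * exp (- (x * real r))) * (y * exp (- (y * real r'))))" .
    qed
    also have "\<dots> = ((s / b) ^ 2 * (1 + \<delta>)) * ((x * (\<Sum>r=1..R d. exp (- (x * real r)))) * (y * (\<Sum>r'=1..R e. exp (- (y * real r')))))"
      by (simp only: sum_distrib_left sum_distrib_right) (rule sum.swap)
    also have "\<dots> \<le> ((s / b) ^ 2 * (1 + \<delta>)) * (1 * 1)"
      using xy \<delta> by (intro mult_left_mono mult_mono geometric_exp_sum_upper) (auto intro!: mult_nonneg_nonneg sum_nonneg)
    finally have "(\<Sum>r=1..R d. \<Sum>r'=1..R e. real d * real e * part_ratio n (r * d + r' * e)) \<le> (s / b) ^ 2 * (1 + \<delta>)"
      by simp
    from mult_left_mono[OF this, of p] show ?thesis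
      unfolding Y_def trunc_mult_mean2[OF d that(3)] p_def[symmetric] R_def using p by simp
  qed
  have diag: "(\<Sum>M\<in>mset_partitions n. Y d M * Y d M) \<le> p * w ^ 2" if "d \<in> D" for d
  proof -
    have "(\<Sum>M\<in>mset_partitions n. Y d M * Y d M) \<le> (\<Sum>M\<in>mset_partitions n. w ^ 2)"
      unfolding power2_eq_square Y_def
      using D that w by (intro sum_mono mult_mono trunc_mult_bounds) auto
    then show ?thesis by (simp add: p_def num_partitions_def)
  qed
  have "(\<Sum>M\<in>mset_partitions n. (\<Sum>d\<in>D. Y d M) ^ 2) = (\<Sum>d\<in>D. \<Sum>e\<in>D. \<Sum>M\<in>mset_partitions n. Y d M * Y e M)"
    unfolding power2_eq_square sum_product
    by (subst sum.swap, intro sum.cong refl, rule sum.swap)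
  also have "\<dots> \<le> (\<Sum>d\<in>D. \<Sum>e\<in>D. p * ((s / b) ^ 2 * (1 + \<delta>)) + (if d = e then p * w ^ 2 else 0))"
  proof (intro sum_mono)
    fix d e assume de: "d \<in> D" "e \<in> D"
    have "0 \<le> p * ((s / b) ^ 2 * (1 + \<delta>))" using p \<delta> by simp
    then show "(\<Sum>M\<in>mset_partitions n. Y d M * Y e M) \<le> p * ((s / b) ^ 2 * (1 + \<delta>)) + (if d = e then p * w ^ 2 else 0)"
      using cross[OF de] diag[of d] de by (cases "d = e") auto
  qed
  also have "\<dots> = p * ((real (card D) * s / b) ^ 2 * (1 + \<delta>) + real (card D) * w ^ 2)"
    using D(1) by (simp add: sum.distrib algebra_simps power2_eq_square)
  finally have sq: "(\<Sum>M\<in>mset_partitions n. (\<Sum>d\<in>D. Y d M) ^ 2) \<le> p * ((real (card D) * s / b) ^ 2 * (1 + \<delta>) + real (card D) * w ^ 2)" .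
  have "p * (real (card D) * ((1 - \<delta>) * (s / a) * (1 - a * \<kappa> - exp (- (a * K))))) =
      (\<Sum>d\<in>D. p * ((1 - \<delta>) * (s / a) * (1 - a * \<kappa> - exp (- (a * K)))))" by simp
  also have "\<dots> \<le> (\<Sum>d\<in>D. \<Sum>M\<in>mset_partitions n. Y d M)" by (intro sum_mono mean)
  also have "\<dots> = (\<Sum>M\<in>mset_partitions n. \<Sum>d\<in>D. Y d M)" by (rule sum.swap)
  finally have "2 * a0 * (p * (real (card D) * ((1 - \<delta>) * (s / a) * (1 - a * \<kappa> - exp (- (a * K)))))) \<le>
      2 * a0 * (\<Sum>M\<in>mset_partitions n. \<Sum>d\<in>D. Y d M)"
    using a0 by (intro mult_left_mono) auto
  moreover have "(\<Sum>M\<in>mset_partitions n. ((\<Sum>d\<in>D. Y d M) - a0) ^ 2) =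
      (\<Sum>M\<in>mset_partitions n. (\<Sum>d\<in>D. Y d M) ^ 2) - 2 * a0 * (\<Sum>M\<in>mset_partitions n. \<Sum>d\<in>D. Y d M) + p * a0 ^ 2"
    by (simp add: power2_diff sum.distrib sum_subtractf sum_distrib_left p_def num_partitions_def mult_ac)
  ultimately have "(\<Sum>M\<in>mset_partitions n. ((\<Sum>d\<in>D. Y d M) - a0) ^ 2) \<le>
      p * ((real (card D) * s / b) ^ 2 * (1 + \<delta>) + real (card D) * w ^ 2)
      - 2 * a0 * (p * (real (card D) * ((1 - \<delta>) * (s / a) * (1 - a * \<kappa> - exp (- (a * K)))))) + p * a0 ^ 2"
    using sq by linarith
  also have "\<dots> = p * ((real (card D) * s / b) ^ 2 * (1 + \<delta>) + real (card D) * w ^ 2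
      - 2 * a0 * (real (card D) * ((1 - \<delta>) * (s / a) * (1 - a * \<kappa> - exp (- (a * K))))) + a0 ^ 2)"
    by (simp only: algebra_simps)
  finally show ?thesis unfolding Y_def w_def p_def .
qed

text \<open>The weight of the parts 2^k * m up to sqrt n; squaring the condition keeps it in the
  naturals. Any 2^j * m that is at least sqrt n then has j no smaller than every level k that
  occurs.\<close>

definition doubling_weight :: "nat \<Rightarrow> nat \<Rightarrow> nat multiset \<Rightarrow> nat" where
  "doubling_weight m n M = (\<Sum>k | (2 ^ k * m) ^ 2 \<le> n. 2 ^ k * m * count M (2 ^ k * m))"

lemma finite_doubling_levels:
  assumes "m > 0" shows "finite {k. (2 ^ k * m) ^ 2 \<le> (n::nat)}"
proof (rule finite_subset)
  show "{k. (2 ^ k * m) ^ 2 \<le> n} \<subseteq> {..n}"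
  proof
    fix k assume "k \<in> {k. (2 ^ k * m) ^ 2 \<le> n}"
    then have "(2 ^ k * m) ^ 2 \<le> n" by simp
    moreover have "k < 2 ^ k" by simp
    moreover have "(2::nat) ^ k \<le> 2 ^ k * m" using assms by simp
    moreover have "2 ^ k * m \<le> (2 ^ k * m) ^ 2" using assms by (simp add: power2_eq_square)
    ultimately have "k \<le> n" by linarith
    then show "k \<in> {..n}" by simp
  qed
qed simp

text \<open>About ln n / (2 * ln 2) levels k have 2^k * m small against sqrt n, and each contributes
  weight about sqrt n / \<gamma>. The second moment bound gives concentration by Chebyshev's
  inequality, and 1 / (2 * ln 2) > 7 / 10.\<close>

lemma doubling_weight_large:
  assumes m: "m > 0" and \<epsilon>: "\<epsilon> > 0"
  shows "\<forall>\<^sub>F n in sequentially.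
    real (card {M \<in> mset_partitions n. real (doubling_weight m n M) < 7 / 10 * (sqrt (real n) * ln (real n) / part_rate)})
      \<le> \<epsilon> * real (num_partitions n)"
proof -
  define c where "c = part_rate"
  have c: "c \<ge> 1" using part_rate_ge_1 by (simp add: c_def)
  define \<eta> :: real where "\<eta> = 1 / 100"
  define \<epsilon>' where "\<epsilon>' = \<epsilon> * \<eta> ^ 2"
  have \<epsilon>': "\<epsilon>' > 0" using \<epsilon> by (simp add: \<epsilon>'_def \<eta>_def)
  \<comment> \<open>The second moment bound without its diagonal, divided by the square of the
    centre; it vanishes in the limit \<delta> to 0, so a small \<delta> makes it negligible.\<close>
  define g where "g = (\<lambda>\<delta>. (c / (c - \<delta>)) ^ 2 * (1 + \<delta>) - 2 * ((1 - \<delta>) * (c / (c + \<delta>)) * (1 - (c + \<delta>) * \<delta> - \<delta>)) + 1)"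
  have "(g \<longlongrightarrow> (c / (c - 0)) ^ 2 * (1 + 0) - 2 * ((1 - 0) * (c / (c + 0)) * (1 - (c + 0) * 0 - 0)) + 1) (at_right 0)"
    unfolding g_def using c by (intro tendsto_intros) auto
  then have "(g \<longlongrightarrow> 0) (at_right 0)" using c by simp
  then have "\<forall>\<^sub>F \<delta> in at_right 0. g \<delta> < \<epsilon>' / 2" using \<epsilon>' by (intro order_tendstoD) auto
  moreover have "\<forall>\<^sub>F \<delta> in at_right 0. \<delta> < 1 / (2 * (c + 2))"
    using c by (intro eventually_at_right_less[THEN eventually_mono] order_tendstoD(2)[OF tendsto_ident_at]) auto
  moreover have "\<forall>\<^sub>F \<delta> in at_right 0. (0::real) < \<delta>" by (rule eventually_at_right_less)
  ultimately have "\<forall>\<^sub>F \<delta> in at_right 0. g \<delta> < \<epsilon>' / 2 \<and> \<delta> < 1 / (2 * (c + 2)) \<and> 0 < \<delta>" by eventually_elim auto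
  then obtain \<delta> where \<delta>: "g \<delta> < \<epsilon>' / 2" "\<delta> < 1 / (2 * (c + 2))" "0 < \<delta>"
    using eventually_happens[of _ "at_right (0::real)"] trivial_limit_at_right_real by blast
  have \<delta>1: "\<delta> < 1"
  proof -
    have "1 / (2 * (c + 2)) \<le> 1" using c by simp
    with \<delta> show ?thesis by linarith
  qed
  \<comment> \<open>Makes the truncated tail exp (- (a * K)) at most \<delta>, since a > 1.\<close>
  define K where "K = ln (1 / \<delta>)"
  have K: "K > 0" using \<delta> \<delta>1 by (simp add: K_def)
  define a where "a = c + \<delta>"
  define b where "b = c - \<delta>"
  have ab: "a > 1" "b > 0" using c \<delta> \<delta>1 by (auto simp: a_def b_def)
  have expK: "exp (- (a * K)) \<le> \<delta>"
  proof -
    have "exp (- (a * K)) \<le> exp (- (1 * K))" using ab K by (simp add: mult_right_mono)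
    also have "\<dots> = \<delta>" using \<delta> by (simp add: K_def ln_div)
    finally show ?thesis .
  qed
  have \<kappa>: "a * \<delta> + exp (- (a * K)) \<le> 1"
  proof -
    have "\<delta> * (c + 2) < 1 / 2" using \<delta>(2) c by (simp add: field_simps)
    moreover have "a * \<delta> + exp (- (a * K)) \<le> (c + 1) * \<delta> + \<delta>"
      using expK \<delta>1 \<delta> by (intro add_mono mult_right_mono) (auto simp: a_def)
    ultimately show ?thesis by (simp add: algebra_simps)
  qed
  \<comment> \<open>The levels below \<open>L n\<close> satisfy 2^k * m \<le> \<delta> * sqrt n,
    where the Riemann sums are fine enough.\<close>
  define L where "L = (\<lambda>n::nat. nat \<lfloor>log 2 (\<delta> * sqrt (real n) / real m)\<rfloor>)"
  have "filterlim (\<lambda>n::nat. log 2 (\<delta> * sqrt (real n) / real m) - 1) at_top sequentially"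
    using \<delta>(3) m by real_asymp
  then have Ltop: "\<forall>\<^sub>F n in sequentially. C \<le> log 2 (\<delta> * sqrt (real n) / real m) - 1" for C
    by (simp add: filterlim_at_top)
  have Lge: "log 2 (\<delta> * sqrt (real n) / real m) - 1 \<le> real (L n)" for n
    unfolding L_def by linarith
  \<comment> \<open>The diagonal grows linearly in the number of levels and the square of the centre
    quadratically; their quotient is K^2 * c^2 / \<open>L n\<close>.\<close>
  have ev1: "\<forall>\<^sub>F n in sequentially. K ^ 2 * c ^ 2 / (\<epsilon>' / 2) + 1 \<le> real (L n)"
    using Ltop by eventually_elim (use Lge in \<open>auto intro: order_trans\<close>)
  \<comment> \<open>99 / 100 * 36 / 25 * 1 / 2 = 0.7128 is just above 7 / 10, so the bound 25 / 36
    for ln 2 leaves room for the one percent given to Chebyshev's inequality.\<close>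
  have ev2: "\<forall>\<^sub>F n in sequentially. 7 / 10 * ln (real n) \<le> 99 / 100 * (log 2 (\<delta> * sqrt (real n) / real m) - 1)"
  proof -
    have l2: "ln 2 \<le> (25/36::real)" by (rule ln2_le_25_over_36)
    have "\<forall>\<^sub>F n in sequentially. 7 / 10 * ln (real n) \<le> 99 / 100 * ((36/25) * ln (\<delta> * sqrt (real n) / real m) - 1)"
      using \<delta>(3) m by real_asymp
    moreover have "\<forall>\<^sub>F n in sequentially. 0 \<le> ln (\<delta> * sqrt (real n) / real m)"
      using \<delta>(3) m by real_asymp
    ultimately show ?thesis
    proof eventually_elim
      case (elim n)
      define y where "y = ln (\<delta> * sqrt (real n) / real m)"
      have y: "y \<ge> 0" using elim by (simp add: y_def)
      have "y * ln 2 * 36 \<le> y * (25/36) * 36" using l2 y by (intro mult_mono) auto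
      then have "(36/25) * y \<le> y / ln 2" by (simp add: field_simps)
      then have "(36/25) * y \<le> log 2 (\<delta> * sqrt (real n) / real m)" by (simp add: log_def y_def)
      then show ?case using elim(1) unfolding y_def[symmetric] by (simp add: algebra_simps)
    qed
  qed
  have ev3: "\<forall>\<^sub>F n in sequentially. \<forall>k. real k \<le> (2 * K) * sqrt (real n) \<longrightarrow>
    (1 - \<delta>) * exp (- ((part_rate + \<delta>) * real k / sqrt (real n))) \<le> part_ratio n k \<and>
    part_ratio n k \<le> (1 + \<delta>) * exp (- ((part_rate - \<delta>) * real k / sqrt (real n)))"
    using \<delta> \<delta>1 K by (intro part_ratio_window) auto
  show ?thesis using ev1 ev2 ev3 eventually_gt_at_top[of 0]
  proof eventually_elim
    case (elim n)
    define s where "s = sqrt (real n)"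
    have s: "s > 0" using elim(4) by (simp add: s_def)
    define p where "p = real (num_partitions n)"
    have p: "p > 0" using num_partitions_pos by (simp add: p_def)
    define D where "D = (\<lambda>k. 2 ^ k * m) ` {..<L n}"
    have inj: "inj_on (\<lambda>k. 2 ^ k * m) {..<L n}" using m by (intro inj_onI) auto
    have D: "finite D" "card D = L n" using inj by (auto simp: D_def card_image)
    have L1: "real (L n) \<ge> 1"
    proof -
      have "0 \<le> K ^ 2 * c ^ 2 / (\<epsilon>' / 2)" using \<epsilon>' by simp
      then show ?thesis using elim(1) by linarith
    qed
    have "real (L n) \<le> log 2 (\<delta> * s / real m)"
    proof -
      have "L n > 0" using L1 by simp
      then have "log 2 (\<delta> * s / real m) \<ge> 0" unfolding L_def s_def by linarith
      then show ?thesis unfolding L_def s_def by simp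
    qed
    moreover have "\<delta> * s / real m > 0" using \<delta> s m by simp
    ultimately have "2 powr real (L n) \<le> \<delta> * s / real m" by (simp add: le_log_iff)
    then have pw: "2 ^ L n * real m \<le> \<delta> * s" using m by (simp add: powr_realpow field_simps)
    have Dle: "real (2 ^ k * m) \<le> \<delta> * s" if "k < L n" for k
    proof -
      have "(2::real) ^ k \<le> 2 ^ L n" using that by (intro power_increasing) auto
      then have "2 ^ k * real m \<le> 2 ^ L n * real m" by (intro mult_right_mono) auto
      then show ?thesis using pw by simp
    qed
    define a0 where "a0 = real (L n) * s / c"
    have a0: "a0 > 0" using L1 s c by (simp add: a0_def)
    define X where "X = (\<lambda>M. \<Sum>d\<in>D. trunc_mult (K * s) d M)"
    have "(\<Sum>M\<in>mset_partitions n. (X M - a0) ^ 2) \<le>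
      p * ((real (card D) * s / (part_rate - \<delta>)) ^ 2 * (1 + \<delta>) + real (card D) * (K * s) ^ 2
        - 2 * a0 * (real (card D) * ((1 - \<delta>) * (s / (part_rate + \<delta>)) * (1 - (part_rate + \<delta>) * \<delta> - exp (- ((part_rate + \<delta>) * K))))) + a0 ^ 2)"
      unfolding X_def p_def s_def
    proof (rule sum_trunc_mult_second_moment)
      show "(part_rate + \<delta>) * \<delta> + exp (- ((part_rate + \<delta>) * K)) \<le> 1" using \<kappa> by (simp add: a_def c_def)
      show "\<And>d. d \<in> D \<Longrightarrow> 0 < d \<and> real d \<le> \<delta> * sqrt (real n)" using Dle m by (auto simp: D_def s_def)
    qed (use elim \<delta> \<delta>1 K D a0 in auto)
    also have "\<dots> \<le> p * (\<epsilon>' * a0 ^ 2)"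
    proof (intro mult_left_mono)
      have *: "real (L n) * s = a0 * c" using c by (simp add: a0_def)
      have i1: "(real (L n) * s / b) ^ 2 * (1 + \<delta>) = a0 ^ 2 * ((c / b) ^ 2 * (1 + \<delta>))"
        unfolding * by (simp add: power_mult_distrib power_divide)
      have i2: "real (L n) * (K * s) ^ 2 \<le> a0 ^ 2 * (\<epsilon>' / 2)"
      proof -
        have "K ^ 2 * c ^ 2 / (\<epsilon>' / 2) \<le> real (L n)" using elim(1) by linarith
        then have "K ^ 2 * c ^ 2 \<le> real (L n) * (\<epsilon>' / 2)" using \<epsilon>' by (subst (asm) pos_divide_le_eq) auto
        then have "(real (L n) * (K ^ 2 * c ^ 2)) * s ^ 2 / c ^ 2 \<le> (real (L n) * (real (L n) * (\<epsilon>' / 2))) * s ^ 2 / c ^ 2"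
          by (intro divide_right_mono mult_right_mono mult_left_mono) auto
        moreover have "(real (L n) * (K ^ 2 * c ^ 2)) * s ^ 2 / c ^ 2 = real (L n) * (K * s) ^ 2"
          using c by (simp add: power_mult_distrib)
        moreover have "(real (L n) * (real (L n) * (\<epsilon>' / 2))) * s ^ 2 / c ^ 2 = a0 ^ 2 * (\<epsilon>' / 2)"
          by (simp add: a0_def power_mult_distrib power_divide power2_eq_square mult_ac)
        ultimately show ?thesis by linarith
      qed
      have "(1 - \<delta>) * (c / a) * (1 - a * \<delta> - \<delta>) \<le> (1 - \<delta>) * (c / a) * (1 - a * \<delta> - exp (- (a * K)))"
        using expK \<delta>1 c ab by (intro mult_left_mono) auto
      then have "2 * a0 ^ 2 * ((1 - \<delta>) * (c / a) * (1 - a * \<delta> - \<delta>)) \<le> 2 * a0 ^ 2 * ((1 - \<delta>) * (c / a) * (1 - a * \<delta> - exp (- (a * K))))"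
        by (rule mult_left_mono) simp
      moreover have "2 * a0 * (real (L n) * ((1 - \<delta>) * (s / a) * (1 - a * \<delta> - exp (- (a * K))))) =
          2 * a0 * ((real (L n) * s) * ((1 - \<delta>) / a * (1 - a * \<delta> - exp (- (a * K)))))" by simp
      moreover have "\<dots> = 2 * a0 ^ 2 * ((1 - \<delta>) * (c / a) * (1 - a * \<delta> - exp (- (a * K))))"
        unfolding * by (simp add: power2_eq_square)
      ultimately have i3: "2 * a0 ^ 2 * ((1 - \<delta>) * (c / a) * (1 - a * \<delta> - \<delta>)) \<le>
          2 * a0 * (real (L n) * ((1 - \<delta>) * (s / a) * (1 - a * \<delta> - exp (- (a * K)))))" by linarith
      have i4: "a0 ^ 2 * g \<delta> \<le> a0 ^ 2 * (\<epsilon>' / 2)" using \<delta> by (intro mult_left_mono) auto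
      have i5: "a0 ^ 2 * g \<delta> = a0 ^ 2 * ((c / b) ^ 2 * (1 + \<delta>)) - 2 * a0 ^ 2 * ((1 - \<delta>) * (c / a) * (1 - a * \<delta> - \<delta>)) + a0 ^ 2"
        unfolding g_def a_def b_def by (simp only: distrib_left right_diff_distrib mult_1_right mult_ac)
      show "(real (card D) * s / (part_rate - \<delta>)) ^ 2 * (1 + \<delta>) + real (card D) * (K * s) ^ 2
        - 2 * a0 * (real (card D) * ((1 - \<delta>) * (s / (part_rate + \<delta>)) * (1 - (part_rate + \<delta>) * \<delta> - exp (- ((part_rate + \<delta>) * K))))) + a0 ^ 2 \<le> \<epsilon>' * a0 ^ 2"
        unfolding D(2) c_def[symmetric] a_def[symmetric] b_def[symmetric]
        using i1 i2 i3 i4 i5 by argo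
    qed (use p in auto)
    finally have second: "(\<Sum>M\<in>mset_partitions n. (X M - a0) ^ 2) \<le> p * (\<epsilon>' * a0 ^ 2)" .
    define Bad where "Bad = {M \<in> mset_partitions n. X M < (1 - \<eta>) * a0}"
    have "real (card Bad) * (\<eta> * a0) ^ 2 = (\<Sum>M\<in>Bad. (\<eta> * a0) ^ 2)" by simp
    also have "\<dots> \<le> (\<Sum>M\<in>Bad. (X M - a0) ^ 2)"
    proof (rule sum_mono)
      fix M assume "M \<in> Bad"
      then have "\<eta> * a0 \<le> a0 - X M" by (simp add: Bad_def algebra_simps)
      moreover have "0 \<le> \<eta> * a0" using a0 by (simp add: \<eta>_def)
      ultimately have "(\<eta> * a0) ^ 2 \<le> (a0 - X M) ^ 2" by (intro power_mono) auto
      then show "(\<eta> * a0) ^ 2 \<le> (X M - a0) ^ 2" by (simp add: power2_commute)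
    qed
    also have "\<dots> \<le> (\<Sum>M\<in>mset_partitions n. (X M - a0) ^ 2)"
      by (intro sum_mono2 finite_mset_partitions) (auto simp: Bad_def)
    also note second
    also have "p * (\<epsilon>' * a0 ^ 2) = (\<epsilon> * p) * (\<eta> * a0) ^ 2" by (simp add: \<epsilon>'_def power_mult_distrib)
    finally have "real (card Bad) * (\<eta> * a0) ^ 2 \<le> (\<epsilon> * p) * (\<eta> * a0) ^ 2" .
    then have cB: "real (card Bad) \<le> \<epsilon> * p" using a0 by (simp add: \<eta>_def)
    have "{M \<in> mset_partitions n. real (doubling_weight m n M) < 7 / 10 * (sqrt (real n) * ln (real n) / part_rate)} \<subseteq> Bad"
    proof
      fix M assume M: "M \<in> {M \<in> mset_partitions n. real (doubling_weight m n M) < 7 / 10 * (sqrt (real n) * ln (real n) / part_rate)}"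
      have "X M \<le> (\<Sum>d\<in>D. real d * real (count M d))"
        unfolding X_def using m K s by (intro sum_mono trunc_mult_bounds) (auto simp: D_def)
      also have "\<dots> = (\<Sum>k<L n. real (2 ^ k * m * count M (2 ^ k * m)))"
        unfolding D_def by (subst sum.reindex[OF inj]) simp
      also have "\<dots> \<le> (\<Sum>k | (2 ^ k * m) ^ 2 \<le> n. real (2 ^ k * m * count M (2 ^ k * m)))"
      proof (intro sum_mono2 finite_doubling_levels m)
        show "{..<L n} \<subseteq> {k. (2 ^ k * m) ^ 2 \<le> n}"
        proof
          fix k assume "k \<in> {..<L n}"
          then have "real (2 ^ k * m) \<le> \<delta> * s" using Dle by simp
          also have "\<dots> \<le> 1 * s" using \<delta>1 s by (intro mult_right_mono) auto
          finally have "real (2 ^ k * m) ^ 2 \<le> s ^ 2" by (intro power_mono) auto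
          also have "s ^ 2 = real n" by (simp add: s_def)
          finally show "k \<in> {k. (2 ^ k * m) ^ 2 \<le> n}" by (metis mem_Collect_eq of_nat_le_iff of_nat_power)
        qed
      qed simp
      also have "\<dots> = real (doubling_weight m n M)" by (simp add: doubling_weight_def)
      also have "\<dots> < 7 / 10 * (s * ln (real n) / c)" using M by (simp add: s_def c_def)
      also have "\<dots> = (7 / 10 * ln (real n)) * (s / c)" by simp
      also have "\<dots> \<le> (99 / 100 * real (L n)) * (s / c)"
        using elim(2) Lge[of n] s c by (intro mult_right_mono) auto
      also have "\<dots> = (1 - \<eta>) * a0" by (simp add: \<eta>_def a0_def)
      finally show "M \<in> Bad" using M by (simp add: Bad_def)
    qed
    then have "card {M \<in> mset_partitions n. real (doubling_weight m n M) < 7 / 10 * (sqrt (real n) * ln (real n) / part_rate)} \<le> card Bad"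
      by (intro card_mono) (auto simp: Bad_def finite_mset_partitions)
    with cB show ?case by (simp add: p_def)
  qed
qed

text \<open>With \<delta> = 1 / 50 the decay exponent is at least 49 / 50 * 21 / 40 = 0.5145 > 51 /
  100 times ln n. Relative to p n the first term is then at most of order n^(-0.01) * ln n, and the
  second, at 2 * t, of order n^(-0.02): anything beyond 1 / 2 serves for both.\<close>

lemma num_partitions_decay:
  assumes "\<epsilon> > 0"
  shows "\<forall>\<^sub>F n in sequentially. \<forall>t. 21 / 40 * (sqrt (real n) * ln (real n) / part_rate) \<le> real t \<longrightarrow>
    real t \<le> 7 / 10 * (sqrt (real n) * ln (real n) / part_rate) \<longrightarrow>
    2 * t \<le> n \<and> real t * real (num_partitions (n - t)) + real n * real (num_partitions (n - 2 * t))
      \<le> \<epsilon> * real (num_partitions n)"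
proof -
  define c where "c = part_rate"
  have c: "c \<ge> 1" using part_rate_ge_1 by (simp add: c_def)
  define \<delta> :: real where "\<delta> = 1 / 50"
  have "0 < \<delta>" "\<delta> < 1" by (auto simp: \<delta>_def)
  then obtain n0 where n0: "n0 > 0"
    and up: "\<And>n k. k \<le> n \<Longrightarrow> n0 \<le> n - k \<Longrightarrow> real (num_partitions (n - k)) / real (num_partitions n)
      \<le> (1 + \<delta>) * (real n / real (n - k)) * exp (- ((c - \<delta>) * real k / sqrt (real n)))"
    unfolding c_def using num_partitions_ratio_bounds[of \<delta>] by metis
  have e1: "\<forall>\<^sub>F n in sequentially. 4 * (sqrt (real n) * ln (real n)) \<le> real n - 2 * real n0" by real_asymp
  have e2: "\<forall>\<^sub>F n in sequentially. sqrt (real n) * ln (real n) * (4 * exp (- (51 / 100 * ln (real n)))) \<le> \<epsilon> / 2"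
    using assms by real_asymp
  have e3: "\<forall>\<^sub>F n in sequentially. real n * (4 * exp (- (102 / 100 * ln (real n)))) \<le> \<epsilon> / 2"
    using assms by real_asymp
  show ?thesis using e1 e2 e3 eventually_gt_at_top[of 1]
  proof eventually_elim
    case (elim n)
    define s where "s = sqrt (real n)"
    have s: "s > 0" using elim(4) by (simp add: s_def)
    have ln: "ln (real n) > 0" using elim(4) by simp
    define p where "p = real (num_partitions n)"
    have p: "p > 0" using num_partitions_pos by (simp add: p_def)
    show ?case
    proof (intro allI impI)
      fix t :: nat
      assume t1: "21 / 40 * (sqrt (real n) * ln (real n) / part_rate) \<le> real t"
        and t2: "real t \<le> 7 / 10 * (sqrt (real n) * ln (real n) / part_rate)"
      have "s * ln (real n) / c \<le> s * ln (real n)"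
        using divide_left_mono[of 1 c "s * ln (real n)"] c s ln by simp
      moreover have "s * ln (real n) > 0" using s ln by simp
      ultimately have t3: "real t \<le> s * ln (real n)" using t2 unfolding s_def c_def by linarith
      have 4: "4 * real t \<le> real n - 2 * real n0" using elim(1) t3 unfolding s_def by linarith
      then have nat4: "4 * t + 2 * n0 \<le> n" by linarith
      have rate: "(c - \<delta>) * real t / s \<ge> 51 / 100 * ln (real n)"
      proof -
        have "51 / 100 * ln (real n) \<le> (49 / 50 * (21 / 40)) * ln (real n)" using ln by simp
        also have "\<dots> = (49 / 50 * c) * (21 / 40 * (s * ln (real n) / c)) / s" using s c by simp
        also have "\<dots> \<le> (c - \<delta>) * real t / s"
          using t1 c s ln unfolding s_def c_def
          by (intro divide_right_mono mult_mono) (auto simp: \<delta>_def)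
        finally show ?thesis .
      qed
      have half: "real n / real (n - k) \<le> 2" if "k \<le> 2 * t" for k
        using that nat4 n0 by (simp add: field_simps)
      have gen: "real (num_partitions (n - k)) \<le> p * (4 * exp (- x))"
        if "k \<le> 2 * t" "x \<le> (c - \<delta>) * real k / s" for k x
      proof -
        have "real (num_partitions (n - k)) / p \<le> (1 + \<delta>) * (real n / real (n - k)) * exp (- ((c - \<delta>) * real k / s))"
          unfolding p_def s_def using that nat4 by (intro up) auto
        also have "\<dots> \<le> 2 * 2 * exp (- x)"
          using half[OF that(1)] that(2) by (intro mult_mono) (auto simp: \<delta>_def)
        finally show ?thesis using p by (simp add: field_simps)
      qed
      have g1: "real (num_partitions (n - t)) \<le> p * (4 * exp (- (51 / 100 * ln (real n))))"
        using rate by (intro gen) auto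
      have "102 / 100 * ln (real n) \<le> 2 * ((c - \<delta>) * real t / s)" using rate by linarith
      also have "\<dots> = (c - \<delta>) * real (2 * t) / s" by simp
      finally have g2: "real (num_partitions (n - 2 * t)) \<le> p * (4 * exp (- (102 / 100 * ln (real n))))"
        by (intro gen) auto
      have "real t * real (num_partitions (n - t)) + real n * real (num_partitions (n - 2 * t)) \<le>
        (s * ln (real n)) * (p * (4 * exp (- (51 / 100 * ln (real n))))) + real n * (p * (4 * exp (- (102 / 100 * ln (real n)))))"
        using t3 s ln by (intro add_mono mult_mono g1 g2) auto
      also have "\<dots> = p * (s * ln (real n) * (4 * exp (- (51 / 100 * ln (real n)))) + real n * (4 * exp (- (102 / 100 * ln (real n)))))"
        by (simp only: algebra_simps)
      also have "\<dots> \<le> p * (\<epsilon> / 2 + \<epsilon> / 2)"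
        using elim(2,3) p unfolding s_def by (intro mult_left_mono add_mono) auto
      finally show "2 * t \<le> n \<and> real t * real (num_partitions (n - t)) + real n * real (num_partitions (n - 2 * t))
        \<le> \<epsilon> * real (num_partitions n)" using nat4 by (simp add: p_def mult.commute)
    qed
  qed
qed

text \<open>Between consecutive powers of two the candidates are 4, 5, 6, 8 times 2^k, with
  successive ratios 5 / 4, 6 / 5 and 4 / 3.\<close>

lemma exists_smooth_between:
  fixes y :: real assumes "y \<ge> 4"
  obtains m j :: nat where "m \<in> {1, 3, 5}" "y \<le> real (2 ^ j * m)" "real (2 ^ j * m) \<le> 4 / 3 * y"
proof -
  define i where "i = nat \<lfloor>log 2 y\<rfloor>"
  have "log 2 y \<ge> 2" using assms by (simp add: le_log_iff)
  then have fl: "real i \<le> log 2 y" "log 2 y < real i + 1" "i \<ge> 2" unfolding i_def by linarith+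
  then have lo: "2 ^ i \<le> y" using assms by (simp add: le_log_iff powr_realpow)
  have "y < 2 powr (real (Suc i))" using fl assms by (simp add: log_less_iff add.commute)
  then have hi: "y < 2 ^ Suc i" by (subst (asm) powr_realpow) auto
  from fl(3) obtain k where k: "i = k + 2" by (metis add.commute le_Suc_ex)
  define z :: real where "z = 2 ^ k"
  have z: "4 * z \<le> y" "y < 8 * z" using lo hi by (auto simp: k z_def)
  consider "y \<le> 5 * z" | "5 * z < y" "y \<le> 6 * z" | "6 * z < y" by linarith
  then show thesis
  proof cases
    case 1 then show ?thesis using z by (intro that[of 5 k]) (auto simp: z_def)
  next
    case 2 then show ?thesis using z by (intro that[of 3 "k + 1"]) (auto simp: z_def)
  next
    case 3 then show ?thesis using z by (intro that[of 1 "k + 3"]) (auto simp: z_def power_add)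
  qed
qed

lemma doubling_subset_sum:
  fixes B :: "nat multiset"
  assumes "\<forall>x\<in>#B. \<exists>k\<le>j. x = 2 ^ k * m" "2 ^ j * m \<le> sum_mset B" "m > 0"
  shows "\<exists>A. A \<subseteq># B \<and> sum_mset A = 2 ^ j * m"
  using assms(1,2)
proof (induction "size B" arbitrary: B)
  case 0
  then show ?case using assms(3) by auto
next
  case (Suc s)
  show ?case
  proof (cases "sum_mset B = 2 ^ j * m")
    case False
    define x where "x = Min (set_mset B)"
    have ne: "set_mset B \<noteq> {}" using Suc.hyps(2) by (cases B) auto
    then have x: "x \<in># B" and xmin: "\<And>y. y \<in># B \<Longrightarrow> x \<le> y"
      unfolding x_def by auto
    obtain k where k: "k \<le> j" "x = 2 ^ k * m" using Suc.prems(1) x by blast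
    have dv: "\<forall>y\<in>#B. x dvd y"
    proof
      fix y assume y: "y \<in># B"
      obtain l where l: "y = 2 ^ l * m" using Suc.prems(1) y by blast
      then have "(2::nat) ^ k \<le> 2 ^ l" using xmin[OF y] k(2) assms(3) by simp
      then have "k \<le> l" by simp
      then show "x dvd y" using k(2) l by (simp add: le_imp_power_dvd mult_dvd_mono)
    qed
    have "x dvd sum_mset C" if "\<forall>y\<in>#C. x dvd y" for C
      using that by (induction C) auto
    then have "x dvd sum_mset B" using dv by blast
    moreover have "x dvd 2 ^ j * m" using k by (simp add: le_imp_power_dvd mult_dvd_mono)
    ultimately have "x dvd sum_mset B - 2 ^ j * m" by (rule dvd_diff_nat)
    then have ge: "x \<le> sum_mset B - 2 ^ j * m" using False Suc.prems(2) by (intro dvd_imp_le) auto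
    have sB: "sum_mset B = x + sum_mset (B - {#x#})"
      using x by (metis insert_DiffM sum_mset.add_mset)
    have "\<exists>A. A \<subseteq># B - {#x#} \<and> sum_mset A = 2 ^ j * m"
    proof (rule Suc.hyps(1))
      show "s = size (B - {#x#})" using Suc.hyps(2) x by (simp add: size_Diff_singleton)
      show "\<forall>y\<in>#B - {#x#}. \<exists>k\<le>j. y = 2 ^ k * m" using Suc.prems(1) by (auto dest: in_diffD)
      show "2 ^ j * m \<le> sum_mset (B - {#x#})" using sB ge Suc.prems(2) by linarith
    qed
    then show ?thesis by (meson diff_subset_eq_self subset_mset.order_trans)
  qed auto
qed

text \<open>For odd \<open>m\<close> such a block cannot be told from a single part 2^j * m after j
  squarings.\<close>

definition has_doubling_block :: "nat \<Rightarrow> nat \<Rightarrow> nat multiset \<Rightarrow> bool" where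
  "has_doubling_block m j M \<longleftrightarrow> (\<exists>A. A \<subseteq># M \<and> sum_mset A = 2 ^ j * m \<and> (\<forall>x\<in>#A. \<exists>k\<le>j. x = 2 ^ k * m))"

text \<open>Parts counted in \<open>doubling_weight\<close> are at most sqrt n, hence at most 2^j *
  m, so their levels do not exceed j.\<close>

lemma has_doubling_blockI:
  assumes m: "m > 0" and n: "n \<le> (2 ^ j * m) ^ 2" and ge: "2 ^ j * m \<le> doubling_weight m n M"
  shows "has_doubling_block m j M"
proof -
  define Lv where "Lv = {k. (2 ^ k * m) ^ 2 \<le> n}"
  define S where "S = (\<lambda>k. 2 ^ k * m) ` Lv"
  have fin: "finite Lv" unfolding Lv_def by (rule finite_doubling_levels[OF m])
  have inj: "inj_on (\<lambda>k. 2 ^ k * m) Lv" using m by (intro inj_onI) auto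
  have lej: "k \<le> j" if "k \<in> Lv" for k
  proof -
    have "(2 ^ k * m) ^ 2 \<le> (2 ^ j * m) ^ 2" using that n unfolding Lv_def by (blast intro: order_trans)
    then have "2 ^ k * m \<le> 2 ^ j * m" by (rule power2_le_imp_le) simp
    then show ?thesis using m by simp
  qed
  define B where "B = filter_mset (\<lambda>x. x \<in> S) M"
  have "sum_mset B = (\<Sum>d\<in>S. d * count B d)"
    using fin by (intro sum_mset_eq_sum_count) (auto simp: B_def S_def)
  also have "\<dots> = (\<Sum>d\<in>S. d * count M d)" by (intro sum.cong) (auto simp: B_def)
  also have "\<dots> = doubling_weight m n M"
    unfolding S_def doubling_weight_def Lv_def[symmetric] by (subst sum.reindex[OF inj]) simp
  finally have "2 ^ j * m \<le> sum_mset B" using ge by simp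
  moreover have B: "\<forall>x\<in>#B. \<exists>k\<le>j. x = 2 ^ k * m" using lej by (auto simp: B_def S_def)
  ultimately obtain A where A: "A \<subseteq># B" "sum_mset A = 2 ^ j * m"
    using doubling_subset_sum m by blast
  have "A \<subseteq># M" using A(1) unfolding B_def by (meson multiset_filter_subset subset_mset.order_trans)
  moreover have "\<forall>x\<in>#A. \<exists>k\<le>j. x = 2 ^ k * m" using B A(1) by (meson mset_subset_eqD)
  ultimately show ?thesis unfolding has_doubling_block_def using A(2) by blast
qed

text \<open>The pair m, j depends on n alone and not on the partition, so one and the same block
  cycle later serves all columns that have the block.\<close>

lemma eventually_doubling_block:
  assumes \<epsilon>: "\<epsilon> > 0"
  shows "\<forall>\<^sub>F n in sequentially. \<exists>m j. odd m \<and> 2 * (2 ^ j * m) \<le> n \<and>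
    real (card {M \<in> mset_partitions n. \<not> has_doubling_block m j M}) \<le> \<epsilon> * real (num_partitions n) \<and>
    real (2 ^ j * m) * real (num_partitions (n - 2 ^ j * m)) + real n * real (num_partitions (n - 2 * (2 ^ j * m)))
      \<le> \<epsilon> * real (num_partitions n)"
proof -
  have c: "part_rate > 0" using part_rate_ge_1 by simp
  have e1: "\<forall>\<^sub>F n in sequentially. 4 \<le> 21 / 40 * (sqrt (real n) * ln (real n) / part_rate)"
    using c by real_asymp
  have e2: "\<forall>\<^sub>F n in sequentially. sqrt (real n) \<le> 21 / 40 * (sqrt (real n) * ln (real n) / part_rate)"
    using c by real_asymp
  have w: "\<forall>\<^sub>F n in sequentially. \<forall>m\<in>{1,3,5}.
      real (card {M \<in> mset_partitions n. real (doubling_weight m n M) < 7 / 10 * (sqrt (real n) * ln (real n) / part_rate)})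
      \<le> \<epsilon> * real (num_partitions n)"
    by (intro eventually_ball_finite ballI doubling_weight_large \<epsilon>) auto
  show ?thesis using e1 e2 w num_partitions_decay[OF \<epsilon>]
  proof eventually_elim
    case (elim n)
    define X where "X = sqrt (real n) * ln (real n) / part_rate"
    \<comment> \<open>From 21 / 40 to 7 / 10 is a ratio of exactly 4 / 3.\<close>
    obtain m j where mj: "m \<in> {1, 3, 5::nat}" "21 / 40 * X \<le> real (2 ^ j * m)" "real (2 ^ j * m) \<le> 4 / 3 * (21 / 40 * X)"
      using exists_smooth_between[OF elim(1)[folded X_def]] by metis
    define t where "t = 2 ^ j * m"
    have t: "21 / 40 * X \<le> real t" "real t \<le> 7 / 10 * X" using mj by (auto simp: t_def)
    have dec: "2 * t \<le> n \<and> real t * real (num_partitions (n - t)) + real n * real (num_partitions (n - 2 * t))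
      \<le> \<epsilon> * real (num_partitions n)" using elim(4) t unfolding X_def by blast
    have "sqrt (real n) \<le> real t" using elim(2) t unfolding X_def by linarith
    then have "sqrt (real n) ^ 2 \<le> real t ^ 2" by (intro power_mono) auto
    then have "real n \<le> real (t ^ 2)" by simp
    then have nt: "n \<le> t ^ 2" by (simp only: of_nat_le_iff)
    have m: "m > 0" "odd m" using mj(1) by auto
    have "{M \<in> mset_partitions n. \<not> has_doubling_block m j M} \<subseteq>
        {M \<in> mset_partitions n. real (doubling_weight m n M) < 7 / 10 * X}"
    proof (intro Collect_mono impI, elim conjE, intro conjI)
      fix M assume no: "\<not> has_doubling_block m j M"
      have "\<not> t \<le> doubling_weight m n M"
        using has_doubling_blockI[OF m(1) nt[unfolded t_def]] no by (auto simp: t_def)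
      then show "real (doubling_weight m n M) < 7 / 10 * X" using t by linarith
    qed
    then have "card {M \<in> mset_partitions n. \<not> has_doubling_block m j M} \<le>
        card {M \<in> mset_partitions n. real (doubling_weight m n M) < 7 / 10 * X}"
      by (intro card_mono) (auto simp: finite_mset_partitions)
    also have "real \<dots> \<le> \<epsilon> * real (num_partitions n)" using elim(3) mj(1) unfolding X_def by blast
    finally show ?case using m dec unfolding t_def by (intro exI[of _ m] exI[of _ j]) auto
  qed
qed

section \<open>Traces and integrality\<close>

lemma sum_fun_apply: "(\<Sum>i\<in>A. f i) x = (\<Sum>i\<in>A. f i x)" for f :: "'i \<Rightarrow> 'a \<Rightarrow> 'b::comm_monoid_add"
  by (induction A rule: infinite_finite_induct) auto

text \<open>The localization of the integers at the prime \<open>p\<close>, inside the complex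
  numbers.\<close>

definition p_integral :: "nat \<Rightarrow> complex set" where
  "p_integral p = {z. \<exists>a b::int. \<not> int p dvd b \<and> z = of_int a / of_int b}"

context
  fixes p :: nat assumes p: "prime p"
begin

lemma p_integral_of_int: "of_int a \<in> p_integral p"
  unfolding p_integral_def using p
  by (intro CollectI exI[of _ a] exI[of _ 1]) (auto dest: prime_gt_1_nat)

lemma p_integral_0: "0 \<in> p_integral p" and p_integral_1: "1 \<in> p_integral p"
  using p_integral_of_int[of 0] p_integral_of_int[of 1] by simp_all

lemma p_integral_mult: "x \<in> p_integral p \<Longrightarrow> y \<in> p_integral p \<Longrightarrow> x * y \<in> p_integral p"
proof -
  assume "x \<in> p_integral p" "y \<in> p_integral p"
  then obtain a b c d where *: "\<not> int p dvd b" "x = of_int a / of_int b" "\<not> int p dvd d" "y = of_int c / of_int d"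
    unfolding p_integral_def by blast
  have "\<not> int p dvd b * d" using * p by (simp add: prime_dvd_mult_iff)
  then show ?thesis unfolding p_integral_def using *
    by (intro CollectI exI[of _ "a * c"] exI[of _ "b * d"]) auto
qed

lemma p_integral_add: "x \<in> p_integral p \<Longrightarrow> y \<in> p_integral p \<Longrightarrow> x + y \<in> p_integral p"
proof -
  assume "x \<in> p_integral p" "y \<in> p_integral p"
  then obtain a b c d where *: "\<not> int p dvd b" "x = of_int a / of_int b" "\<not> int p dvd d" "y = of_int c / of_int d"
    unfolding p_integral_def by blast
  have "\<not> int p dvd b * d" using * p by (simp add: prime_dvd_mult_iff)
  moreover have "b \<noteq> 0" "d \<noteq> 0" using * by auto
  ultimately show ?thesis unfolding p_integral_def using *
    by (intro CollectI exI[of _ "a * d + c * b"] exI[of _ "b * d"]) (auto simp: field_simps)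
qed

lemma p_integral_diff: "x \<in> p_integral p \<Longrightarrow> y \<in> p_integral p \<Longrightarrow> x - y \<in> p_integral p"
  using p_integral_add[of x "(-1) * y"] p_integral_mult[of "-1" y] p_integral_of_int[of "-1"] by simp

lemma p_integral_sum: "(\<And>i. i \<in> A \<Longrightarrow> f i \<in> p_integral p) \<Longrightarrow> sum f A \<in> p_integral p"
  by (induction A rule: infinite_finite_induct) (auto intro: p_integral_0 p_integral_add)

lemma p_integral_Rats: "z \<in> p_integral p \<Longrightarrow> z \<in> \<rat>"
  by (auto simp: p_integral_def)

text \<open>The localization is a valuation ring: in lowest terms p cannot divide both numerator and
  denominator.\<close>

lemma p_integral_inverse:
  assumes "z \<in> \<rat>" "z \<notin> p_integral p" shows "inverse z \<in> p_integral p"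
proof -
  obtain a b where ab: "z = of_int a / of_int b" "b > 0" "coprime a b"
    using assms(1) by (elim Rats_cases') auto
  have "int p dvd b" using assms(2) ab(1) unfolding p_integral_def by blast
  then have "\<not> int p dvd a" using ab(3) p
    by (metis coprime_common_divisor not_prime_unit prime_nat_int_transfer)
  then show ?thesis unfolding p_integral_def using ab
    by (intro CollectI exI[of _ b] exI[of _ a]) auto
qed

text \<open>The pivot is an entry of least p-adic valuation, found by comparing the new entry with
  the best one so far through their quotient.\<close>

lemma p_integral_pivot:
  assumes "finite X" "\<forall>x\<in>X. g x \<in> \<rat>" "\<exists>x\<in>X. g x \<noteq> 0"
  shows "\<exists>x0\<in>X. g x0 \<noteq> 0 \<and> (\<forall>y\<in>X. g y / g x0 \<in> p_integral p)"
  using assms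
proof (induction X)
  case (insert y X)
  show ?case
  proof (cases "\<exists>x\<in>X. g x \<noteq> 0")
    case False
    then show ?thesis using insert by (intro bexI[of _ y]) (auto simp: p_integral_0 p_integral_1)
  next
    case True
    then obtain x0 where x0: "x0 \<in> X" "g x0 \<noteq> 0" "\<forall>y\<in>X. g y / g x0 \<in> p_integral p" using insert by auto
    show ?thesis
    proof (cases "g y / g x0 \<in> p_integral p")
      case True then show ?thesis using x0 by (intro bexI[of _ x0]) auto
    next
      case False
      have "g y / g x0 \<in> \<rat>" using insert.prems x0 by auto
      from p_integral_inverse[OF this False] have i: "g x0 / g y \<in> p_integral p" by simp
      have "g y \<noteq> 0" using False p_integral_0 by auto
      moreover have "g z / g y \<in> p_integral p" if "z \<in> X" for z
        using p_integral_mult[OF x0(3)[rule_format, OF that] i] x0 by simp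
      ultimately show ?thesis by (intro bexI[of _ y]) (auto simp: p_integral_1)
    qed
  qed
qed simp

end

text \<open>A prime divisor of the reduced denominator would contradict integrality at that
  prime.\<close>

lemma Ints_if_p_integral:
  assumes "\<And>p. prime p \<Longrightarrow> z \<in> p_integral p" shows "z \<in> \<int>"
proof -
  have "z \<in> \<rat>" using p_integral_Rats[OF two_is_prime_nat assms[OF two_is_prime_nat]] .
  then obtain a b where ab: "z = of_int a / of_int b" "b > 0" "coprime a b"
    by (elim Rats_cases') auto
  have "b = 1"
  proof (rule ccontr)
    assume "b \<noteq> 1"
    then have "nat b \<noteq> 1" using ab(2) by (simp add: nat_eq_iff)
    then obtain q where q: "prime q" "q dvd nat b" using prime_factor_nat by blast
    then have qb: "int q dvd b" using ab(2) by (metis int_dvd_int_iff int_nat_eq less_imp_le)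
    obtain c d where cd: "\<not> int q dvd d" "z = of_int c / of_int d"
      using assms[OF q(1)] unfolding p_integral_def by blast
    have "d \<noteq> 0" using cd by auto
    then have "(of_int (a * d) :: complex) = of_int (c * b)"
      using ab(1,2) cd(2) by (simp add: field_simps)
    then have "a * d = c * b" by (simp only: of_int_eq_iff)
    then have "int q dvd a * d" using qb by simp
    then have "int q dvd a" using cd(1) q(1) by (simp add: prime_dvd_mult_iff)
    with qb ab(3) q(1) show False
      by (metis coprime_common_divisor not_prime_unit prime_nat_int_transfer)
  qed
  then show ?thesis using ab by simp
qed

text \<open>A basis in reduced row echelon form: the coordinates of a vector are its values at the
  pivots. Traces become sums of point values and inherit integrality from the entries of the
  basis.\<close>

definition pivot_basis :: "('a \<Rightarrow> complex) set \<Rightarrow> 'a set \<Rightarrow> ('a \<Rightarrow> 'a \<Rightarrow> complex) \<Rightarrow> bool" where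
  "pivot_basis V P v \<longleftrightarrow> finite P \<and> (\<forall>x\<in>P. v x \<in> V) \<and>
     (\<forall>x\<in>P. \<forall>y\<in>P. v x y = (if x = y then 1 else 0)) \<and>
     (\<forall>u\<in>V. \<forall>z. u z = (\<Sum>x\<in>P. u x * v x z))"

text \<open>Lets the expansion property of an echelon basis be checked on a spanning set.\<close>

lemma subspace_pivot_expansion:
  "fun_space.subspace {f. \<forall>z. f z = (\<Sum>x\<in>P. f x * v x z)}"
  unfolding fun_space.subspace_def
proof (intro conjI allI ballI CollectI)
  fix f g z assume "f \<in> {f. \<forall>z. f z = (\<Sum>x\<in>P. f x * v x z)}" "g \<in> {f. \<forall>z. f z = (\<Sum>x\<in>P. f x * v x z)}"
  then have "f z = (\<Sum>x\<in>P. f x * v x z)" "g z = (\<Sum>x\<in>P. g x * v x z)" by blast+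
  then show "(f + g) z = (\<Sum>x\<in>P. (f + g) x * v x z)"
    by (simp only: plus_fun_apply distrib_right sum.distrib)
next
  fix c f z assume "f \<in> {f. \<forall>z. f z = (\<Sum>x\<in>P. f x * v x z)}"
  then have "f z = (\<Sum>x\<in>P. f x * v x z)" by blast
  then show "fun_scale c f z = (\<Sum>x\<in>P. fun_scale c f x * v x z)"
    by (simp only: fun_scale_def mult.assoc sum_distrib_left)
qed simp

text \<open>Gauss-Jordan elimination, one generator at a time. Dividing by a pivot of least
  valuation keeps all entries p-integral, which an arbitrary nonzero pivot would not
  guarantee.\<close>

lemma exists_pivot_basis:
  assumes p: "prime p" and X: "finite X" and F: "finite F"
    and rat: "\<And>f x. f \<in> F \<Longrightarrow> f x \<in> \<rat>" and supp: "\<And>f x. f \<in> F \<Longrightarrow> x \<notin> X \<Longrightarrow> f x = 0"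
  shows "\<exists>P v. P \<subseteq> X \<and> pivot_basis (fun_space.span F) P v \<and> (\<forall>x\<in>P. \<forall>y. v x y \<in> p_integral p)"
  using F rat supp
proof (induction F)
  case empty
  show ?case by (intro exI[of _ "{}"]) (auto simp: pivot_basis_def)
next
  case (insert w F)
  have "\<exists>P v. P \<subseteq> X \<and> pivot_basis (fun_space.span F) P v \<and> (\<forall>x\<in>P. \<forall>y. v x y \<in> p_integral p)"
    using insert.prems by (intro insert.IH) auto
  then obtain P v where P: "P \<subseteq> X" "pivot_basis (fun_space.span F) P v" "\<forall>x\<in>P. \<forall>y. v x y \<in> p_integral p"
    by blast
  have fin: "finite P" and vV: "\<And>x. x \<in> P \<Longrightarrow> v x \<in> fun_space.span F"
    and vd: "\<And>x y. x \<in> P \<Longrightarrow> y \<in> P \<Longrightarrow> v x y = (if x = y then 1 else 0)"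
    and vs: "\<And>u z. u \<in> fun_space.span F \<Longrightarrow> u z = (\<Sum>x\<in>P. u x * v x z)"
    using P(2) unfolding pivot_basis_def by blast+
  \<comment> \<open>Clears the old pivot positions of the new generator.\<close>
  define w' where "w' = w - (\<Sum>x\<in>P. fun_scale (w x) (v x))"
  have w'z: "w' z = w z - (\<Sum>x\<in>P. w x * v x z)" for z
    by (simp add: w'_def sum_fun_apply fun_scale_def)
  have vS: "v x \<in> fun_space.span (insert w F)" if "x \<in> P" for x
    using vV[OF that] fun_space.span_mono[of F "insert w F"] by auto
  have w'S: "w' \<in> fun_space.span (insert w F)"
    unfolding w'_def
    by (intro fun_space.span_diff fun_space.span_sum fun_space.span_scale fun_space.span_base vS) auto
  show ?case
  proof (cases "\<forall>z. w' z = 0")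
    case True
    then have "w' = 0" by auto
    then have eq: "(\<Sum>x\<in>P. fun_scale (w x) (v x)) = w" by (simp add: w'_def)
    have "(\<Sum>x\<in>P. fun_scale (w x) (v x)) \<in> fun_space.span F"
      using vV by (intro fun_space.span_sum fun_space.span_scale)
    then have "w \<in> fun_space.span F" unfolding eq .
    then have "fun_space.span (insert w F) = fun_space.span F" by (rule fun_space.span_redundant)
    then show ?thesis using P by auto
  next
    case False
    have ratw: "w' z \<in> \<rat>" for z
      unfolding w'z using insert.prems(1) P(3) p_integral_Rats[OF p]
      by (intro Rats_diff Rats_sum Rats_mult) auto
    have suppw: "w' z = 0" if "z \<notin> X" for z
    proof -
      have S: "fun_space.span (insert w F) \<subseteq> {f. f z = 0}"
        using insert.prems(2) that
        by (intro fun_space.span_minimal) (auto simp: fun_space.subspace_def fun_scale_def)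
      then show ?thesis using w'S by auto
    qed
    have "\<exists>x\<in>X. w' x \<noteq> 0" using False suppw by blast
    then obtain x0 where x0: "x0 \<in> X" "w' x0 \<noteq> 0" "\<forall>y\<in>X. w' y / w' x0 \<in> p_integral p"
      using p_integral_pivot[OF p X] ratw by blast
    define u where "u = fun_scale (1 / w' x0) w'"
    have uz: "u z = w' z / w' x0" for z by (simp add: u_def fun_scale_def)
    have uS: "u \<in> fun_space.span (insert w F)" unfolding u_def by (intro fun_space.span_scale w'S)
    have ui: "u z \<in> p_integral p" for z
      using x0(3) suppw p_integral_0[OF p] unfolding uz by (cases "z \<in> X") auto
    have w'P: "w' x = 0" if "x \<in> P" for x
    proof -
      have "(\<Sum>y\<in>P. w y * v y x) = (\<Sum>y\<in>P. if y = x then w x else 0)"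
        using that by (intro sum.cong) (auto simp: vd)
      then show ?thesis using that fin by (simp add: w'z)
    qed
    then have x0P: "x0 \<notin> P" using x0(2) by auto
    have u0: "u x = 0" if "x \<in> P" for x using w'P that by (simp add: uz)
    have u1: "u x0 = 1" using x0(2) by (simp add: uz)
    \<comment> \<open>Clears the new pivot position in the old basis vectors.\<close>
    define v' where "v' = (\<lambda>x. if x = x0 then u else v x - fun_scale (v x x0) u)"
    have v'P: "v' x z = v x z - v x x0 * u z" if "x \<in> P" for x z
      using that x0P by (auto simp: v'_def fun_scale_def)
    have exp: "(\<Sum>x\<in>insert x0 P. f x * v' x z) = (\<Sum>x\<in>P. f x * v x z) + u z * (f x0 - (\<Sum>x\<in>P. f x * v x x0))" for f z
    proof -
      have "(\<Sum>x\<in>insert x0 P. f x * v' x z) = f x0 * u z + (\<Sum>x\<in>P. f x * (v x z - v x x0 * u z))"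
        using fin x0P v'P by (simp add: v'_def)
      also have "(\<Sum>x\<in>P. f x * (v x z - v x x0 * u z)) = (\<Sum>x\<in>P. f x * v x z) - u z * (\<Sum>x\<in>P. f x * v x x0)"
        by (simp add: sum_subtractf sum_distrib_left algebra_simps)
      finally show ?thesis by (simp add: algebra_simps)
    qed
    have S: "fun_space.span (insert w F) \<subseteq> {f. \<forall>z. f z = (\<Sum>x\<in>insert x0 P. f x * v' x z)}"
    proof (rule fun_space.span_minimal)
      show "insert w F \<subseteq> {f. \<forall>z. f z = (\<Sum>x\<in>insert x0 P. f x * v' x z)}"
      proof (intro subsetI CollectI allI)
        fix f z assume "f \<in> insert w F"
        then consider "f = w" | "f \<in> fun_space.span F" by (auto intro: fun_space.span_base)
        then show "f z = (\<Sum>x\<in>insert x0 P. f x * v' x z)"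
        proof cases
          case 1 then show ?thesis unfolding exp using w'z[of z] w'z[of x0] x0(2) by (simp add: uz)
        next
          case 2 then show ?thesis unfolding exp using vs[OF 2, of z] vs[OF 2, of x0] by simp
        qed
      qed
    qed (rule subspace_pivot_expansion)
    have "pivot_basis (fun_space.span (insert w F)) (insert x0 P) v'"
      unfolding pivot_basis_def
    proof (intro conjI ballI allI)
      show "finite (insert x0 P)" using fin by simp
      show "v' x \<in> fun_space.span (insert w F)" if "x \<in> insert x0 P" for x
        using that uS vS unfolding v'_def by (auto intro!: fun_space.span_diff fun_space.span_scale)
      show "v' x y = (if x = y then 1 else 0)" if "x \<in> insert x0 P" "y \<in> insert x0 P" for x y
        using that u0 u1 x0P vd by (auto simp: v'_def fun_scale_def)
      show "f z = (\<Sum>x\<in>insert x0 P. f x * v' x z)" if "f \<in> fun_space.span (insert w F)" for f z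
        using S that by blast
    qed
    moreover have "\<forall>x\<in>insert x0 P. \<forall>y. v' x y \<in> p_integral p"
      using ui P(3) v'P by (auto simp: v'_def fun_scale_def intro!: p_integral_diff[OF p] p_integral_mult[OF p])
    ultimately show ?thesis using P(1) x0(1) by (intro exI[of _ "insert x0 P"] exI[of _ v']) auto
  qed
qed

section \<open>Traces in echelon bases\<close>

definition lin_op :: "(('a \<Rightarrow> complex) \<Rightarrow> ('b \<Rightarrow> complex)) \<Rightarrow> bool" where
  "lin_op T \<longleftrightarrow> (\<forall>f g. T (f + g) = T f + T g) \<and> (\<forall>c f. T (fun_scale c f) = fun_scale c (T f))"

lemma lin_op_sum:
  assumes "lin_op T" shows "T (\<Sum>i\<in>A. fun_scale (c i) (f i)) = (\<Sum>i\<in>A. fun_scale (c i) (T (f i)))"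
proof -
  have "T (0 + 0) = T 0 + T 0" using assms unfolding lin_op_def by blast
  then have "T 0 = 0" by simp
  then show ?thesis
    using assms by (induction A rule: infinite_finite_induct) (auto simp: lin_op_def)
qed

text \<open>\<open>T\<close> induces the zero map on the quotient of \<open>Z\<close> by
  \<open>U\<close>. Concretely: expand \<open>T (v x)\<close> in the basis of \<open>U\<close> and
  \<open>u y\<close> in that of \<open>Z\<close>, then exchange the sums.\<close>

lemma pivot_trace_subspace:
  assumes T: "lin_op T" and Z: "pivot_basis Z P v" and U: "pivot_basis U Q u"
    and UZ: "U \<subseteq> Z" and TU: "\<And>f. f \<in> Z \<Longrightarrow> T f \<in> U"
  shows "(\<Sum>x\<in>P. T (v x) x) = (\<Sum>y\<in>Q. T (u y) y)"
proof -
  have uZ: "u y = (\<Sum>x\<in>P. fun_scale (u y x) (v x))" if "y \<in> Q" for y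
  proof -
    have "u y \<in> Z" using U UZ that unfolding pivot_basis_def by blast
    then have *: "u y z = (\<Sum>x\<in>P. u y x * v x z)" for z using Z unfolding pivot_basis_def by blast
    show ?thesis by (rule ext) (unfold sum_fun_apply fun_scale_def, rule *)
  qed
  have "(\<Sum>x\<in>P. T (v x) x) = (\<Sum>x\<in>P. \<Sum>y\<in>Q. T (v x) y * u y x)"
  proof (intro sum.cong refl)
    fix x assume "x \<in> P"
    then have "T (v x) \<in> U" using Z TU unfolding pivot_basis_def by blast
    then show "T (v x) x = (\<Sum>y\<in>Q. T (v x) y * u y x)" using U unfolding pivot_basis_def by blast
  qed
  also have "\<dots> = (\<Sum>y\<in>Q. \<Sum>x\<in>P. T (v x) y * u y x)" by (rule sum.swap)
  also have "\<dots> = (\<Sum>y\<in>Q. T (u y) y)"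
  proof (intro sum.cong refl)
    fix y assume "y \<in> Q"
    from uZ[OF this] have "T (u y) y = T (\<Sum>x\<in>P. fun_scale (u y x) (v x)) y"
      by (rule arg_cong[where f = "\<lambda>f. T f y"])
    also have "\<dots> = (\<Sum>x\<in>P. T (v x) y * u y x)"
      by (subst lin_op_sum[OF T]) (simp add: sum_fun_apply fun_scale_def mult.commute)
    finally show "(\<Sum>x\<in>P. T (v x) y * u y x) = T (u y) y" ..
  qed
  finally show ?thesis .
qed

text \<open>The definition picks an unknown basis; expanding each of the two bases in the other and
  exchanging the sums shows that the choice does not matter.\<close>

lemma trace_on_pivot:
  assumes T: "lin_op T" and V: "fun_space.subspace V" and P: "pivot_basis V P v"
    and TV: "\<And>f. f \<in> V \<Longrightarrow> T f \<in> V"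
  shows "trace_on V T = (\<Sum>x\<in>P. T (v x) x)"
proof -
  define B where "B = (SOME B. fun_space.independent B \<and> fun_space.span B = V)"
  obtain B0 where "B0 \<subseteq> V" "fun_space.independent B0" "V \<subseteq> fun_space.span B0"
    by (rule fun_space.maximal_independent_subset[of V])
  then have "fun_space.independent B0 \<and> fun_space.span B0 = V"
    using V fun_space.span_minimal by blast
  then have B: "fun_space.independent B" "fun_space.span B = V"
    unfolding B_def using someI[of "\<lambda>B. fun_space.independent B \<and> fun_space.span B = V" B0] by blast+
  have vs: "\<And>u z. u \<in> V \<Longrightarrow> u z = (\<Sum>x\<in>P. u x * v x z)" and vV: "\<And>x. x \<in> P \<Longrightarrow> v x \<in> V" and fin: "finite P"
    using P unfolding pivot_basis_def by blast+
  have vs': "u = (\<Sum>x\<in>P. fun_scale (u x) (v x))" if "u \<in> V" for u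
    by (rule ext) (unfold sum_fun_apply fun_scale_def, rule vs[OF that])
  have BV: "b \<in> V" if "b \<in> B" for b using B(2) fun_space.span_base[OF that] by simp
  have "B \<subseteq> fun_space.span (v ` P)"
  proof
    fix b assume "b \<in> B"
    then have "b = (\<Sum>x\<in>P. fun_scale (b x) (v x))" using vs' BV by blast
    also have "\<dots> \<in> fun_space.span (v ` P)"
      by (intro fun_space.span_sum fun_space.span_scale fun_space.span_base) auto
    finally show "b \<in> fun_space.span (v ` P)" .
  qed
  then have finB: "finite B" using fun_space.independent_span_bound[of "v ` P" B] fin B by auto
  let ?r = "fun_space.representation B"
  have "trace_on V T = (\<Sum>b\<in>B. ?r (T b) b)" by (simp add: trace_on_def B_def Let_def)
  also have "\<dots> = (\<Sum>b\<in>B. \<Sum>x\<in>P. T b x * ?r (v x) b)"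
  proof (intro sum.cong refl)
    fix b assume "b \<in> B"
    have "T b \<in> V" using TV BV \<open>b \<in> B\<close> by blast
    from vs'[OF this] have "?r (T b) b = ?r (\<Sum>x\<in>P. fun_scale (T b x) (v x)) b"
      by (rule arg_cong[where f = "\<lambda>u. ?r u b"])
    also have "\<dots> = (\<Sum>x\<in>P. ?r (fun_scale (T b x) (v x)) b)"
      using B vV by (subst fun_space.representation_sum) (auto intro!: fun_space.subspace_scale V)
    also have "\<dots> = (\<Sum>x\<in>P. T b x * ?r (v x) b)"
      using B vV by (intro sum.cong refl) (simp add: fun_space.representation_scale)
    finally show "?r (T b) b = (\<Sum>x\<in>P. T b x * ?r (v x) b)" .
  qed
  also have "\<dots> = (\<Sum>x\<in>P. \<Sum>b\<in>B. T b x * ?r (v x) b)" by (rule sum.swap)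
  also have "\<dots> = (\<Sum>x\<in>P. T (v x) x)"
  proof (intro sum.cong refl)
    fix x assume "x \<in> P"
    have "v x = (\<Sum>b\<in>B. fun_scale (?r (v x) b) b)"
      using fun_space.sum_representation_eq[of B "v x" B] B vV[OF \<open>x \<in> P\<close>] finB by simp
    then have "T (v x) = T (\<Sum>b\<in>B. fun_scale (?r (v x) b) b)" by (rule arg_cong)
    also have "\<dots> = (\<Sum>b\<in>B. fun_scale (?r (v x) b) (T b))" by (rule lin_op_sum[OF T])
    finally show "(\<Sum>b\<in>B. T b x * ?r (v x) b) = T (v x) x"
      by (simp add: sum_fun_apply fun_scale_def mult.commute)
  qed
  finally show ?thesis .
qed

section \<open>Cycle types\<close>

lemma permutes_lessThan_permutation: "p permutes {..<n::nat} \<Longrightarrow> permutation p"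
  using permutation_permutes by blast

lemma orbit_period:
  fixes x :: 'a
  assumes "permutation p"
  defines "d \<equiv> card (orbit p x)"
  shows "d > 0" "orbit p x = (\<lambda>i. (p ^^ i) x) ` {..<d}" "inj_on (\<lambda>i. (p ^^ i) x) {..<d}" "(p ^^ d) x = x"
proof -
  have self: "x \<in> orbit p x" by (rule permutation_self_in_orbit[OF assms(1)])
  define e where "e = funpow_dist1 p x x"
  have im: "orbit p x = (\<lambda>i. (p ^^ i) x) ` {0..<e}" unfolding e_def by (rule orbit_conv_funpow_dist1[OF self])
  have inj: "inj_on (\<lambda>i. (p ^^ i) x) {0..<e}" unfolding e_def by (rule inj_on_funpow_dist1[OF self])
  have de: "d = e" unfolding d_def im using card_image[OF inj] by simp
  show "d > 0" unfolding de e_def by simp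
  show "orbit p x = (\<lambda>i. (p ^^ i) x) ` {..<d}" using im by (simp add: de lessThan_atLeast0)
  show "inj_on (\<lambda>i. (p ^^ i) x) {..<d}" using inj by (simp add: de lessThan_atLeast0)
  show "(p ^^ d) x = x" unfolding de e_def by (rule funpow_dist1_prop[OF self])
qed

lemma funpow_mult_period: "(p ^^ d) x = x \<Longrightarrow> (p ^^ (d * k)) x = x"
  by (induction k) (simp_all add: funpow_add)

lemma finite_orbit_permutation: "permutation p \<Longrightarrow> finite (orbit p x)"
  by (intro finite_orbit permutation_self_in_orbit)

lemma orbit_eq_iff_permutation:
  assumes "permutation p" shows "y \<in> orbit p x \<longleftrightarrow> orbit p y = orbit p x"
proof
  assume "y \<in> orbit p x"
  then show "orbit p y = orbit p x"
    using cyclic_on_orbit'[OF assms, of x] by (intro orbit_cyclic_eq3) auto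
next
  assume "orbit p y = orbit p x"
  then show "y \<in> orbit p x" using permutation_self_in_orbit[OF assms, of y] by simp
qed

text \<open>Squaring cuts a cycle of even length into two halves, whereas 2 is invertible modulo an
  odd length.\<close>

lemma card_orbit_square:
  assumes p: "permutation p"
  shows "card (orbit (p \<circ> p) x) =
    (if even (card (orbit p x)) then card (orbit p x) div 2 else card (orbit p x))"
proof -
  define d where "d = card (orbit p x)"
  note per = orbit_period[OF p, of x, folded d_def]
  have pp: "permutation (p \<circ> p)" using p by (rule permutation_compose[OF _ p])
  have pow: "((p \<circ> p) ^^ k) y = (p ^^ (2 * k)) y" for k y
    by (induction k) simp_all
  show ?thesis
  proof (cases "even d")
    case True
    then obtain e where e: "d = 2 * e" by auto
    have "e > 0" using per(1) e by simp
    have "((p \<circ> p) ^^ e) x = x" using per(4) pow e by simp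
    then have "orbit (p \<circ> p) x = {((p \<circ> p) ^^ m) x | m. m < e}"
      using \<open>e > 0\<close> by (rule orbit_altdef_bounded)
    also have "\<dots> = (\<lambda>i. (p ^^ i) x) ` ((*) 2 ` {..<e})" unfolding pow by auto
    finally have "card (orbit (p \<circ> p) x) = card ((*) (2::nat) ` {..<e})"
      using per(3) e by (simp only:) (intro card_image inj_on_subset[OF per(3)], auto)
    also have "\<dots> = e" by (subst card_image) (auto simp: inj_on_def)
    finally show ?thesis using e by (simp add: d_def[symmetric])
  next
    case False
    have "orbit (p \<circ> p) x = orbit p x"
    proof
      show "orbit (p \<circ> p) x \<subseteq> orbit p x"
        unfolding orbit_altdef_permutation[OF p] orbit_altdef_permutation[OF pp] pow by auto
      show "orbit p x \<subseteq> orbit (p \<circ> p) x"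
      proof
        fix y assume "y \<in> orbit p x"
        then obtain i where i: "y = (p ^^ i) x" unfolding orbit_altdef_permutation[OF p] by auto
        \<comment> \<open>(d + 1) div 2 is the inverse of 2 modulo the odd period d.\<close>
        have "((p \<circ> p) ^^ (i * ((d + 1) div 2))) x = (p ^^ (i * (2 * ((d + 1) div 2)))) x"
          unfolding pow by (simp add: mult_ac)
        also have "i * (2 * ((d + 1) div 2)) = i + d * i" using False by (simp add: algebra_simps)
        also have "(p ^^ (i + d * i)) x = y"
          using funpow_mult_period[OF per(4), of i] i by (simp add: funpow_add)
        finally have "y = ((p \<circ> p) ^^ (i * ((d + 1) div 2))) x" ..
        then show "y \<in> orbit (p \<circ> p) x" unfolding orbit_altdef_permutation[OF pp] by blast
      qed
    qed
    then show ?thesis using False by (simp add: d_def)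
  qed
qed

text \<open>Counting points instead of orbits avoids sets of sets: the number is d times the
  multiplicity of d, so these numbers for d > 0 determine the cycle type.\<close>

definition points_of_length :: "nat \<Rightarrow> (nat \<Rightarrow> nat) \<Rightarrow> nat \<Rightarrow> nat" where
  "points_of_length n p d = card {x\<in>{..<n}. card (orbit p x) = d}"

lemma count_cycle_type:
  assumes p: "p permutes {..<n}"
  shows "d * count (cycle_type n p) d = points_of_length n p d" "0 \<notin># cycle_type n p"
proof -
  have pp: "permutation p" using p by (rule permutes_lessThan_permutation)
  define Os where "Os = orbit p ` {..<n}"
  have fin: "finite Os" by (simp add: Os_def)
  have "count (cycle_type n p) d = card {A \<in> Os. card A = d}"
    unfolding cycle_type_def Os_def[symmetric] using fin
    by (simp add: count_image_mset' sum.If_cases Int_def conj_commute vimage_def)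
      (simp add: card_eq_sum[symmetric] eq_commute[of d] conj_commute)
  moreover have "points_of_length n p d = card (\<Union> {A \<in> Os. card A = d})"
  proof -
    have "{x\<in>{..<n}. card (orbit p x) = d} = \<Union> {A \<in> Os. card A = d}"
      using permutes_orbit_subset[OF p] permutation_self_in_orbit[OF pp] orbit_eq_iff_permutation[OF pp]
      unfolding Os_def by auto
    then show ?thesis by (simp add: points_of_length_def)
  qed
  moreover have "card (\<Union> {A \<in> Os. card A = d}) = (\<Sum>A\<in>{A \<in> Os. card A = d}. card A)"
  proof (rule card_Union_disjoint)
    show "pairwise disjnt {A \<in> Os. card A = d}"
      using orbit_eq_iff_permutation[OF pp] unfolding pairwise_def Os_def disjnt_def by blast
    show "finite A" if "A \<in> {A \<in> Os. card A = d}" for A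
      using that finite_orbit_permutation[OF pp] by (auto simp: Os_def)
  qed
  ultimately show "d * count (cycle_type n p) d = points_of_length n p d" by simp
  show "0 \<notin># cycle_type n p"
    unfolding cycle_type_def using orbit_period(1)[OF pp] by (auto simp: image_iff)
qed

lemma cycle_type_eqI:
  assumes "p permutes {..<n}" "0 \<notin># M" "\<And>d. d > 0 \<Longrightarrow> d * count M d = points_of_length n p d"
  shows "cycle_type n p = M"
proof (rule multiset_eqI)
  fix d show "count (cycle_type n p) d = count M d"
    using count_cycle_type[OF assms(1)] assms(2,3)
    by (cases "d = 0") (auto simp: not_in_iff, metis mult_left_cancel)
qed

lemma cycle_type_mset_partitions:
  assumes p: "p permutes {..<n}" shows "cycle_type n p \<in> mset_partitions n"
proof -
  have pp: "permutation p" using p by (rule permutes_lessThan_permutation)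
  have le: "card (orbit p x) \<le> n" if "x < n" for x
    using card_mono[OF finite_lessThan permutes_orbit_subset[OF p, of x]] that by auto
  have sub: "set_mset (cycle_type n p) \<subseteq> {..n}" unfolding cycle_type_def using le by auto
  have "sum_mset (cycle_type n p) = (\<Sum>d\<le>n. d * count (cycle_type n p) d)"
    using sub by (intro sum_mset_eq_sum_count) auto
  also have "\<dots> = (\<Sum>d\<le>n. card {x\<in>{..<n}. card (orbit p x) = d})"
    by (simp add: count_cycle_type(1)[OF p] points_of_length_def)
  also have "\<dots> = card {..<n}"
    using le unfolding card_eq_sum by (intro sum.group) auto
  finally show ?thesis using count_cycle_type(2)[OF p] by (simp add: mset_partitions_def)
qed

text \<open>The effect on the cycle type of squaring a permutation.\<close>

definition split_even :: "nat multiset \<Rightarrow> nat multiset" where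
  "split_even M = (\<Sum>d\<in>#M. if even d then {#d div 2, d div 2#} else {#d#})"

lemma split_even_add: "split_even (M + N) = split_even M + split_even N"
  by (simp add: split_even_def)

lemma count_split_even:
  "count (split_even M) e = (if odd e then count M e else 0) + 2 * count M (2 * e)"
proof (induction M)
  case (add x M)
  have "split_even (add_mset x M) = (if even x then {#x div 2, x div 2#} else {#x#}) + split_even M"
    by (simp add: split_even_def)
  then show ?case using add by (auto elim!: evenE)
qed (simp add: split_even_def)

lemma cycle_type_square:
  assumes p: "p permutes {..<n}"
  shows "cycle_type n (p \<circ> p) = split_even (cycle_type n p)"
proof (rule cycle_type_eqI)
  have pp: "permutation p" using p by (rule permutes_lessThan_permutation)
  show "p \<circ> p permutes {..<n}" using p by (rule permutes_compose[OF _ p])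
  show "0 \<notin># split_even (cycle_type n p)"
    using count_cycle_type(2)[OF p] by (simp add: count_split_even not_in_iff)
  fix e :: nat assume "e > 0"
  have "{x\<in>{..<n}. card (orbit (p \<circ> p) x) = e} =
      (if odd e then {x\<in>{..<n}. card (orbit p x) = e} else {}) \<union> {x\<in>{..<n}. card (orbit p x) = 2 * e}"
    unfolding card_orbit_square[OF pp] by (auto elim!: evenE split: if_splits)
  then have "points_of_length n (p \<circ> p) e = card ((if odd e then {x\<in>{..<n}. card (orbit p x) = e} else {}) \<union> {x\<in>{..<n}. card (orbit p x) = 2 * e})"
    by (simp add: points_of_length_def)
  also have "\<dots> = (if odd e then points_of_length n p e else 0) + points_of_length n p (2 * e)"
    using \<open>e > 0\<close> by (subst card_Un_disjoint) (auto simp: points_of_length_def)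
  also have "\<dots> = e * count (split_even (cycle_type n p)) e"
    unfolding count_cycle_type(1)[OF p, symmetric] count_split_even by (simp add: algebra_simps)
  finally show "e * count (split_even (cycle_type n p)) e = points_of_length n (p \<circ> p) e" ..
qed

lemma cycle_type_conj:
  assumes p: "p permutes {..<n}" and g: "g permutes {..<n}"
  shows "cycle_type n (g \<circ> p \<circ> inv g) = cycle_type n p"
proof (rule cycle_type_eqI)
  show perm: "g \<circ> p \<circ> inv g permutes {..<n}"
    using p g by (intro permutes_compose permutes_inv)
  show "0 \<notin># cycle_type n p" by (rule count_cycle_type(2)[OF p])
  have bij: "bij g" using g permutes_bij by blast
  have o: "orbit (g \<circ> p \<circ> inv g) (g x) = g ` orbit p x" for x
  proof -
    have pow: "((g \<circ> p \<circ> inv g) ^^ k) (g x) = g ((p ^^ k) x)" for k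
      using bij by (induction k) (auto simp: bij_is_inj)
    show ?thesis
      unfolding orbit_altdef pow by auto
  qed
  fix d :: nat assume "d > 0"
  have "{x\<in>{..<n}. card (orbit (g \<circ> p \<circ> inv g) x) = d} = g ` {x\<in>{..<n}. card (orbit p x) = d}"
  proof -
    have "card (g ` orbit p x) = card (orbit p x)" for x
      using bij by (intro card_image) (auto intro: inj_on_subset bij_is_inj)
    then have *: "card (orbit (g \<circ> p \<circ> inv g) (g x)) = card (orbit p x)" for x by (simp add: o)
    show ?thesis
    proof (intro equalityI subsetI)
      fix x assume x: "x \<in> {x\<in>{..<n}. card (orbit (g \<circ> p \<circ> inv g) x) = d}"
      then have "inv g x < n" using permutes_in_image[OF permutes_inv[OF g]] by auto
      moreover have "g (inv g x) = x" using g by (simp add: permutes_inverses)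
      ultimately show "x \<in> g ` {x\<in>{..<n}. card (orbit p x) = d}"
        using x *[of "inv g x"] by (intro image_eqI[of _ _ "inv g x"]) auto
    qed (use * permutes_in_image[OF g] in auto)
  qed
  then have "points_of_length n (g \<circ> p \<circ> inv g) d = points_of_length n p d"
    unfolding points_of_length_def using bij
    by (simp add: card_image inj_on_subset[OF bij_is_inj])
  then show "d * count (cycle_type n p) d = points_of_length n (g \<circ> p \<circ> inv g) d"
    by (simp add: count_cycle_type(1)[OF p])
qed

lemma cycle_type_inv:
  assumes "p permutes {..<n}" shows "cycle_type n (inv p) = cycle_type n p"
  unfolding cycle_type_def using orbit_inv_eq[OF permutes_lessThan_permutation[OF assms]] by simp

text \<open>A cycle on the top points N, ..., n - 1. With this position the permutations disjoint
  from it are literally those of the points below N.\<close>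

definition block_cycle :: "nat \<Rightarrow> nat \<Rightarrow> nat \<Rightarrow> nat" where
  "block_cycle N n x = (if N \<le> x \<and> x < n then if Suc x = n then N else Suc x else x)"

lemma block_cycle_permutes: assumes "N < n" shows "block_cycle N n permutes {N..<n}"
proof (rule bij_imp_permutes)
  show "bij_betw (block_cycle N n) {N..<n} {N..<n}"
  proof (rule bij_betwI[where g = "\<lambda>x. if x = N then n - 1 else x - 1"])
  qed (use assms in \<open>auto simp: block_cycle_def\<close>)
qed (auto simp: block_cycle_def)

lemma block_cycle_comp_permutes:
  assumes "N < n" "\<tau> permutes {..<N}" shows "block_cycle N n \<circ> \<tau> permutes {..<n}"
  by (intro permutes_compose permutes_subset[OF assms(2)] permutes_subset[OF block_cycle_permutes[OF assms(1)]])
    (use assms(1) in auto)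

lemma block_cycle_commute:
  assumes "N < n" "\<tau> permutes {..<N}" shows "block_cycle N n \<circ> \<tau> = \<tau> \<circ> block_cycle N n"
proof
  fix x show "(block_cycle N n \<circ> \<tau>) x = (\<tau> \<circ> block_cycle N n) x"
  proof (cases "x < N")
    case True
    then have "\<tau> x < N" using permutes_in_image[OF assms(2), of x] by simp
    then show ?thesis using True by (simp add: block_cycle_def)
  next
    case False
    then have "\<not> block_cycle N n x < N" by (auto simp: block_cycle_def)
    then show ?thesis using False permutes_not_in[OF assms(2)] by simp
  qed
qed

lemma block_cycle_orbits:
  assumes N: "N < n" and \<tau>: "\<tau> permutes {..<N}"
  shows "x < N \<Longrightarrow> orbit (block_cycle N n \<circ> \<tau>) x = orbit \<tau> x"
    and "N \<le> x \<Longrightarrow> x < n \<Longrightarrow> orbit (block_cycle N n \<circ> \<tau>) x = {N..<n}"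
proof -
  define h where "h = block_cycle N n \<circ> \<tau>"
  have hp: "permutation h"
    unfolding h_def using block_cycle_comp_permutes[OF N \<tau>] by (rule permutes_lessThan_permutation)
  show "orbit (block_cycle N n \<circ> \<tau>) x = orbit \<tau> x" if "x < N"
  proof (rule orbit_cong0[symmetric, where A = "{..<N}"])
    show "\<tau> \<in> {..<N} \<rightarrow> {..<N}" using permutes_in_image[OF \<tau>] by auto
    show "\<tau> y = (block_cycle N n \<circ> \<tau>) y" if "y \<in> {..<N}" for y
      using permutes_in_image[OF \<tau>, of y] that by (simp add: block_cycle_def)
  qed (use that in simp)
  have hb: "h y = block_cycle N n y" if "N \<le> y" for y
    using that permutes_not_in[OF \<tau>, of y] by (simp add: h_def)
  have pow: "(h ^^ i) N = N + i" if "N + i < n" for i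
    using that by (induction i) (auto simp: hb block_cycle_def)
  have "orbit h N = {N..<n}"
  proof
    have "(h ^^ i) N \<in> {N..<n}" for i
      using N by (induction i) (auto simp: hb block_cycle_def)
    then show "orbit h N \<subseteq> {N..<n}" unfolding orbit_altdef_permutation[OF hp] by auto
    show "{N..<n} \<subseteq> orbit h N"
    proof
      fix y assume "y \<in> {N..<n}"
      then have "y = (h ^^ (y - N)) N" using pow[of "y - N"] by simp
      then show "y \<in> orbit h N" unfolding orbit_altdef_permutation[OF hp] by blast
    qed
  qed
  then show "orbit (block_cycle N n \<circ> \<tau>) x = {N..<n}" if "N \<le> x" "x < n"
    using orbit_eq_iff_permutation[OF hp, of x N] that unfolding h_def by auto
qed

lemma cycle_type_block_cycle:
  assumes N: "N < n" and \<tau>: "\<tau> permutes {..<N}"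
  shows "cycle_type n (block_cycle N n \<circ> \<tau>) = add_mset (n - N) (cycle_type N \<tau>)"
proof (rule cycle_type_eqI)
  show "block_cycle N n \<circ> \<tau> permutes {..<n}" by (rule block_cycle_comp_permutes[OF N \<tau>])
  show "0 \<notin># add_mset (n - N) (cycle_type N \<tau>)" using N count_cycle_type(2)[OF \<tau>] by simp
  fix d :: nat assume "d > 0"
  have "{x\<in>{..<n}. card (orbit (block_cycle N n \<circ> \<tau>) x) = d} =
      {x\<in>{..<N}. card (orbit \<tau> x) = d} \<union> (if d = n - N then {N..<n} else {})"
    using block_cycle_orbits[OF N \<tau>] N by (auto simp: not_less split: if_splits) (metis not_less card_atLeastLessThan)+
  then have "points_of_length n (block_cycle N n \<circ> \<tau>) d = card ({x\<in>{..<N}. card (orbit \<tau> x) = d} \<union> (if d = n - N then {N..<n} else {}))"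
    by (simp add: points_of_length_def)
  also have "\<dots> = points_of_length N \<tau> d + (if d = n - N then n - N else 0)"
    by (subst card_Un_disjoint) (auto simp: points_of_length_def)
  also have "\<dots> = d * count (add_mset (n - N) (cycle_type N \<tau>)) d"
    using count_cycle_type(1)[OF \<tau>, of d] by simp
  finally show "d * count (add_mset (n - N) (cycle_type N \<tau>)) d = points_of_length n (block_cycle N n \<circ> \<tau>) d" ..
qed

text \<open>Relabel so that the orbit of x occupies the top points in its cyclic order. The
  conjugate agrees with \<open>block_cycle\<close> there, and cancelling that cycle leaves a
  permutation of the points below N.\<close>

lemma conj_block_cycle:
  assumes p: "p permutes {..<n}" and x: "x < n"
  defines "N \<equiv> n - card (orbit p x)"
  obtains g \<tau> where "g permutes {..<n}" "\<tau> permutes {..<N}" "g \<circ> p = block_cycle N n \<circ> \<tau> \<circ> g"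
proof -
  have pp: "permutation p" using p by (rule permutes_lessThan_permutation)
  define t where "t = card (orbit p x)"
  note per = orbit_period[OF pp, of x, folded t_def]
  have osub: "orbit p x \<subseteq> {..<n}" using permutes_orbit_subset[OF p] x by auto
  have tn: "t \<le> n" using card_mono[OF _ osub] by (simp add: t_def)
  have N: "N = n - t" "N < n" "n = N + t" using per(1) tn by (auto simp: N_def t_def)
  have "card ({..<n} - orbit p x) = card {..<N}"
    using osub by (subst card_Diff_subset) (auto simp: finite_orbit_permutation[OF pp] N_def)
  then obtain a where a: "bij_betw a {..<N} ({..<n} - orbit p x)"
    using finite_same_card_bij[of "{..<N}" "{..<n} - orbit p x"] by auto
  define f where "f = (\<lambda>y. if y < N then a y else if y < n then (p ^^ (y - N)) x else y)"
  have e: "bij_betw (\<lambda>y. (p ^^ (y - N)) x) {N..<n} (orbit p x)"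
  proof -
    have 1: "bij_betw (\<lambda>y. y - N) {N..<n} {..<t}"
      by (rule bij_betwI[where g = "\<lambda>y. y + N"]) (use N(2,3) in auto)
    have 2: "bij_betw (\<lambda>i. (p ^^ i) x) {..<t} (orbit p x)"
      using per(2,3) by (simp add: bij_betw_def)
    show ?thesis using bij_betw_trans[OF 1 2] by (simp add: comp_def)
  qed
  have "bij_betw f ({..<N} \<union> {N..<n}) (({..<n} - orbit p x) \<union> orbit p x)"
  proof (rule bij_betw_combine)
    show "bij_betw f {..<N} ({..<n} - orbit p x)"
      using a by (rule bij_betw_cong[THEN iffD1, rotated]) (auto simp: f_def)
    show "bij_betw f {N..<n} (orbit p x)"
      using e by (rule bij_betw_cong[THEN iffD1, rotated]) (auto simp: f_def)
  qed auto
  moreover have "{..<N} \<union> {N..<n} = {..<n}" using N(2) by auto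
  moreover have "({..<n} - orbit p x) \<union> orbit p x = {..<n}" using osub by auto
  ultimately have f: "f permutes {..<n}"
    using N(2) by (intro bij_imp_permutes) (auto simp: f_def)
  define h where "h = inv f \<circ> p \<circ> f"
  have h: "h permutes {..<n}" unfolding h_def by (intro permutes_compose permutes_inv f p)
  have hc: "h y = block_cycle N n y" if "N \<le> y" "y < n" for y
  proof -
    have "p (f y) = (p ^^ Suc (y - N)) x" using that by (simp add: f_def)
    also have "\<dots> = f (block_cycle N n y)"
    proof (cases "Suc y = n")
      case True
      then have "Suc (y - N) = t" using N(3) that by auto
      then show ?thesis using per(4) True that N(2) by (simp add: block_cycle_def f_def)
    next
      case False
      then show ?thesis using that by (simp add: block_cycle_def f_def Suc_diff_le)
    qed
    finally show ?thesis using permutes_inverses(2)[OF f] by (simp add: h_def)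
  qed
  define c where "c = block_cycle N n"
  have c: "c permutes {..<n}"
    unfolding c_def by (rule permutes_subset[OF block_cycle_permutes[OF N(2)]]) auto
  define \<tau> where "\<tau> = inv c \<circ> h"
  have "\<tau> permutes {..<N}"
  proof (rule permutes_superset)
    show "\<tau> permutes {..<n}" unfolding \<tau>_def by (intro permutes_compose permutes_inv c h)
    show "\<tau> y = y" if "y \<in> {..<n} - {..<N}" for y
      using that hc permutes_inverses(2)[OF c] by (auto simp: \<tau>_def c_def)
  qed
  moreover have "inv f \<circ> p = block_cycle N n \<circ> \<tau> \<circ> inv f"
    unfolding \<tau>_def h_def c_def[symmetric]
    by (simp add: fun_eq_iff permutes_inverses[OF c] permutes_inverses[OF f])
  ultimately show thesis using that permutes_inv[OF f] by blast
qed

text \<open>Induction by peeling off a cycle of common length from each permutation. A conjugation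
  of the remainders fixes the top points and therefore commutes with the block cycle.\<close>

lemma conjugate_if_cycle_type_eq:
  assumes "p permutes {..<n}" "q permutes {..<n}" "cycle_type n p = cycle_type n q"
  shows "\<exists>g. g permutes {..<n} \<and> g \<circ> p = q \<circ> g"
  using assms
proof (induction n arbitrary: p q rule: less_induct)
  case (less n)
  show ?case
  proof (cases "n = 0")
    case True
    then have "p = id" "q = id" using less.prems by (auto simp: fun_eq_iff permutes_def)
    then have "id \<circ> p = q \<circ> id" by simp
    then show ?thesis using permutes_id by blast
  next
    case False
    define t where "t = card (orbit p 0)"
    have pp: "permutation p" using less.prems(1) by (rule permutes_lessThan_permutation)
    have t: "t > 0" unfolding t_def by (rule orbit_period(1)[OF pp])
    have "t \<in># cycle_type n p" unfolding cycle_type_def t_def using False by auto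
    then have "t \<in># cycle_type n q" using less.prems(3) by simp
    then obtain y where y: "y < n" "card (orbit q y) = t" unfolding cycle_type_def by auto
    define N where "N = n - t"
    have N: "N < n" using t False by (simp add: N_def)
    obtain g1 \<tau>1 where 1: "g1 permutes {..<n}" "\<tau>1 permutes {..<N}" "g1 \<circ> p = block_cycle N n \<circ> \<tau>1 \<circ> g1"
      using conj_block_cycle[OF less.prems(1), of 0] False unfolding t_def N_def by blast
    obtain g2 \<tau>2 where 2: "g2 permutes {..<n}" "\<tau>2 permutes {..<N}" "g2 \<circ> q = block_cycle N n \<circ> \<tau>2 \<circ> g2"
      using conj_block_cycle[OF less.prems(2) y(1)] y(2) unfolding N_def by blast
    have ty: "cycle_type n p = add_mset (n - N) (cycle_type N \<tau>)"
      if p: "p permutes {..<n}" and "g permutes {..<n}" "\<tau> permutes {..<N}" "g \<circ> p = block_cycle N n \<circ> \<tau> \<circ> g" for p g \<tau>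
    proof -
      have "g \<circ> p \<circ> inv g = block_cycle N n \<circ> \<tau>"
        unfolding that(4) using permutes_inv_o[OF that(2)] by (simp add: comp_assoc)
      then show ?thesis
        using cycle_type_conj[OF p that(2)] cycle_type_block_cycle[OF N that(3)] by simp
    qed
    have "cycle_type N \<tau>1 = cycle_type N \<tau>2"
      using ty[OF less.prems(1) 1] ty[OF less.prems(2) 2] less.prems(3) by simp
    then obtain h where h: "h permutes {..<N}" "h \<circ> \<tau>1 = \<tau>2 \<circ> h" using less.IH[OF N 1(2) 2(2)] by blast
    define g where "g = inv g2 \<circ> h \<circ> g1"
    have "g permutes {..<n}" unfolding g_def
      using N by (intro permutes_compose permutes_inv 1 2 permutes_subset[OF h(1)]) auto
    moreover have "g \<circ> p = q \<circ> g"
    proof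
      fix x
      have "h (block_cycle N n (\<tau>1 (g1 x))) = block_cycle N n (h (\<tau>1 (g1 x)))"
        using fun_cong[OF block_cycle_commute[OF N h(1)], of "\<tau>1 (g1 x)"] by simp
      also have "\<dots> = block_cycle N n (\<tau>2 (h (g1 x)))" using fun_cong[OF h(2), of "g1 x"] by simp
      also have "\<dots> = g2 (q (g x))"
        using fun_cong[OF 2(3), of "g x"] by (simp add: g_def permutes_inverses[OF 2(1)])
      finally have "inv g2 (h (block_cycle N n (\<tau>1 (g1 x)))) = q (g x)"
        by (simp add: permutes_inverses[OF 2(1)])
      then show "(g \<circ> p) x = (q \<circ> g) x" using fun_cong[OF 1(3), of x] by (simp add: g_def)
    qed
    ultimately show ?thesis by blast
  qed
qed

lemma exists_cycle_type:
  assumes "M \<in> mset_partitions n" shows "\<exists>p. p permutes {..<n} \<and> cycle_type n p = M"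
  using assms
proof (induction n arbitrary: M rule: less_induct)
  case (less n)
  show ?case
  proof (cases "M = {#}")
    case True
    then have "n = 0" using less.prems by (simp add: mset_partitions_def)
    then have "cycle_type n id = M" using True by (simp add: cycle_type_def)
    then show ?thesis using permutes_id by blast
  next
    case False
    then obtain t where t: "t \<in># M" by (meson multiset_nonemptyE)
    then have "t > 0" using less.prems unfolding mset_partitions_def by (metis (mono_tags) mem_Collect_eq neq0_conv)
    have s: "n = t + sum_mset (M - {#t#})"
      using t less.prems by (metis (mono_tags) insert_DiffM mem_Collect_eq mset_partitions_def sum_mset.add_mset)
    define N where "N = n - t"
    have N: "N < n" "n - N = t" using s \<open>t > 0\<close> by (auto simp: N_def)
    have "M - {#t#} \<in> mset_partitions N"
      using s less.prems by (auto simp: mset_partitions_def N_def dest: in_diffD)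
    then obtain \<tau> where \<tau>: "\<tau> permutes {..<N}" "cycle_type N \<tau> = M - {#t#}" using less.IH[OF N(1)] by blast
    then have "cycle_type n (block_cycle N n \<circ> \<tau>) = M"
      using cycle_type_block_cycle[OF N(1) \<tau>(1)] N(2) t by simp
    then show ?thesis using block_cycle_comp_permutes[OF N(1) \<tau>(1)] by blast
  qed
qed

section \<open>Conjugacy classes and their sizes\<close>

definition sym_group :: "nat \<Rightarrow> (nat \<Rightarrow> nat) set" where
  "sym_group n = {p. p permutes {..<n}}"

definition cyc_class :: "nat \<Rightarrow> nat multiset \<Rightarrow> (nat \<Rightarrow> nat) set" where
  "cyc_class n M = {p \<in> sym_group n. cycle_type n p = M}"

lemma finite_sym_group: "finite (sym_group n)"
  unfolding sym_group_def by (simp add: finite_permutations)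

lemma card_sym_group: "card (sym_group n) = fact n"
  unfolding sym_group_def by (simp add: card_permutations)

lemma finite_cyc_class: "finite (cyc_class n M)"
  using finite_sym_group by (simp add: cyc_class_def)

lemma card_le_fibers:
  assumes "finite B" "f \<in> A \<rightarrow> B" "\<And>b. b \<in> B \<Longrightarrow> card {a \<in> A. f a = b} \<le> K"
  shows "card A \<le> K * card B"
proof -
  have "A = (\<Union>b\<in>B. {a \<in> A. f a = b})" using assms(2) by auto
  then have "card A = card (\<Union>b\<in>B. {a \<in> A. f a = b})" by simp
  also have "\<dots> \<le> (\<Sum>b\<in>B. card {a \<in> A. f a = b})" by (rule card_UN_le[OF assms(1)])
  also have "\<dots> \<le> K * card B" using sum_bounded_above[of B "\<lambda>b. card {a \<in> A. f a = b}" K] assms(3) by (simp add: mult.commute)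
  finally show ?thesis .
qed

text \<open>Divided by both class sizes this compares centralizer orders: adding a cycle of length t
  = n - N multiplies the order by at most t times the new multiplicity of t. It is a double count of
  pairs consisting of a permutation of the larger class and a point on one of its t-cycles.\<close>

lemma card_cyc_class_block_cycle:
  assumes N: "N < n" and \<tau>: "\<tau> permutes {..<N}"
  shows "fact n * card (cyc_class N (cycle_type N \<tau>)) \<le>
    fact N * (card (cyc_class n (cycle_type n (block_cycle N n \<circ> \<tau>))) * ((n - N) * (count (cycle_type N \<tau>) (n - N) + 1)))"
proof -
  define t where "t = n - N"
  define c where "c = block_cycle N n"
  define K where "K = cycle_type N \<tau>"
  define C where "C = cyc_class n (add_mset t K)"
  define B where "B = (SIGMA h:C. {x\<in>{..<n}. card (orbit h x) = t})"
  \<comment> \<open>A conjugate of c \<circ> \<tau> together with the image of \<open>N\<close>,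
    which marks one point on a t-cycle of that conjugate.\<close>
  define f where "f = (\<lambda>(g :: nat \<Rightarrow> nat, \<tau>). (g \<circ> (c \<circ> \<tau>) \<circ> inv g, g N))"
  have finC: "finite C" by (simp add: C_def finite_cyc_class)
  have cp: "c permutes {..<n}" unfolding c_def by (rule permutes_subset[OF block_cycle_permutes[OF N]]) auto
  have fB: "f \<in> sym_group n \<times> cyc_class N K \<rightarrow> B"
  proof (rule Pi_I)
    fix a assume aa: "a \<in> sym_group n \<times> cyc_class N K"
    obtain g \<sigma> where a: "a = (g, \<sigma>)" by (cases a)
    have g: "g \<in> sym_group n" and \<sigma>: "\<sigma> \<in> cyc_class N K" using aa a by auto
    have gp: "g permutes {..<n}" and sp: "\<sigma> permutes {..<N}" and sK: "cycle_type N \<sigma> = K"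
      using g \<sigma> by (auto simp: sym_group_def cyc_class_def)
    have hp: "c \<circ> \<sigma> permutes {..<n}" unfolding c_def by (rule block_cycle_comp_permutes[OF N sp])
    have "cycle_type n (g \<circ> (c \<circ> \<sigma>) \<circ> inv g) = add_mset t K"
      using cycle_type_conj[OF hp gp] cycle_type_block_cycle[OF N sp] sK by (simp add: c_def t_def)
    moreover have hp': "g \<circ> (c \<circ> \<sigma>) \<circ> inv g permutes {..<n}" by (intro permutes_compose permutes_inv gp hp)
    moreover have "card (orbit (g \<circ> (c \<circ> \<sigma>) \<circ> inv g) (g N)) = t"
    proof -
      have pow: "((g \<circ> (c \<circ> \<sigma>) \<circ> inv g) ^^ k) (g N) = g (((c \<circ> \<sigma>) ^^ k) N)" for k
        by (induction k) (auto simp: permutes_inverses[OF gp])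
      have "orbit (g \<circ> (c \<circ> \<sigma>) \<circ> inv g) (g N) = g ` orbit (c \<circ> \<sigma>) N"
        unfolding orbit_altdef pow by auto
      also have "orbit (c \<circ> \<sigma>) N = {N..<n}" unfolding c_def using block_cycle_orbits(2)[OF N sp, of N] N by simp
      finally have eq: "orbit (g \<circ> (c \<circ> \<sigma>) \<circ> inv g) (g N) = g ` {N..<n}" .
      show ?thesis unfolding eq using permutes_inj_on[OF gp] by (simp add: card_image t_def)
    qed
    moreover have "g N < n" using permutes_in_image[OF gp, of N] N by simp
    ultimately show "f a \<in> B" unfolding a f_def prod.case B_def C_def cyc_class_def sym_group_def
      by (intro SigmaI CollectI conjI) auto
  qed
  have fib: "card {a \<in> sym_group n \<times> cyc_class N K. f a = b} \<le> fact N" if "b \<in> B" for b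
  proof (cases "{a \<in> sym_group n \<times> cyc_class N K. f a = b} = {}")
    case False
    then obtain g1 \<tau>1 where a1: "g1 \<in> sym_group n" "\<tau>1 \<in> cyc_class N K" "f (g1, \<tau>1) = b" by auto
    have g1p: "g1 permutes {..<n}" using a1 by (simp add: sym_group_def)
    \<comment> \<open>The conjugate and the marked point determine g on the whole top block. Within
      one fibre g thus varies only by permutations of the points below N, and g in turn determines
      \<tau>.\<close>
    have val: "g (N + i) = ((fst b) ^^ i) (snd b)" if "(g, \<sigma>) \<in> {a \<in> sym_group n \<times> cyc_class N K. f a = b}" "N + i < n" for g \<sigma> i
    proof -
      have gp: "g permutes {..<n}" and sp: "\<sigma> permutes {..<N}" and b: "b = (g \<circ> (c \<circ> \<sigma>) \<circ> inv g, g N)"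
        using that by (auto simp: sym_group_def cyc_class_def f_def)
      have "((g \<circ> (c \<circ> \<sigma>) \<circ> inv g) ^^ i) (g N) = g (((c \<circ> \<sigma>) ^^ i) N)" for i
        by (induction i) (auto simp: permutes_inverses[OF gp])
      moreover have "((c \<circ> \<sigma>) ^^ i) N = N + i"
        using that(2) by (induction i) (auto simp: permutes_not_in[OF sp] c_def block_cycle_def)
      ultimately show ?thesis by (simp add: b)
    qed
    have "card {a \<in> sym_group n \<times> cyc_class N K. f a = b} \<le> card (sym_group N)"
    proof (rule card_inj_on_le[where f = "\<lambda>(g, \<sigma>). inv g1 \<circ> g"])
      show "inj_on (\<lambda>(g, \<sigma>). inv g1 \<circ> g) {a \<in> sym_group n \<times> cyc_class N K. f a = b}"
      proof (rule inj_onI)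
        fix a a'
        assume aa: "a \<in> {a \<in> sym_group n \<times> cyc_class N K. f a = b}" "a' \<in> {a \<in> sym_group n \<times> cyc_class N K. f a = b}"
          and ee: "(case a of (g, \<sigma>) \<Rightarrow> inv g1 \<circ> g) = (case a' of (g, \<sigma>) \<Rightarrow> inv g1 \<circ> g)"
        obtain g \<sigma> g' \<sigma>' where a: "a = (g, \<sigma>)" "a' = (g', \<sigma>')" by (cases a, cases a') auto
        have G: "g \<in> sym_group n" using aa a by auto
        have eq: "f (g, \<sigma>) = f (g', \<sigma>')" using aa unfolding a by (simp only: mem_Collect_eq)
        have e: "inv g1 \<circ> g = inv g1 \<circ> g'" using ee unfolding a prod.case .
        have "g x = g' x" for x
          using arg_cong[OF fun_cong[OF e, of x], of g1] permutes_inverses(1)[OF g1p] by simp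
        then have gg: "g = g'" by blast
        have gp: "g permutes {..<n}" using G by (simp add: sym_group_def)
        have eq': "g \<circ> (c \<circ> \<sigma>) \<circ> inv g = g \<circ> (c \<circ> \<sigma>') \<circ> inv g"
          using eq unfolding gg f_def prod.case by (simp only: prod.inject)
        have "g (c (\<sigma> x)) = g (c (\<sigma>' x))" for x
          using fun_cong[OF eq', of "g x"] permutes_inverses[OF gp] by simp
        then have "\<sigma> x = \<sigma>' x" for x
          using permutes_inj[OF gp] permutes_inj[OF cp] by (meson injD)
        then show "a = a'" using gg a by blast
      qed
      show "(\<lambda>(g, \<sigma>). inv g1 \<circ> g) ` {a \<in> sym_group n \<times> cyc_class N K. f a = b} \<subseteq> sym_group N"
      proof (rule image_subsetI)
        fix a assume aa: "a \<in> {a \<in> sym_group n \<times> cyc_class N K. f a = b}"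
        obtain g \<sigma> where a: "a = (g, \<sigma>)" by (cases a)
        have G: "g \<in> sym_group n" "\<sigma> \<in> cyc_class N K" "f (g, \<sigma>) = b" using aa unfolding a by auto
        have gp: "g permutes {..<n}" using G by (simp add: sym_group_def)
        have "inv g1 \<circ> g permutes {..<N}"
        proof (rule permutes_superset)
          show "inv g1 \<circ> g permutes {..<n}" by (intro permutes_compose permutes_inv g1p gp)
          show "(inv g1 \<circ> g) y = y" if "y \<in> {..<n} - {..<N}" for y
          proof -
            from that have "N + (y - N) < n" "N + (y - N) = y" by auto
            then have "g y = g1 y" using val[of g \<sigma> "y - N"] val[of g1 \<tau>1 "y - N"] G a1 by auto
            then show "(inv g1 \<circ> g) y = y" using permutes_inverses[OF g1p] by simp
          qed
        qed
        then show "(case a of (g, \<sigma>) \<Rightarrow> inv g1 \<circ> g) \<in> sym_group N" unfolding a prod.case by (simp only: sym_group_def mem_Collect_eq)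
      qed
    qed (rule finite_sym_group)
    then show ?thesis by (simp add: card_sym_group)
  next
    case True
    show ?thesis unfolding True by simp
  qed
  have finB: "finite B" unfolding B_def using finC by auto
  have "card (sym_group n \<times> cyc_class N K) \<le> fact N * card B"
    by (rule card_le_fibers[OF finB fB fib])
  also have "card B = (\<Sum>h\<in>C. card {x\<in>{..<n}. card (orbit h x) = t})"
    unfolding B_def using finC by (subst card_SigmaI) auto
  also have "\<dots> = (\<Sum>h\<in>C. t * (count K t + 1))"
  proof (intro sum.cong refl)
    fix h assume "h \<in> C"
    then have h: "h permutes {..<n}" "cycle_type n h = add_mset t K" by (auto simp: C_def cyc_class_def sym_group_def)
    show "card {x\<in>{..<n}. card (orbit h x) = t} = t * (count K t + 1)"
      using count_cycle_type(1)[OF h(1), of t] unfolding points_of_length_def h(2) by simp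
  qed
  finally show ?thesis
    using cycle_type_block_cycle[OF N \<tau>]
    by (simp add: card_cartesian_product card_sym_group K_def C_def t_def)
qed

section \<open>Specht modules\<close>

text \<open>Described without reference to a tableau: a finite set, closed under the action, on
  which all functions in the Specht module are supported.\<close>

definition tabloids :: "nat list \<Rightarrow> nat set list set" where
  "tabloids nu = {R. length R = length nu \<and> (\<forall>i<length nu. card (R ! i) = nu ! i) \<and>
     (\<forall>i<length nu. \<forall>j<length nu. i \<noteq> j \<longrightarrow> R ! i \<inter> R ! j = {}) \<and> \<Union> (set R) = {..<sum_list nu}}"

definition act :: "(nat \<Rightarrow> nat) \<Rightarrow> nat set list \<Rightarrow> nat set list" where
  "act p R = map ((`) p) R"

lemma perm_act_apply: "perm_act p f R = f (act (inv p) R)"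
  by (simp add: perm_act_def act_def)

lemma act_comp: "act (p \<circ> q) R = act p (act q R)"
  by (simp add: act_def image_comp)

lemma act_id [simp]: "act id R = R"
  by (simp add: act_def)

lemma act_inv:
  assumes "p permutes S" shows "act (inv p) (act p R) = R" "act p (act (inv p) R) = R"
  using permutes_inv_o[OF assms] by (simp_all add: act_comp[symmetric])

lemma lin_op_perm_act: "lin_op (perm_act p)"
  by (auto simp: lin_op_def perm_act_def fun_scale_def fun_eq_iff)

lemma perm_act_comp:
  assumes "p permutes S" "q permutes S" shows "perm_act (p \<circ> q) f = perm_act p (perm_act q f)"
proof
  fix R
  have "inv (p \<circ> q) = inv q \<circ> inv p"
    using assms by (intro o_inv_distrib) (auto intro: permutes_bij)
  then show "perm_act (p \<circ> q) f R = perm_act p (perm_act q f) R"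
    by (simp add: perm_act_apply act_comp)
qed

lemma perm_act_tabloid_vec:
  assumes "p permutes S" shows "perm_act p (tabloid_vec R) = tabloid_vec (act p R)"
  using act_inv[OF assms] by (auto simp: perm_act_apply tabloid_vec_def fun_eq_iff)

lemma act_tabloids:
  assumes p: "p permutes {..<sum_list nu}" and R: "R \<in> tabloids nu" shows "act p R \<in> tabloids nu"
proof -
  have inj: "inj p" using p by (rule permutes_inj)
  have "\<Union> (set (act p R)) = p ` \<Union> (set R)" by (auto simp: act_def)
  also have "\<dots> = {..<sum_list nu}" using R permutes_image[OF p] by (simp add: tabloids_def)
  finally have U: "\<Union> (set (act p R)) = {..<sum_list nu}" .
  show ?thesis unfolding tabloids_def
  proof (intro CollectI conjI allI impI)
    show "length (act p R) = length nu" using R by (simp add: act_def tabloids_def)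
    show "card (act p R ! i) = nu ! i" if "i < length nu" for i
      using that R inj by (simp add: act_def tabloids_def card_image inj_on_subset)
    show "act p R ! i \<inter> act p R ! j = {}" if "i < length nu" "j < length nu" "i \<noteq> j" for i j
      using that R inj by (simp add: act_def tabloids_def image_Int[symmetric])
  qed (rule U)
qed

lemma finite_tabloids: "finite (tabloids nu)"
proof (rule finite_subset)
  show "tabloids nu \<subseteq> {R. set R \<subseteq> Pow {..<sum_list nu} \<and> length R = length nu}"
    by (auto simp: tabloids_def)
qed (rule finite_lists_length_eq, simp)

lemma tabloids_row_finite:
  assumes "R \<in> tabloids nu" "i < length nu" shows "finite (R ! i)" "R ! i \<subseteq> {..<sum_list nu}"
proof -
  have "R ! i \<in> set R" using assms by (simp add: tabloids_def)
  then have "R ! i \<subseteq> \<Union> (set R)" by blast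
  then show "R ! i \<subseteq> {..<sum_list nu}" using assms by (simp add: tabloids_def)
  then show "finite (R ! i)" using finite_subset by blast
qed

text \<open>Young's column antisymmetrizer as an operator on all functions of tabloids, so that it
  can also be applied to images of homomorphisms.\<close>

definition kappa :: "nat list \<Rightarrow> (nat \<times> nat \<Rightarrow> nat) \<Rightarrow> (nat set list \<Rightarrow> complex) \<Rightarrow> (nat set list \<Rightarrow> complex)" where
  "kappa lam t f = (\<Sum>p\<in>column_stabilizer lam t. fun_scale (of_int (sign p)) (perm_act p f))"

lemma polytabloid_kappa: "polytabloid lam t = kappa lam t (tabloid_vec (tabloid lam t))"
  by (simp add: polytabloid_def kappa_def)

lemma kappa_apply: "kappa lam t f R = (\<Sum>p\<in>column_stabilizer lam t. of_int (sign p) * f (act (inv p) R))"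
  by (simp add: kappa_def sum_fun_apply fun_scale_def perm_act_apply)

definition tab_col :: "nat list \<Rightarrow> (nat \<times> nat \<Rightarrow> nat) \<Rightarrow> nat \<Rightarrow> nat set" where
  "tab_col lam t j = {t (i, j) | i. (i, j) \<in> young_diagram lam}"

lemma column_stabilizer_iff:
  "p \<in> column_stabilizer lam t \<longleftrightarrow> p permutes {..<sum_list lam} \<and> (\<forall>j. p ` tab_col lam t j = tab_col lam t j)"
  by (simp add: column_stabilizer_def tab_col_def)

lemma column_stabilizer_comp:
  "p \<in> column_stabilizer lam t \<Longrightarrow> q \<in> column_stabilizer lam t \<Longrightarrow> p \<circ> q \<in> column_stabilizer lam t"
  unfolding column_stabilizer_iff by (metis permutes_compose image_comp)

lemma column_stabilizer_inv:
  assumes "p \<in> column_stabilizer lam t" shows "inv p \<in> column_stabilizer lam t"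
proof -
  have p: "p permutes {..<sum_list lam}" "\<And>j. p ` tab_col lam t j = tab_col lam t j"
    using assms by (auto simp: column_stabilizer_iff)
  have "inv p ` tab_col lam t j = tab_col lam t j" for j
  proof -
    have "inv p ` tab_col lam t j = inv p ` p ` tab_col lam t j" by (simp add: p(2))
    also have "\<dots> = tab_col lam t j" using permutes_inv_o(2)[OF p(1)] by (simp add: image_comp)
    finally show ?thesis .
  qed
  then show ?thesis using permutes_inv[OF p(1)] by (simp add: column_stabilizer_iff)
qed

lemma column_stabilizer_id: "id \<in> column_stabilizer lam t"
  by (simp add: column_stabilizer_iff)

lemma finite_column_stabilizer: "finite (column_stabilizer lam t)"
  by (rule finite_subset[OF _ finite_permutations[of "{..<sum_list lam}"]]) (auto simp: column_stabilizer_def)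

lemma column_stabilizer_permutes: "p \<in> column_stabilizer lam t \<Longrightarrow> p permutes {..<sum_list lam}"
  by (simp add: column_stabilizer_iff)

lemma column_stabilizer_permutation: "p \<in> column_stabilizer lam t \<Longrightarrow> permutation p"
  using column_stabilizer_permutes permutes_lessThan_permutation by blast

lemma bij_betw_column_stabilizer_comp:
  assumes q: "q \<in> column_stabilizer lam t"
  shows "bij_betw (\<lambda>p. q \<circ> p) (column_stabilizer lam t) (column_stabilizer lam t)"
proof (rule bij_betwI[where g = "\<lambda>p. inv q \<circ> p"])
  note qp = column_stabilizer_permutes[OF q]
  show "(\<lambda>p. q \<circ> p) \<in> column_stabilizer lam t \<rightarrow> column_stabilizer lam t"
    using column_stabilizer_comp[OF q] by auto
  show "(\<lambda>p. inv q \<circ> p) \<in> column_stabilizer lam t \<rightarrow> column_stabilizer lam t"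
    using column_stabilizer_comp[OF column_stabilizer_inv[OF q]] by auto
  show "inv q \<circ> (q \<circ> p) = p" for p :: "nat \<Rightarrow> nat" using permutes_inv_o(2)[OF qp] by (simp add: comp_assoc[symmetric])
  show "q \<circ> (inv q \<circ> p) = p" for p :: "nat \<Rightarrow> nat" using permutes_inv_o(1)[OF qp] by (simp add: comp_assoc[symmetric])
qed

text \<open>Reindexing the signed sum by q turns a column permutation of the argument into a
  sign.\<close>

lemma kappa_act:
  assumes q: "q \<in> column_stabilizer lam t"
  shows "kappa lam t f (act q R) = of_int (sign q) * kappa lam t f R"
proof -
  have "kappa lam t f (act q R) = (\<Sum>p\<in>column_stabilizer lam t. of_int (sign (q \<circ> p)) * f (act (inv (q \<circ> p)) (act q R)))"
    unfolding kappa_apply by (rule sum.reindex_bij_betw[OF bij_betw_column_stabilizer_comp[OF q], symmetric])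
  also have "\<dots> = (\<Sum>p\<in>column_stabilizer lam t. of_int (sign q) * (of_int (sign p) * f (act (inv p) R)))"
  proof (intro sum.cong refl)
    fix p assume p: "p \<in> column_stabilizer lam t"
    have "inv (q \<circ> p) = inv p \<circ> inv q"
      using column_stabilizer_permutes[OF p] column_stabilizer_permutes[OF q]
      by (intro o_inv_distrib) (auto intro: permutes_bij)
    then show "of_int (sign (q \<circ> p)) * f (act (inv (q \<circ> p)) (act q R)) = of_int (sign q) * (of_int (sign p) * f (act (inv p) R))"
      using sign_compose[OF column_stabilizer_permutation[OF q] column_stabilizer_permutation[OF p]]
        act_inv[OF column_stabilizer_permutes[OF q]] by (simp add: act_comp)
  qed
  also have "\<dots> = of_int (sign q) * kappa lam t f R" by (simp add: kappa_apply sum_distrib_left)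
  finally show ?thesis .
qed

text \<open>The transposition of two entries that share a row of R and a column of t fixes R but has
  sign -1, so the value is its own negative.\<close>

lemma kappa_eq_0:
  assumes xy: "x \<noteq> y" "x \<in> tab_col lam t j" "y \<in> tab_col lam t j"
    and cols: "\<And>k. tab_col lam t k \<subseteq> {..<sum_list lam}"
      "\<And>k. k \<noteq> j \<Longrightarrow> tab_col lam t k \<inter> tab_col lam t j = {}"
    and R: "R \<in> tabloids nu" "i < length nu" "x \<in> R ! i" "y \<in> R ! i"
  shows "kappa lam t f R = 0"
proof -
  define \<sigma> where "\<sigma> = Transposition.transpose x y"
  have fx: "\<sigma> ` A = A" if "x \<in> A \<longleftrightarrow> y \<in> A" for A
    using that unfolding \<sigma>_def by (auto simp: Transposition.transpose_def image_iff split: if_splits)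
  have "\<sigma> \<in> column_stabilizer lam t"
    unfolding column_stabilizer_iff
  proof (intro conjI allI)
    show "\<sigma> permutes {..<sum_list lam}" unfolding \<sigma>_def using xy cols(1)[of j] by (intro permutes_swap_id) auto
    show "\<sigma> ` tab_col lam t k = tab_col lam t k" for k
      using xy cols(2)[of k] by (intro fx) (cases "k = j", auto)
  qed
  moreover have "act \<sigma> R = R"
  proof (rule nth_equalityI)
    show "act \<sigma> R ! k = R ! k" if "k < length (act \<sigma> R)" for k
    proof -
      have k: "k < length nu" using that R(1) by (simp add: act_def tabloids_def)
      have "x \<in> R ! k \<longleftrightarrow> y \<in> R ! k"
      proof (cases "k = i")
        case False
        then have "R ! k \<inter> R ! i = {}" using R(1,2) k by (simp add: tabloids_def)
        then show ?thesis using R(3,4) by blast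
      qed (use R in simp)
      then show ?thesis using that fx by (simp add: act_def)
    qed
  qed (simp add: act_def)
  moreover have "sign \<sigma> = -1" unfolding \<sigma>_def using xy(1) by (simp add: sign_swap_id)
  ultimately have "kappa lam t f R = - kappa lam t f R" using kappa_act[of \<sigma> lam t f R] by simp
  then show ?thesis by simp
qed

section \<open>Young diagrams and tabloids transversal to the columns of a tableau\<close>

lemma partitions_nth_antimono:
  assumes "lam \<in> partitions n" "i \<le> j" "j < length lam" shows "lam ! j \<le> lam ! i"
  using assms by (cases "i = j") (auto simp: partitions_def sorted_wrt_iff_nth_less)

lemma sum_list_take_eq: "sum_list (take r xs) = (\<Sum>i | i < r \<and> i < length xs. xs ! i)" for xs :: "nat list"
proof -
  have "{i. i < r \<and> i < length xs} = {0..<min (length xs) r}" by auto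
  then show ?thesis by (simp add: sum_list_sum_nth)
qed

lemma finite_young_diagram: "finite (young_diagram lam)"
  and card_young_diagram_rows: "card {(i, j) \<in> young_diagram lam. i < r} = sum_list (take r lam)"
proof -
  have eq: "{(i, j) \<in> young_diagram lam. i < r} = (SIGMA i:{i. i < r \<and> i < length lam}. {..<lam ! i})" for r
    by (auto simp: young_diagram_def)
  then show "card {(i, j) \<in> young_diagram lam. i < r} = sum_list (take r lam)"
    by (simp add: sum_list_take_eq)
  have "young_diagram lam = {(i, j) \<in> young_diagram lam. i < length lam}"
    by (auto simp: young_diagram_def)
  then show "finite (young_diagram lam)" using eq[of "length lam"] by simp
qed

lemma card_young_diagram: "card (young_diagram lam) = sum_list lam"
proof -
  have "young_diagram lam = {(i, j) \<in> young_diagram lam. i < length lam}"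
    by (auto simp: young_diagram_def)
  then show ?thesis using card_young_diagram_rows[of lam "length lam"] by simp
qed

lemma exists_tableau: "\<exists>t. t \<in> tableaux lam"
  using finite_same_card_bij[OF finite_young_diagram[of lam], of "{..<sum_list lam}"]
  by (auto simp: card_young_diagram tableaux_def)

context
  fixes lam :: "nat list" and t :: "nat \<times> nat \<Rightarrow> nat" and n :: nat
  assumes lam: "lam \<in> partitions n" and t: "t \<in> tableaux lam"
begin

lemma sum_list_lam: "sum_list lam = n"
  using lam by (simp add: partitions_def)

lemma tableau_bij: "bij_betw t (young_diagram lam) {..<n}"
  using t by (simp add: tableaux_def sum_list_lam)

lemma tableau_inj: "c \<in> young_diagram lam \<Longrightarrow> d \<in> young_diagram lam \<Longrightarrow> t c = t d \<longleftrightarrow> c = d"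
  using tableau_bij by (auto simp: bij_betw_def inj_on_def)

lemma tableau_mem: "c \<in> young_diagram lam \<Longrightarrow> t c < n"
  using tableau_bij by (auto simp: bij_betw_def)

lemma tableau_surj: "y < n \<Longrightarrow> \<exists>c\<in>young_diagram lam. t c = y"
  using tableau_bij by (auto simp: bij_betw_def image_iff) (metis imageE lessThan_iff)

lemma tab_col_subset: "tab_col lam t j \<subseteq> {..<n}"
  using tableau_mem by (auto simp: tab_col_def)

lemma tab_col_disjoint: "k \<noteq> j \<Longrightarrow> tab_col lam t k \<inter> tab_col lam t j = {}"
  using tableau_inj by (auto simp: tab_col_def)

text \<open>Antitone row lengths make every column an initial segment, which is where the minimum
  comes from.\<close>

lemma col_heights:
  shows "finite {i. i < r \<and> (i, j) \<in> young_diagram lam}"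
    and "card {i. i < r \<and> (i, j) \<in> young_diagram lam} = min r (card (tab_col lam t j))"
proof -
  define H where "H = {i. (i, j) \<in> young_diagram lam}"
  have finH: "finite H" unfolding H_def by (rule finite_subset[of _ "{..<length lam}"]) (auto simp: young_diagram_def)
  have "tab_col lam t j = (\<lambda>i. t (i, j)) ` H" by (auto simp: tab_col_def H_def)
  moreover have "inj_on (\<lambda>i. t (i, j)) H" using tableau_inj by (auto simp: inj_on_def H_def)
  ultimately have cH: "card (tab_col lam t j) = card H" by (simp add: card_image)
  have down: "i' \<in> H" if "i \<in> H" "i' \<le> i" for i i'
    using that partitions_nth_antimono[OF lam, of i' i] by (auto simp: H_def young_diagram_def)
  have "H = {..<card H}"
  proof (rule card_seteq[symmetric])
    show "{..<card H} \<subseteq> H"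
    proof
      fix i assume i: "i \<in> {..<card H}"
      show "i \<in> H"
      proof (rule ccontr)
        assume "i \<notin> H"
        then have "H \<subseteq> {..<i}" using down by (auto simp: not_less) (metis not_less)
        then have "card H \<le> i" using card_mono[of "{..<i}" H] by simp
        then show False using i by simp
      qed
    qed
  qed (use finH in auto)
  then obtain h where h: "H = {..<h}" by blast
  have "{i. i < r \<and> (i, j) \<in> young_diagram lam} = {..<r} \<inter> H" by (auto simp: H_def)
  also have "\<dots> = {..<min r (card H)}" unfolding h by auto
  finally have "{i. i < r \<and> (i, j) \<in> young_diagram lam} = {..<min r (card H)}" .
  then show "finite {i. i < r \<and> (i, j) \<in> young_diagram lam}"
    "card {i. i < r \<and> (i, j) \<in> young_diagram lam} = min r (card (tab_col lam t j))"
    by (simp_all add: cH)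
qed

lemma young_diagram_col_less:
  assumes "(i, j) \<in> young_diagram lam" shows "j < n"
proof -
  have "lam ! i \<le> sum_list lam" using assms by (intro member_le_sum_list) (auto simp: young_diagram_def)
  then show ?thesis using assms sum_list_lam by (auto simp: young_diagram_def)
qed

lemma sum_col_heights:
  "(\<Sum>j<n. card {i. i < r \<and> (i, j) \<in> young_diagram lam}) = sum_list (take r lam)"
proof -
  have "(\<Sum>j<n. card {i. i < r \<and> (i, j) \<in> young_diagram lam}) = card (SIGMA j:{..<n}. {i. i < r \<and> (i, j) \<in> young_diagram lam})"
    using col_heights(1) by simp
  also have "\<dots> = card {(i, j) \<in> young_diagram lam. i < r}"
    by (rule bij_betw_same_card[of "\<lambda>(j, i). (i, j)"])
      (auto simp: bij_betw_def inj_on_def image_iff dest: young_diagram_col_less)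
  finally show ?thesis by (simp add: card_young_diagram_rows)
qed

text \<open>The only tabloids at which a column antisymmetrized function can be nonzero.\<close>

definition transversal :: "nat set list \<Rightarrow> bool" where
  "transversal R \<longleftrightarrow> (\<forall>i<length R. \<forall>j. card (R ! i \<inter> tab_col lam t j) \<le> 1)"

lemma kappa_nonzero_transversal:
  assumes R: "R \<in> tabloids nu" and nz: "kappa lam t f R \<noteq> 0" shows "transversal R"
  unfolding transversal_def
proof (intro allI impI, rule ccontr)
  fix i j assume i: "i < length R" and c: "\<not> card (R ! i \<inter> tab_col lam t j) \<le> 1"
  have "finite (R ! i \<inter> tab_col lam t j)" using tab_col_subset[of j] finite_subset by blast
  then have "\<exists>x\<in>R ! i \<inter> tab_col lam t j. \<exists>y\<in>R ! i \<inter> tab_col lam t j. x \<noteq> y"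
    using c card_le_Suc0_iff_eq by fastforce
  then obtain x y where "x \<noteq> y" "x \<in> R ! i" "x \<in> tab_col lam t j" "y \<in> R ! i" "y \<in> tab_col lam t j" by blast
  then have "kappa lam t f R = 0"
    using i R tab_col_subset tab_col_disjoint
    by (intro kappa_eq_0[of x y lam t j R nu i]) (auto simp: sum_list_lam tabloids_def)
  with nz show False ..
qed

definition upper_rows :: "nat \<Rightarrow> nat set list \<Rightarrow> nat set" where
  "upper_rows r R = (\<Union>i\<in>{i. i < r \<and> i < length R}. R ! i)"

text \<open>The first r rows of R contribute at most one entry each to a column, and a column has
  only so many entries; the diagram attains the minimum of the two. The total holds because the
  columns partition the points.\<close>

lemma transversal_counts:
  assumes R: "R \<in> tabloids nu" and nu: "sum_list nu = n" and tr: "transversal R"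
  shows "card (upper_rows r R \<inter> tab_col lam t j) \<le> card {i. i < r \<and> (i, j) \<in> young_diagram lam}"
    and "(\<Sum>j<n. card (upper_rows r R \<inter> tab_col lam t j)) = sum_list (take r nu)"
proof -
  have len: "length R = length nu" using R by (simp add: tabloids_def)
  have finc: "finite (tab_col lam t j)" for j using tab_col_subset[of j] finite_subset by blast
  have sub: "upper_rows r R \<subseteq> {..<n}"
    unfolding upper_rows_def using tabloids_row_finite(2)[OF R] len nu by auto
  show "card (upper_rows r R \<inter> tab_col lam t j) \<le> card {i. i < r \<and> (i, j) \<in> young_diagram lam}"
  proof -
    have eq: "upper_rows r R \<inter> tab_col lam t j = (\<Union>i\<in>{i. i < r \<and> i < length R}. R ! i \<inter> tab_col lam t j)"
      by (auto simp: upper_rows_def)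
    have "card (upper_rows r R \<inter> tab_col lam t j) \<le> (\<Sum>i\<in>{i. i < r \<and> i < length R}. card (R ! i \<inter> tab_col lam t j))"
      unfolding eq by (rule card_UN_le) simp
    also have "\<dots> \<le> (\<Sum>i\<in>{i. i < r \<and> i < length R}. 1)"
      using tr by (intro sum_mono) (auto simp: transversal_def)
    also have "\<dots> \<le> r" using card_mono[of "{..<r}" "{i. i < r \<and> i < length R}"] by auto
    finally have "card (upper_rows r R \<inter> tab_col lam t j) \<le> r" .
    moreover have "card (upper_rows r R \<inter> tab_col lam t j) \<le> card (tab_col lam t j)"
      by (intro card_mono finc) auto
    ultimately show ?thesis by (simp add: col_heights(2))
  qed
  have "(\<Sum>j<n. card (upper_rows r R \<inter> tab_col lam t j)) = card (\<Union>j<n. upper_rows r R \<inter> tab_col lam t j)"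
    using finc tab_col_disjoint by (subst card_UN_disjoint) auto
  also have "(\<Union>j<n. upper_rows r R \<inter> tab_col lam t j) = upper_rows r R"
  proof -
    have "\<exists>j<n. y \<in> tab_col lam t j" if "y < n" for y
    proof -
      obtain i j where c: "(i, j) \<in> young_diagram lam" "t (i, j) = y" using tableau_surj[OF \<open>y < n\<close>] by auto
      then show ?thesis using young_diagram_col_less by (auto simp: tab_col_def)
    qed
    then show ?thesis using sub by blast
  qed
  also have "card (upper_rows r R) = (\<Sum>i\<in>{i. i < r \<and> i < length R}. card (R ! i))"
    unfolding upper_rows_def using R len tabloids_row_finite(1)[OF R]
    by (intro card_UN_disjoint) (auto simp: tabloids_def)
  also have "\<dots> = sum_list (take r nu)"
    unfolding sum_list_take_eq len using R by (intro sum.cong) (auto simp: tabloids_def)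
  finally show "(\<Sum>j<n. card (upper_rows r R \<inter> tab_col lam t j)) = sum_list (take r nu)" .
qed

text \<open>Summed over the columns, the counts give dominance of lam over nu.\<close>

lemma transversal_dominates:
  assumes "R \<in> tabloids nu" "sum_list nu = n" "transversal R"
  shows "sum_list (take r nu) \<le> sum_list (take r lam)"
proof -
  have "sum_list (take r nu) = (\<Sum>j<n. card (upper_rows r R \<inter> tab_col lam t j))"
    using transversal_counts(2)[OF assms] by simp
  also have "\<dots> \<le> (\<Sum>j<n. card {i. i < r \<and> (i, j) \<in> young_diagram lam})"
    by (intro sum_mono transversal_counts(1)[OF assms])
  finally show ?thesis by (simp add: sum_col_heights)
qed

text \<open>For equal shapes the column inequalities have equal totals, hence are equalities for
  every r; passing from i to i + 1 rows then adds exactly one entry.\<close>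

lemma transversal_cell:
  assumes R: "R \<in> tabloids lam" and tr: "transversal R" and c: "(i, j) \<in> young_diagram lam"
  shows "card (R ! i \<inter> tab_col lam t j) = 1"
proof -
  have len: "length R = length lam" and il: "i < length lam" using R c by (auto simp: tabloids_def young_diagram_def)
  have finc: "finite (tab_col lam t j)" for j using tab_col_subset[of j] finite_subset by blast
  have jn: "j < n" by (rule young_diagram_col_less[OF c])
  have eq: "card (upper_rows r R \<inter> tab_col lam t j) = card {i. i < r \<and> (i, j) \<in> young_diagram lam}" for r
  proof (rule ccontr)
    assume "card (upper_rows r R \<inter> tab_col lam t j) \<noteq> card {i. i < r \<and> (i, j) \<in> young_diagram lam}"
    then have "card (upper_rows r R \<inter> tab_col lam t j) < card {i. i < r \<and> (i, j) \<in> young_diagram lam}"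
      using transversal_counts(1)[OF R sum_list_lam tr, of r j] by simp
    then have "(\<Sum>j<n. card (upper_rows r R \<inter> tab_col lam t j)) < (\<Sum>j<n. card {i. i < r \<and> (i, j) \<in> young_diagram lam})"
      using jn transversal_counts(1)[OF R sum_list_lam tr] by (intro sum_strict_mono_ex1) auto
    then show False using transversal_counts(2)[OF R sum_list_lam tr] sum_col_heights by simp
  qed
  have "upper_rows (Suc i) R \<inter> tab_col lam t j = (upper_rows i R \<inter> tab_col lam t j) \<union> (R ! i \<inter> tab_col lam t j)"
    using il len by (auto simp: upper_rows_def less_Suc_eq)
  moreover have "(upper_rows i R \<inter> tab_col lam t j) \<inter> (R ! i \<inter> tab_col lam t j) = {}"
  proof -
    have "R ! k \<inter> R ! i = {}" if "k < i" for k using R il that by (simp add: tabloids_def)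
    then show ?thesis unfolding upper_rows_def by blast
  qed
  ultimately have "card (upper_rows (Suc i) R \<inter> tab_col lam t j) = card (upper_rows i R \<inter> tab_col lam t j) + card (R ! i \<inter> tab_col lam t j)"
    using finc by (simp add: card_Un_disjoint)
  moreover have "{i'. i' < Suc i \<and> (i', j) \<in> young_diagram lam} = insert i {i'. i' < i \<and> (i', j) \<in> young_diagram lam}"
    using c by auto
  ultimately show ?thesis unfolding eq using col_heights(1)[of i j] by simp
qed

text \<open>Sending the entry of cell (i, j) to the unique common element of row i of R and column j
  preserves the columns and carries the rows of t to those of R.\<close>

lemma transversal_in_orbit:
  assumes R: "R \<in> tabloids lam" and tr: "transversal R"
  shows "\<exists>p\<in>column_stabilizer lam t. R = act p (tabloid lam t)"
proof -
  have len: "length R = length lam" using R by (auto simp: tabloids_def)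
  define e where "e = (\<lambda>(i, j). SOME y. y \<in> R ! i \<inter> tab_col lam t j)"
  have e: "e (i, j) \<in> R ! i" "e (i, j) \<in> tab_col lam t j" if "(i, j) \<in> young_diagram lam" for i j
  proof -
    have "R ! i \<inter> tab_col lam t j \<noteq> {}" using transversal_cell[OF R tr that] by auto
    then have "e (i, j) \<in> R ! i \<inter> tab_col lam t j" unfolding e_def prod.case by (rule some_in_eq[THEN iffD2])
    then show "e (i, j) \<in> R ! i" "e (i, j) \<in> tab_col lam t j" by auto
  qed
  define p where "p = (\<lambda>y. if y < n then e (inv_into (young_diagram lam) t y) else y)"
  have pt: "p (t c) = e c" if "c \<in> young_diagram lam" for c
    using tableau_mem[OF that] inv_into_f_f[OF bij_betw_imp_inj_on[OF tableau_bij] that] by (simp add: p_def)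
  have einj: "c = d" if "c \<in> young_diagram lam" "d \<in> young_diagram lam" "e c = e d" for c d
  proof -
    obtain i j where cd: "c = (i, j)" by (cases c)
    obtain k l where d: "d = (k, l)" by (cases d)
    have il: "i < length lam" "k < length lam" using that cd d by (auto simp: young_diagram_def)
    have "e c \<in> R ! i \<inter> R ! k" using e(1)[of i j] e(1)[of k l] that unfolding cd d by simp
    then have "i = k" using R il unfolding tabloids_def by blast
    moreover have "e c \<in> tab_col lam t j \<inter> tab_col lam t l"
      using e(2)[of i j] e(2)[of k l] that unfolding cd d by simp
    then have "j = l" using tab_col_disjoint by blast
    ultimately show ?thesis using cd d by simp
  qed
  have pmem: "p y \<in> {..<n}" if "y \<in> {..<n}" for y
  proof -
    obtain i j where c: "(i, j) \<in> young_diagram lam" "t (i, j) = y" using tableau_surj[of y] \<open>y \<in> {..<n}\<close> by auto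
    then show ?thesis using pt[OF c(1)] e(2)[OF c(1)] tab_col_subset[of j] by auto
  qed
  have pinj: "inj_on p {..<n}"
  proof (rule inj_onI)
    fix x y assume "x \<in> {..<n}" "y \<in> {..<n}" "p x = p y"
    moreover obtain c d where "c \<in> young_diagram lam" "t c = x" "d \<in> young_diagram lam" "t d = y"
      using tableau_surj[of x] tableau_surj[of y] calculation by auto
    ultimately show "x = y" using pt[of c] pt[of d] einj[of c d] by simp
  qed
  have "p ` {..<n} = {..<n}" using endo_inj_surj[of "{..<n}" p] pmem pinj by auto
  then have pp: "p permutes {..<n}" using pinj by (intro bij_imp_permutes) (auto simp: bij_betw_def p_def)
  have pcol: "p ` tab_col lam t j = tab_col lam t j" for j
  proof (rule endo_inj_surj)
    show "finite (tab_col lam t j)" using tab_col_subset[of j] finite_subset by blast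
    show "p ` tab_col lam t j \<subseteq> tab_col lam t j"
    proof (rule image_subsetI)
      fix y assume "y \<in> tab_col lam t j"
      then obtain i where "(i, j) \<in> young_diagram lam" "y = t (i, j)" by (auto simp: tab_col_def)
      then show "p y \<in> tab_col lam t j" using pt[of "(i, j)"] e(2)[of i j] by simp
    qed
    show "inj_on p (tab_col lam t j)" using pinj tab_col_subset inj_on_subset by blast
  qed
  have "p \<in> column_stabilizer lam t" using pp pcol by (simp add: column_stabilizer_iff sum_list_lam)
  moreover have "R = act p (tabloid lam t)"
  proof (rule nth_equalityI)
    show "length R = length (act p (tabloid lam t))" by (simp add: act_def tabloid_def len)
    fix i assume "i < length R"
    then have i: "i < length lam" using len by simp
    have row: "{t (i, j) | j. (i, j) \<in> young_diagram lam} = (\<lambda>j. t (i, j)) ` {..<lam ! i}"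
      using i by (auto simp: young_diagram_def)
    have "p ` {t (i, j) | j. (i, j) \<in> young_diagram lam} \<subseteq> R ! i"
    proof (rule image_subsetI)
      fix y assume "y \<in> {t (i, j) | j. (i, j) \<in> young_diagram lam}"
      then obtain j where "(i, j) \<in> young_diagram lam" "y = t (i, j)" by auto
      then show "p y \<in> R ! i" using pt[of "(i, j)"] e(1)[of i j] by simp
    qed
    moreover have "card (p ` {t (i, j) | j. (i, j) \<in> young_diagram lam}) = lam ! i"
    proof -
      have "inj_on (\<lambda>j. t (i, j)) {..<lam ! i}"
        using i tableau_inj by (auto simp: inj_on_def young_diagram_def)
      then have "card {t (i, j) | j. (i, j) \<in> young_diagram lam} = lam ! i" unfolding row by (simp add: card_image)
      then show ?thesis using permutes_inj[OF pp] by (simp add: card_image inj_on_subset)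
    qed
    ultimately have "p ` {t (i, j) | j. (i, j) \<in> young_diagram lam} = R ! i"
      using R i tabloids_row_finite(1)[OF R i] by (intro card_subset_eq) (auto simp: tabloids_def)
    then show "R ! i = act p (tabloid lam t) ! i" using i by (simp add: act_def tabloid_def)
  qed
  ultimately show ?thesis by blast
qed

lemma tabloid_mem: "tabloid lam t \<in> tabloids lam"
  unfolding tabloids_def
proof (intro CollectI conjI allI impI)
  have row: "tabloid lam t ! i = (\<lambda>j. t (i, j)) ` {..<lam ! i}" if "i < length lam" for i
    using that by (auto simp: tabloid_def young_diagram_def)
  show "length (tabloid lam t) = length lam" by (simp add: tabloid_def)
  show "card (tabloid lam t ! i) = lam ! i" if "i < length lam" for i
  proof -
    have "inj_on (\<lambda>j. t (i, j)) {..<lam ! i}"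
      using that tableau_inj by (auto simp: inj_on_def young_diagram_def)
    then show ?thesis unfolding row[OF that] by (simp add: card_image)
  qed
  show "tabloid lam t ! i \<inter> tabloid lam t ! j = {}" if "i < length lam" "j < length lam" "i \<noteq> j" for i j
    using that tableau_inj by (auto simp: row young_diagram_def)
  show "\<Union> (set (tabloid lam t)) = {..<sum_list lam}"
  proof (intro equalityI subsetI)
    fix y assume "y \<in> {..<sum_list lam}"
    then have "y < n" by (simp add: sum_list_lam)
    then obtain i j where "(i, j) \<in> young_diagram lam" "t (i, j) = y" using tableau_surj[of y] by auto
    then show "y \<in> \<Union> (set (tabloid lam t))" by (auto simp: tabloid_def young_diagram_def)
  qed (auto simp: tabloid_def sum_list_lam dest: tableau_mem)
qed

text \<open>A permutation that preserves all rows and all columns of t is the identity, so a single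
  term of the signed sum survives.\<close>

lemma polytabloid_at_tabloid: "polytabloid lam t (tabloid lam t) = 1"
proof -
  have "p = id" if p: "p \<in> column_stabilizer lam t" and fx: "act (inv p) (tabloid lam t) = tabloid lam t" for p
  proof
    fix y
    have pp: "p permutes {..<n}" using column_stabilizer_permutes[OF p] by (simp add: sum_list_lam)
    have fx': "act p (tabloid lam t) = tabloid lam t" using act_inv(2)[OF pp, of "tabloid lam t"] fx by simp
    show "p y = id y"
    proof (cases "y < n")
      case True
      then obtain i j where c: "(i, j) \<in> young_diagram lam" "t (i, j) = y" using tableau_surj[of y] by auto
      have i: "i < length lam" using c by (simp add: young_diagram_def)
      have "y \<in> tabloid lam t ! i" using c i by (auto simp: tabloid_def)
      then have "p y \<in> act p (tabloid lam t) ! i" using i by (simp add: act_def tabloid_def)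
      then have "p y \<in> tabloid lam t ! i" by (simp add: fx')
      then obtain l where l: "p y = t (i, l)" "(i, l) \<in> young_diagram lam" using i by (auto simp: tabloid_def)
      have "y \<in> tab_col lam t j" using c by (auto simp: tab_col_def)
      then have "p y \<in> tab_col lam t j" using p by (auto simp: column_stabilizer_iff)
      moreover have "p y \<in> tab_col lam t l" using l by (auto simp: tab_col_def)
      ultimately have "l = j" using tab_col_disjoint by blast
      then show ?thesis using l c by simp
    qed (use permutes_not_in[OF pp] in auto)
  qed
  then have "polytabloid lam t (tabloid lam t) = (\<Sum>p\<in>column_stabilizer lam t. if p = id then 1 else 0)"
    unfolding polytabloid_kappa kappa_apply tabloid_vec_def
    by (intro sum.cong) auto
  then show ?thesis using column_stabilizer_id finite_column_stabilizer by simp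
qed

lemma kappa_support:
  assumes "\<And>R. f R \<noteq> 0 \<Longrightarrow> R \<in> tabloids nu" "sum_list nu = n" "kappa lam t f R \<noteq> 0"
  shows "R \<in> tabloids nu"
proof -
  have "\<exists>p\<in>column_stabilizer lam t. f (act (inv p) R) \<noteq> 0"
  proof (rule ccontr)
    assume "\<not> ?thesis"
    then have "kappa lam t f R = 0" unfolding kappa_apply by (intro sum.neutral) auto
    with assms(3) show False ..
  qed
  then obtain p where p: "p \<in> column_stabilizer lam t" "f (act (inv p) R) \<noteq> 0" by blast
  have pp: "p permutes {..<n}" using column_stabilizer_permutes[OF p(1)] by (simp add: sum_list_lam)
  have "act p (act (inv p) R) \<in> tabloids nu"
    using pp assms(2) by (intro act_tabloids[OF _ assms(1)[OF p(2)]]) simp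
  then show ?thesis by (simp add: act_inv[OF pp])
qed

text \<open>Both sides change by the sign under column permutations and vanish off the transversal
  tabloids, which lie in one orbit; comparing them at \<open>tabloid lam t\<close> suffices.\<close>

lemma kappa_multiple:
  assumes supp: "\<And>R. f R \<noteq> 0 \<Longrightarrow> R \<in> tabloids lam"
  shows "kappa lam t f = fun_scale (kappa lam t f (tabloid lam t)) (polytabloid lam t)"
proof
  fix R
  have supp': "tabloid_vec (tabloid lam t) R \<noteq> 0 \<Longrightarrow> R \<in> tabloids lam" for R
    using tabloid_mem by (auto simp: tabloid_vec_def split: if_splits)
  show "kappa lam t f R = fun_scale (kappa lam t f (tabloid lam t)) (polytabloid lam t) R"
  proof (cases "R \<in> tabloids lam \<and> transversal R")
    case True
    then obtain p where p: "p \<in> column_stabilizer lam t" "R = act p (tabloid lam t)"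
      using transversal_in_orbit by blast
    show ?thesis unfolding p(2) fun_scale_def polytabloid_kappa kappa_act[OF p(1)]
      using polytabloid_at_tabloid by (simp add: polytabloid_kappa)
  next
    case False
    then have "kappa lam t f R = 0" "polytabloid lam t R = 0"
      using kappa_nonzero_transversal kappa_support[OF supp sum_list_lam] kappa_support[OF supp' sum_list_lam]
      unfolding polytabloid_kappa by blast+
    then show ?thesis by (simp add: fun_scale_def)
  qed
qed

lemma kappa_zero_unless_dominates:
  assumes "\<And>R. f R \<noteq> 0 \<Longrightarrow> R \<in> tabloids nu" "sum_list nu = n" "sum_list (take r lam) < sum_list (take r nu)"
  shows "kappa lam t f = 0"
proof
  fix R
  have "kappa lam t f R = 0"
  proof (rule ccontr)
    assume nz: "kappa lam t f R \<noteq> 0"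
    have R: "R \<in> tabloids nu" by (rule kappa_support[OF assms(1,2) nz])
    then show False
      using transversal_dominates[OF R assms(2) kappa_nonzero_transversal[OF R nz], of r] assms(3) by simp
  qed
  then show "kappa lam t f R = 0 R" by simp
qed

lemma polytabloid_support: "polytabloid lam t R \<noteq> 0 \<Longrightarrow> R \<in> tabloids lam"
  unfolding polytabloid_kappa
  by (rule kappa_support[OF _ sum_list_lam]) (use tabloid_mem in \<open>auto simp: tabloid_vec_def split: if_splits\<close>)

text \<open>Quasi-idempotence of the antisymmetrizer, read off from \<open>kappa_multiple\<close> by
  evaluating at one tabloid.\<close>

lemma kappa_polytabloid:
  "kappa lam t (polytabloid lam t) = fun_scale (of_nat (card (column_stabilizer lam t))) (polytabloid lam t)"
proof -
  have "of_int (sign p) * polytabloid lam t (act (inv p) (tabloid lam t)) = 1" if p: "p \<in> column_stabilizer lam t" for p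
    using kappa_act[OF column_stabilizer_inv[OF p], of "tabloid_vec (tabloid lam t)" "tabloid lam t"]
      sign_inverse[OF column_stabilizer_permutation[OF p]] polytabloid_at_tabloid
    unfolding polytabloid_kappa by (simp add: sign_def)
  then have "kappa lam t (polytabloid lam t) (tabloid lam t) = of_nat (card (column_stabilizer lam t))"
    unfolding kappa_apply by simp
  then show ?thesis using kappa_multiple[of "polytabloid lam t", OF polytabloid_support] by simp
qed

lemma polytabloid_Ints: "polytabloid lam t R \<in> \<int>"
  unfolding polytabloid_kappa kappa_apply tabloid_vec_def by (intro Ints_sum Ints_mult) auto

end

section \<open>Relabelling of tableaux and the Specht module as a cyclic module\<close>

lemma tab_col_comp: "tab_col lam (g \<circ> t) j = g ` tab_col lam t j"
  by (auto simp: tab_col_def)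

lemma tabloid_comp: "tabloid lam (g \<circ> t) = act g (tabloid lam t)"
  by (auto simp: tabloid_def act_def)

lemma column_stabilizer_conj:
  assumes g: "g permutes {..<sum_list lam}"
  shows "bij_betw (\<lambda>p. g \<circ> p \<circ> inv g) (column_stabilizer lam t) (column_stabilizer lam (g \<circ> t))"
proof (rule bij_betwI[where g = "\<lambda>p. inv g \<circ> p \<circ> g"])
  have i: "inv g ` g ` A = A" "g ` inv g ` A = A" for A
    using permutes_inverses[OF g] by (auto simp: image_image)
  show "(\<lambda>p. g \<circ> p \<circ> inv g) \<in> column_stabilizer lam t \<rightarrow> column_stabilizer lam (g \<circ> t)"
  proof (rule Pi_I)
    fix p assume "p \<in> column_stabilizer lam t"
    then have p: "p permutes {..<sum_list lam}" "\<And>j. p ` tab_col lam t j = tab_col lam t j"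
      by (auto simp: column_stabilizer_iff)
    have "(g \<circ> p \<circ> inv g) ` tab_col lam (g \<circ> t) j = g ` p ` inv g ` g ` tab_col lam t j" for j
      by (simp only: tab_col_comp image_comp comp_assoc)
    then show "g \<circ> p \<circ> inv g \<in> column_stabilizer lam (g \<circ> t)"
      unfolding column_stabilizer_iff using p(1) g
      by (auto simp only: i p(2) tab_col_comp intro!: permutes_compose permutes_inv)
  qed
  show "(\<lambda>p. inv g \<circ> p \<circ> g) \<in> column_stabilizer lam (g \<circ> t) \<rightarrow> column_stabilizer lam t"
  proof (rule Pi_I)
    fix p assume "p \<in> column_stabilizer lam (g \<circ> t)"
    then have p: "p permutes {..<sum_list lam}" "\<And>j. p ` g ` tab_col lam t j = g ` tab_col lam t j"
      by (auto simp: column_stabilizer_iff tab_col_comp)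
    have "(inv g \<circ> p \<circ> g) ` tab_col lam t j = inv g ` p ` g ` tab_col lam t j" for j
      by (simp only: image_comp comp_assoc)
    then show "inv g \<circ> p \<circ> g \<in> column_stabilizer lam t"
      unfolding column_stabilizer_iff using p(1) g
      by (auto simp only: i p(2) intro!: permutes_compose permutes_inv)
  qed
  show "inv g \<circ> (g \<circ> p \<circ> inv g) \<circ> g = p" for p :: "nat \<Rightarrow> nat"
    using permutes_inverses[OF g] by (auto simp: fun_eq_iff)
  show "g \<circ> (inv g \<circ> p \<circ> g) \<circ> inv g = p" for p :: "nat \<Rightarrow> nat"
    using permutes_inverses[OF g] by (auto simp: fun_eq_iff)
qed

lemma perm_act_inv:
  assumes "g permutes S" shows "perm_act (inv g) (perm_act g f) = f" "perm_act g (perm_act (inv g) f) = f"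
  by (intro ext; simp add: perm_act_apply act_inv[OF assms] permutes_inv_inv[OF assms])+

lemma polytabloid_comp:
  assumes g: "g permutes {..<sum_list lam}"
  shows "polytabloid lam (g \<circ> t) = perm_act g (polytabloid lam t)"
proof -
  have "polytabloid lam (g \<circ> t) = (\<Sum>p\<in>column_stabilizer lam t. fun_scale (of_int (sign (g \<circ> p \<circ> inv g)))
      (perm_act (g \<circ> p \<circ> inv g) (tabloid_vec (act g (tabloid lam t)))))"
    unfolding polytabloid_def tabloid_comp
    by (rule sum.reindex_bij_betw[OF column_stabilizer_conj[OF g], symmetric])
  also have "\<dots> = (\<Sum>p\<in>column_stabilizer lam t. fun_scale (of_int (sign p)) (perm_act g (perm_act p (tabloid_vec (tabloid lam t)))))"
  proof (intro sum.cong refl)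
    fix p assume p: "p \<in> column_stabilizer lam t"
    have pp: "p permutes {..<sum_list lam}" by (rule column_stabilizer_permutes[OF p])
    have gp: "permutation g" using g by (rule permutes_lessThan_permutation)
    have "sign (g \<circ> p \<circ> inv g) = sign g * sign p * sign (inv g)"
      using gp column_stabilizer_permutation[OF p]
      by (simp add: sign_compose permutation_compose permutation_inverse)
    also have "\<dots> = sign p * (sign g * sign g)" by (simp add: sign_inverse[OF gp] mult_ac)
    also have "\<dots> = sign p" by (simp add: sign_idempotent)
    finally have s: "sign (g \<circ> p \<circ> inv g) = sign p" .
    have "perm_act (g \<circ> p \<circ> inv g) (tabloid_vec (act g (tabloid lam t))) =
        perm_act (g \<circ> p \<circ> inv g) (perm_act g (tabloid_vec (tabloid lam t)))"
      by (simp add: perm_act_tabloid_vec[OF g])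
    also have "\<dots> = perm_act g (perm_act p (tabloid_vec (tabloid lam t)))"
      using g pp permutes_compose[OF pp g] permutes_inv[OF g] perm_act_inv[OF g]
      by (simp add: perm_act_comp[of _ "{..<sum_list lam}"])
    finally show "fun_scale (of_int (sign (g \<circ> p \<circ> inv g))) (perm_act (g \<circ> p \<circ> inv g) (tabloid_vec (act g (tabloid lam t)))) =
      fun_scale (of_int (sign p)) (perm_act g (perm_act p (tabloid_vec (tabloid lam t))))"
      unfolding s by simp
  qed
  also have "\<dots> = perm_act g (polytabloid lam t)"
    unfolding polytabloid_def by (rule lin_op_sum[OF lin_op_perm_act, symmetric])
  finally show ?thesis .
qed

text \<open>Tableaux are total functions with arbitrary values off the diagram; polytabloids do not
  see those values.\<close>

lemma polytabloid_cong:
  assumes "\<And>c. c \<in> young_diagram lam \<Longrightarrow> t c = t' c" shows "polytabloid lam t = polytabloid lam t'"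
proof -
  have "{t (i, j) | j. (i, j) \<in> young_diagram lam} = {t' (i, j) | j. (i, j) \<in> young_diagram lam}" for i
    by (rule Collect_cong) (metis assms)
  then have "tabloid lam t = tabloid lam t'" by (simp add: tabloid_def)
  moreover have "column_stabilizer lam t = column_stabilizer lam t'"
  proof -
    have "tab_col lam t j = tab_col lam t' j" for j
      unfolding tab_col_def by (rule Collect_cong) (metis assms)
    then show ?thesis by (auto simp: column_stabilizer_iff)
  qed
  ultimately show ?thesis by (simp add: polytabloid_def)
qed

text \<open>Any two tableaux differ on the diagram by a permutation. Hence the module is cyclic, and
  its generating set is finite although \<open>tableaux lam\<close> is not.\<close>

lemma polytabloid_image:
  assumes lam: "lam \<in> partitions n" and t: "t \<in> tableaux lam"
  shows "polytabloid lam ` tableaux lam = (\<lambda>g. perm_act g (polytabloid lam t)) ` sym_group n"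
proof (intro equalityI subsetI)
  have n: "sum_list lam = n" using lam by (simp add: partitions_def)
  have bt: "bij_betw t (young_diagram lam) {..<n}" using t n by (simp add: tableaux_def)
  {
    fix e assume "e \<in> polytabloid lam ` tableaux lam"
    then obtain t' where t': "t' \<in> tableaux lam" "e = polytabloid lam t'" by blast
    have bt': "bij_betw t' (young_diagram lam) {..<n}" using t' n by (simp add: tableaux_def)
    define g where "g = (\<lambda>y. if y < n then t' (inv_into (young_diagram lam) t y) else y)"
    have "bij_betw (t' \<circ> inv_into (young_diagram lam) t) {..<n} {..<n}"
      using bij_betw_trans[OF bij_betw_inv_into[OF bt] bt'] .
    then have "bij_betw g {..<n} {..<n}"
      by (rule bij_betw_cong[THEN iffD1, rotated]) (auto simp: g_def)
    then have g: "g permutes {..<n}" by (intro bij_imp_permutes) (auto simp: g_def)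
    have "t' c = (g \<circ> t) c" if "c \<in> young_diagram lam" for c
      using that bt inv_into_f_f[OF bij_betw_imp_inj_on[OF bt] that] bij_betwE[OF bt] by (auto simp: g_def)
    then have "e = polytabloid lam (g \<circ> t)" unfolding t'(2) by (rule polytabloid_cong)
    also have "\<dots> = perm_act g (polytabloid lam t)" using g n by (intro polytabloid_comp) simp
    finally show "e \<in> (\<lambda>g. perm_act g (polytabloid lam t)) ` sym_group n"
      using g by (auto simp: sym_group_def)
  next
    fix e assume "e \<in> (\<lambda>g. perm_act g (polytabloid lam t)) ` sym_group n"
    then obtain g where g: "g permutes {..<n}" "e = perm_act g (polytabloid lam t)" by (auto simp: sym_group_def)
    then have "e = polytabloid lam (g \<circ> t)" using n by (simp add: polytabloid_comp)
    moreover have "g \<circ> t \<in> tableaux lam"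
      using bij_betw_trans[OF bt permutes_imp_bij[OF g(1)]] n by (simp add: tableaux_def)
    ultimately show "e \<in> polytabloid lam ` tableaux lam" by blast
  }
qed

lemma specht_subspace: "fun_space.subspace (specht_module lam)"
  by (simp add: specht_module_def)

lemma specht_polytabloid: "t \<in> tableaux lam \<Longrightarrow> polytabloid lam t \<in> specht_module lam"
  by (auto simp: specht_module_def intro: fun_space.span_base)

lemma specht_minimal:
  assumes "fun_space.subspace S" "\<And>t. t \<in> tableaux lam \<Longrightarrow> polytabloid lam t \<in> S"
  shows "specht_module lam \<subseteq> S"
  unfolding specht_module_def using assms by (intro fun_space.span_minimal) auto

lemma specht_invariant:
  assumes lam: "lam \<in> partitions n" and g: "g \<in> sym_group n" and u: "u \<in> specht_module lam"
  shows "perm_act g u \<in> specht_module lam"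
proof -
  have n: "sum_list lam = n" using lam by (simp add: partitions_def)
  have gp: "g permutes {..<n}" using g by (simp add: sym_group_def)
  have "specht_module lam \<subseteq> {u. perm_act g u \<in> specht_module lam}"
  proof (rule specht_minimal)
    show "fun_space.subspace {u. perm_act g u \<in> specht_module lam}"
      using specht_subspace[of lam] lin_op_perm_act[of g] unfolding fun_space.subspace_def lin_op_def
      by (auto simp: perm_act_def zero_fun_def)
    fix t assume t: "t \<in> tableaux lam"
    have "g \<circ> t \<in> tableaux lam"
      using t bij_betw_trans[OF _ permutes_imp_bij[OF gp]] n by (auto simp: tableaux_def)
    from specht_polytabloid[OF this] show "polytabloid lam t \<in> {u. perm_act g u \<in> specht_module lam}"
      using polytabloid_comp[of g lam t] gp n by (simp only: mem_Collect_eq)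
  qed
  then show ?thesis using u by blast
qed

lemma specht_support:
  assumes lam: "lam \<in> partitions n" and "u \<in> specht_module lam" "u R \<noteq> 0" shows "R \<in> tabloids lam"
proof -
  have "specht_module lam \<subseteq> {u. \<forall>R. R \<notin> tabloids lam \<longrightarrow> u R = 0}"
    using polytabloid_support[OF lam]
    by (intro specht_minimal) (auto simp: fun_space.subspace_def fun_scale_def)
  then show ?thesis using assms by blast
qed

lemma specht_pivot_basis:
  assumes lam: "lam \<in> partitions n" and p: "prime p"
  shows "\<exists>P v. pivot_basis (specht_module lam) P v \<and> (\<forall>x\<in>P. \<forall>y. v x y \<in> p_integral p)"
proof -
  obtain t where t: "t \<in> tableaux lam" using exists_tableau by blast
  have fin: "finite (polytabloid lam ` tableaux lam)"
    unfolding polytabloid_image[OF lam t] using finite_sym_group by simp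
  have "\<exists>P v. P \<subseteq> tabloids lam \<and> pivot_basis (fun_space.span (polytabloid lam ` tableaux lam)) P v \<and> (\<forall>x\<in>P. \<forall>y. v x y \<in> p_integral p)"
  proof (rule exists_pivot_basis[OF p finite_tabloids fin])
    show "f x \<in> \<rat>" if "f \<in> polytabloid lam ` tableaux lam" for f x
      using that polytabloid_Ints[OF lam] Ints_subset_Rats by blast
    show "f x = 0" if "f \<in> polytabloid lam ` tableaux lam" "x \<notin> tabloids lam" for f x
      using that polytabloid_support[OF lam] by blast
  qed
  then show ?thesis unfolding specht_module_def by blast
qed

section \<open>Characters: class functions, integrality, parity under squaring\<close>

lemma irr_character_pivot:
  assumes lam: "lam \<in> partitions n" and P: "pivot_basis (specht_module lam) P v" and g: "g \<in> sym_group n"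
  shows "irr_character lam g = (\<Sum>x\<in>P. perm_act g (v x) x)"
  unfolding irr_character_def
  by (rule trace_on_pivot[OF lin_op_perm_act specht_subspace P specht_invariant[OF lam g]])

lemma pivot_expand:
  assumes "pivot_basis V P v" "u \<in> V" shows "u = (\<Sum>x\<in>P. fun_scale (u x) (v x))"
proof (rule ext)
  fix z show "u z = (\<Sum>x\<in>P. fun_scale (u x) (v x)) z"
    using assms unfolding pivot_basis_def sum_fun_apply fun_scale_def by blast
qed

lemma lin_op_pivot:
  assumes "lin_op T" "pivot_basis V P v" "u \<in> V" shows "T u z = (\<Sum>x\<in>P. u x * T (v x) z)"
proof -
  have "T u = T (\<Sum>x\<in>P. fun_scale (u x) (v x))"
    using pivot_expand[OF assms(2,3)] by (rule arg_cong)
  also have "\<dots> = (\<Sum>x\<in>P. fun_scale (u x) (T (v x)))" by (rule lin_op_sum[OF assms(1)])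
  finally show ?thesis by (simp add: sum_fun_apply fun_scale_def)
qed

lemma pivot_trace_comm:
  assumes S: "lin_op S" "\<And>u. u \<in> V \<Longrightarrow> S u \<in> V" and T: "lin_op T" "\<And>u. u \<in> V \<Longrightarrow> T u \<in> V"
    and P: "pivot_basis V P v"
  shows "(\<Sum>x\<in>P. S (T (v x)) x) = (\<Sum>x\<in>P. T (S (v x)) x)"
proof -
  have vV: "v x \<in> V" if "x \<in> P" for x using P that by (simp add: pivot_basis_def)
  have "(\<Sum>x\<in>P. S (T (v x)) x) = (\<Sum>x\<in>P. \<Sum>y\<in>P. T (v x) y * S (v y) x)"
    using vV T(2) by (intro sum.cong refl lin_op_pivot[OF S(1) P]) auto
  also have "\<dots> = (\<Sum>y\<in>P. \<Sum>x\<in>P. S (v y) x * T (v x) y)"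
    by (subst sum.swap) (simp add: mult.commute)
  also have "\<dots> = (\<Sum>y\<in>P. T (S (v y)) y)"
    using vV S(2) by (intro sum.cong refl lin_op_pivot[OF T(1) P, symmetric]) auto
  finally show ?thesis .
qed

lemma sym_group_comp: "p \<in> sym_group n \<Longrightarrow> q \<in> sym_group n \<Longrightarrow> p \<circ> q \<in> sym_group n"
  unfolding sym_group_def using permutes_compose by blast

lemma sym_group_inv: "p \<in> sym_group n \<Longrightarrow> inv p \<in> sym_group n"
  unfolding sym_group_def using permutes_inv by blast

lemma perm_act_comp': "p \<in> sym_group n \<Longrightarrow> q \<in> sym_group n \<Longrightarrow> perm_act (p \<circ> q) f = perm_act p (perm_act q f)"
  unfolding sym_group_def using perm_act_comp by blast

lemma irr_character_conj:
  assumes lam: "lam \<in> partitions n" and g: "g \<in> sym_group n" and h: "h \<in> sym_group n" and hg: "h \<circ> g = g' \<circ> h" and g': "g' \<in> sym_group n"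
  shows "irr_character lam g' = irr_character lam g"
proof -
  obtain P v where P: "pivot_basis (specht_module lam) P v" using specht_pivot_basis[OF lam two_is_prime_nat] by blast
  have hp: "h permutes {..<n}" using h by (simp add: sym_group_def)
  \<comment> \<open>On the module, g acts as \<open>inv h\<close> after S and g' as S after
    \<open>inv h\<close>; the two composites have equal traces.\<close>
  define S where "S = (\<lambda>u. perm_act g' (perm_act h u))"
  have S: "lin_op S" unfolding S_def using lin_op_perm_act by (simp add: lin_op_def)
  have "irr_character lam g = (\<Sum>x\<in>P. perm_act (inv h) (S (v x)) x)"
  proof -
    have "perm_act g u = perm_act (inv h) (S u)" for u
    proof -
      have "S u = perm_act (g' \<circ> h) u" by (simp add: S_def perm_act_comp'[OF g' h])
      also have "\<dots> = perm_act h (perm_act g u)" by (simp add: hg[symmetric] perm_act_comp'[OF h g])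
      finally show ?thesis by (simp add: perm_act_inv[OF hp])
    qed
    then show ?thesis by (simp add: irr_character_pivot[OF lam P g])
  qed
  also have "\<dots> = (\<Sum>x\<in>P. S (perm_act (inv h) (v x)) x)"
    using specht_invariant[OF lam] g' h sym_group_inv[OF h]
    by (intro pivot_trace_comm[OF lin_op_perm_act _ S _ P]) (auto simp: S_def)
  also have "\<dots> = irr_character lam g'"
    by (simp add: irr_character_pivot[OF lam P g'] S_def perm_act_inv[OF hp])
  finally show ?thesis ..
qed

lemma irr_character_cycle_type:
  assumes lam: "lam \<in> partitions n" and "g \<in> sym_group n" "g' \<in> sym_group n" "cycle_type n g = cycle_type n g'"
  shows "irr_character lam g = irr_character lam g'"
  using conjugate_if_cycle_type_eq[of g n g'] irr_character_conj[OF lam, of g _ g'] assms by (auto simp: sym_group_def)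

text \<open>A group element only permutes the arguments of the p-integral functions in an echelon
  basis, so its trace is p-integral, and this for every prime p.\<close>

lemma irr_character_Ints:
  assumes lam: "lam \<in> partitions n" and g: "g \<in> sym_group n" shows "irr_character lam g \<in> \<int>"
proof (rule Ints_if_p_integral)
  fix p :: nat assume p: "prime p"
  obtain P v where P: "pivot_basis (specht_module lam) P v" "\<forall>x\<in>P. \<forall>y. v x y \<in> p_integral p"
    using specht_pivot_basis[OF lam p] by blast
  show "irr_character lam g \<in> p_integral p"
    unfolding irr_character_pivot[OF lam P(1) g] perm_act_apply using P(2)
    by (intro p_integral_sum[OF p]) auto
qed

text \<open>An integer name for a value already known to be integral; floor and real part only undo
  the embedding into the complex numbers.\<close>

definition chi :: "nat list \<Rightarrow> (nat \<Rightarrow> nat) \<Rightarrow> int" where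
  "chi lam g = \<lfloor>Re (irr_character lam g)\<rfloor>"

lemma irr_character_chi:
  assumes "lam \<in> partitions n" "g \<in> sym_group n" shows "irr_character lam g = of_int (chi lam g)"
  using irr_character_Ints[OF assms] by (auto simp: chi_def elim!: Ints_cases)

lemma chi_cycle_type:
  assumes "lam \<in> partitions n" "g \<in> sym_group n" "g' \<in> sym_group n" "cycle_type n g = cycle_type n g'"
  shows "chi lam g = chi lam g'"
  using irr_character_cycle_type[OF assms] by (simp add: chi_def)

text \<open>The difference is twice the sum of M x y * M y x - M x x * M y y over unordered pairs x
  \<noteq> y; each induction step adds the pairs containing the new index.\<close>

lemma trace_square_parity:
  assumes "finite P" "\<And>x y. x \<in> P \<Longrightarrow> y \<in> P \<Longrightarrow> M x y \<in> p_integral 2"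
  shows "\<exists>z\<in>p_integral 2. (\<Sum>x\<in>P. \<Sum>y\<in>P. M x y * M y x) - (\<Sum>x\<in>P. M x x) ^ 2 = 2 * z"
  using assms
proof (induction P)
  case empty
  show ?case using p_integral_0[OF two_is_prime_nat] by (intro bexI[of _ 0]) auto
next
  case (insert a P)
  obtain z where z: "z \<in> p_integral 2" "(\<Sum>x\<in>P. \<Sum>y\<in>P. M x y * M y x) - (\<Sum>x\<in>P. M x x) ^ 2 = 2 * z"
    using insert by auto
  define c where "c = (\<Sum>y\<in>P. M a y * M y a)"
  define d where "d = (\<Sum>x\<in>P. M x x)"
  have "c \<in> p_integral 2" "d \<in> p_integral 2"
    unfolding c_def d_def using insert.prems
    by (auto intro!: p_integral_sum[OF two_is_prime_nat] p_integral_mult[OF two_is_prime_nat])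
  then have "z + c - d * M a a \<in> p_integral 2"
    using z insert.prems
    by (intro p_integral_add[OF two_is_prime_nat] p_integral_diff[OF two_is_prime_nat] p_integral_mult[OF two_is_prime_nat]) auto
  moreover have "(\<Sum>x\<in>insert a P. \<Sum>y\<in>insert a P. M x y * M y x) = M a a * M a a + 2 * c + (\<Sum>x\<in>P. \<Sum>y\<in>P. M x y * M y x)"
    using insert(1,2) by (simp add: sum.distrib c_def mult.commute)
  moreover have "(\<Sum>x\<in>insert a P. M x x) = M a a + d" using insert(1,2) by (simp add: d_def)
  ultimately show ?case using z(2) unfolding d_def[symmetric]
    by (intro bexI[of _ "z + c - d * M a a"]) (auto simp: power2_eq_square algebra_simps)
qed

lemma chi_square_parity:
  assumes lam: "lam \<in> partitions n" and g: "g \<in> sym_group n"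
  shows "even (chi lam (g \<circ> g)) \<longleftrightarrow> even (chi lam g)"
proof -
  obtain P v where P: "pivot_basis (specht_module lam) P v" "\<forall>x\<in>P. \<forall>y. v x y \<in> p_integral 2"
    using specht_pivot_basis[OF lam two_is_prime_nat] by blast
  define M where "M = (\<lambda>x y. perm_act g (v x) y)"
  have "M x y \<in> p_integral 2" if "x \<in> P" for x y using P(2) that by (simp add: M_def perm_act_apply)
  then obtain z where z: "z \<in> p_integral 2" "(\<Sum>x\<in>P. \<Sum>y\<in>P. M x y * M y x) - (\<Sum>x\<in>P. M x x) ^ 2 = 2 * z"
    using trace_square_parity[of P M] P(1) unfolding pivot_basis_def by blast
  have "of_int (chi lam (g \<circ> g)) = (\<Sum>x\<in>P. perm_act g (perm_act g (v x)) x)"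
    using irr_character_chi[OF lam sym_group_comp[OF g g]] irr_character_pivot[OF lam P(1) sym_group_comp[OF g g]]
    by (simp add: perm_act_comp'[OF g g])
  also have "\<dots> = (\<Sum>x\<in>P. \<Sum>y\<in>P. M x y * M y x)"
    unfolding M_def using P(1) specht_invariant[OF lam g]
    by (intro sum.cong refl lin_op_pivot[OF lin_op_perm_act P(1)]) (auto simp: pivot_basis_def)
  finally have a: "(\<Sum>x\<in>P. \<Sum>y\<in>P. M x y * M y x) = of_int (chi lam (g \<circ> g))" ..
  have b: "(\<Sum>x\<in>P. M x x) = of_int (chi lam g)"
    using irr_character_chi[OF lam g] irr_character_pivot[OF lam P(1) g] by (simp add: M_def)
  \<comment> \<open>Clearing the odd denominator j turns 2-integrality into a parity
    statement.\<close>
  obtain i j where ij: "\<not> 2 dvd j" "z = of_int i / of_int j" using z(1) unfolding p_integral_def by auto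
  have "j \<noteq> 0" using ij by auto
  then have "(of_int ((chi lam (g \<circ> g) - chi lam g ^ 2) * j) :: complex) = of_int (2 * i)"
    using z(2) unfolding a b ij(2) by (simp add: field_simps)
  then have "(chi lam (g \<circ> g) - chi lam g ^ 2) * j = 2 * i" by (simp only: of_int_eq_iff)
  then have "even ((chi lam (g \<circ> g) - chi lam g ^ 2) * j)" by simp
  then have "even (chi lam (g \<circ> g) - chi lam g ^ 2)" using ij(1) by simp
  then show ?thesis by simp
qed

section \<open>Orthogonality of the characters\<close>

text \<open>An equivariant map commutes with the antisymmetrizer, which acts on its own polytabloid
  by the order of the column stabilizer. So the image of a polytabloid is, up to a scalar, in the
  range of \<open>kappa\<close>, which is under control.\<close>

lemma hom_kappa:
  assumes lam: "lam \<in> partitions n" and \<theta>: "lin_op \<theta>"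
    and eqv: "\<And>g u. g \<in> sym_group n \<Longrightarrow> u \<in> specht_module lam \<Longrightarrow> \<theta> (perm_act g u) = perm_act g (\<theta> u)"
    and t: "t \<in> tableaux lam"
  shows "fun_scale (of_nat (card (column_stabilizer lam t))) (\<theta> (polytabloid lam t)) = kappa lam t (\<theta> (polytabloid lam t))"
    and "card (column_stabilizer lam t) > 0"
proof -
  have n: "sum_list lam = n" using lam by (simp add: partitions_def)
  have "fun_scale (of_nat (card (column_stabilizer lam t))) (\<theta> (polytabloid lam t)) =
      \<theta> (kappa lam t (polytabloid lam t))"
    using \<theta> by (simp add: kappa_polytabloid[OF lam t] lin_op_def)
  also have "\<dots> = (\<Sum>p\<in>column_stabilizer lam t. fun_scale (of_int (sign p)) (\<theta> (perm_act p (polytabloid lam t))))"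
    unfolding kappa_def by (rule lin_op_sum[OF \<theta>])
  also have "\<dots> = kappa lam t (\<theta> (polytabloid lam t))"
    unfolding kappa_def
    using eqv specht_polytabloid[OF t] column_stabilizer_permutes n
    by (intro sum.cong refl) (auto simp: sym_group_def)
  finally show "fun_scale (of_nat (card (column_stabilizer lam t))) (\<theta> (polytabloid lam t)) = kappa lam t (\<theta> (polytabloid lam t))" .
  show "card (column_stabilizer lam t) > 0"
    using column_stabilizer_id finite_column_stabilizer card_gt_0_iff by blast
qed

lemma fun_scale_cancel: "c \<noteq> 0 \<Longrightarrow> fun_scale c f = fun_scale c g \<longleftrightarrow> f = g"
  by (auto simp: fun_scale_def fun_eq_iff)

text \<open>When a partial sum of lam falls below that of nu, the antisymmetrizer kills every
  function supported on nu-tabloids, hence the image of each polytabloid.\<close>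

lemma hom_specht_zero:
  assumes lam: "lam \<in> partitions n" and \<theta>: "lin_op \<theta>"
    and eqv: "\<And>g u. g \<in> sym_group n \<Longrightarrow> u \<in> specht_module lam \<Longrightarrow> \<theta> (perm_act g u) = perm_act g (\<theta> u)"
    and supp: "\<And>u R. u \<in> specht_module lam \<Longrightarrow> \<theta> u R \<noteq> 0 \<Longrightarrow> R \<in> tabloids nu"
    and nu: "sum_list nu = n" "sum_list (take r lam) < sum_list (take r nu)" and u: "u \<in> specht_module lam"
  shows "\<theta> u = 0"
proof -
  have "\<theta> (polytabloid lam t) = 0" if t: "t \<in> tableaux lam" for t
  proof -
    have "kappa lam t (\<theta> (polytabloid lam t)) = 0"
      using supp[OF specht_polytabloid[OF t]] nu by (intro kappa_zero_unless_dominates[OF lam t]) auto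
    then show ?thesis
      using hom_kappa[OF lam \<theta> eqv t] by (auto simp: fun_scale_def fun_eq_iff)
  qed
  moreover have "fun_space.subspace {u. \<theta> u = 0}"
    using \<theta> lin_op_sum[OF \<theta>, of _ _ "{}"] by (auto simp: fun_space.subspace_def lin_op_def)
  ultimately show ?thesis using specht_minimal[of "{u. \<theta> u = 0}" lam] u by auto
qed

text \<open>Schur's lemma without a prior proof of irreducibility: the image of one polytabloid is a
  multiple of it, and the polytabloids form one orbit.\<close>

lemma hom_specht_scalar:
  assumes lam: "lam \<in> partitions n" and \<theta>: "lin_op \<theta>"
    and eqv: "\<And>g u. g \<in> sym_group n \<Longrightarrow> u \<in> specht_module lam \<Longrightarrow> \<theta> (perm_act g u) = perm_act g (\<theta> u)"
    and supp: "\<And>u R. u \<in> specht_module lam \<Longrightarrow> \<theta> u R \<noteq> 0 \<Longrightarrow> R \<in> tabloids lam"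
  shows "\<exists>a. \<forall>u\<in>specht_module lam. \<theta> u = fun_scale a u"
proof -
  obtain t where t: "t \<in> tableaux lam" using exists_tableau by blast
  define k where "k = kappa lam t (\<theta> (polytabloid lam t)) (tabloid lam t)"
  define c :: complex where "c = of_nat (card (column_stabilizer lam t))"
  have c: "c \<noteq> 0" using hom_kappa(2)[OF lam \<theta> eqv t] by (simp add: c_def)
  define a where "a = k / c"
  have "kappa lam t (\<theta> (polytabloid lam t)) = fun_scale k (polytabloid lam t)"
    unfolding k_def by (rule kappa_multiple[OF lam t supp[OF specht_polytabloid[OF t]]])
  then have "fun_scale c (\<theta> (polytabloid lam t)) = fun_scale c (fun_scale a (polytabloid lam t))"
    using hom_kappa(1)[OF lam \<theta> eqv t] c by (simp add: c_def a_def)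
  then have at: "\<theta> (polytabloid lam t) = fun_scale a (polytabloid lam t)" using fun_scale_cancel[OF c] by blast
  have "specht_module lam \<subseteq> {u. \<theta> u = fun_scale a u}"
  proof (rule specht_minimal)
    show "fun_space.subspace {u. \<theta> u = fun_scale a u}"
      using \<theta> lin_op_sum[OF \<theta>, of _ _ "{}"]
      by (auto simp: fun_space.subspace_def lin_op_def fun_space.scale_right_distrib fun_space.scale_left_commute)
    fix t' assume "t' \<in> tableaux lam"
    then have "polytabloid lam t' \<in> (\<lambda>g. perm_act g (polytabloid lam t)) ` sym_group n"
      unfolding polytabloid_image[OF lam t, symmetric] by blast
    then obtain g where g: "g \<in> sym_group n" "polytabloid lam t' = perm_act g (polytabloid lam t)" by blast
    have "\<theta> (polytabloid lam t') = perm_act g (fun_scale a (polytabloid lam t))"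
      unfolding g(2) using eqv[OF g(1) specht_polytabloid[OF t]] at by simp
    also have "\<dots> = fun_scale a (polytabloid lam t')"
      unfolding g(2) using lin_op_perm_act[of g] by (simp add: lin_op_def)
    finally show "polytabloid lam t' \<in> {u. \<theta> u = fun_scale a u}" by simp
  qed
  then show ?thesis by blast
qed

text \<open>Group average of the rank one map sending u to u y * u0, hence equivariant. Its values
  at pivots are sums of products of matrix coefficients.\<close>

definition avg_hom :: "nat \<Rightarrow> nat set list \<Rightarrow> (nat set list \<Rightarrow> complex) \<Rightarrow> (nat set list \<Rightarrow> complex) \<Rightarrow> (nat set list \<Rightarrow> complex)" where
  "avg_hom n y u0 u = (\<Sum>g\<in>sym_group n. fun_scale (perm_act (inv g) u y) (perm_act g u0))"

lemma avg_hom_apply: "avg_hom n y u0 u z = (\<Sum>g\<in>sym_group n. perm_act (inv g) u y * perm_act g u0 z)"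
  by (simp add: avg_hom_def sum_fun_apply fun_scale_def)

lemma lin_op_avg_hom: "lin_op (avg_hom n y u0)"
  unfolding lin_op_def
  by (auto simp: avg_hom_apply fun_eq_iff perm_act_apply fun_scale_def sum.distrib sum_distrib_left algebra_simps)

lemma bij_betw_sym_group_comp:
  assumes h: "h \<in> sym_group n" shows "bij_betw (\<lambda>g. h \<circ> g) (sym_group n) (sym_group n)"
proof (rule bij_betwI[where g = "\<lambda>g. inv h \<circ> g"])
  have hp: "h permutes {..<n}" using h by (simp add: sym_group_def)
  show "inv h \<circ> (h \<circ> g) = g" for g :: "nat \<Rightarrow> nat" using permutes_inverses[OF hp] by (auto simp: fun_eq_iff)
  show "h \<circ> (inv h \<circ> g) = g" for g :: "nat \<Rightarrow> nat" using permutes_inverses[OF hp] by (auto simp: fun_eq_iff)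
qed (use sym_group_comp[OF h] sym_group_comp[OF sym_group_inv[OF h]] in auto)

lemma avg_hom_equivariant:
  assumes h: "h \<in> sym_group n"
  shows "avg_hom n y u0 (perm_act h u) = perm_act h (avg_hom n y u0 u)"
proof -
  have hp: "h permutes {..<n}" using h by (simp add: sym_group_def)
  have "avg_hom n y u0 (perm_act h u) = (\<Sum>g\<in>sym_group n. fun_scale (perm_act (inv (h \<circ> g)) (perm_act h u) y) (perm_act (h \<circ> g) u0))"
    unfolding avg_hom_def by (rule sum.reindex_bij_betw[OF bij_betw_sym_group_comp[OF h], symmetric])
  also have "\<dots> = (\<Sum>g\<in>sym_group n. fun_scale (perm_act (inv g) u y) (perm_act h (perm_act g u0)))"
  proof (intro sum.cong refl)
    fix g assume g: "g \<in> sym_group n"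
    have gp: "g permutes {..<n}" using g by (simp add: sym_group_def)
    have "inv (h \<circ> g) = inv g \<circ> inv h" using hp gp by (intro o_inv_distrib) (auto intro: permutes_bij)
    then have "perm_act (inv (h \<circ> g)) (perm_act h u) = perm_act (inv g) u"
      using sym_group_inv g h by (simp add: perm_act_comp'[of _ n] perm_act_inv[OF hp])
    then show "fun_scale (perm_act (inv (h \<circ> g)) (perm_act h u) y) (perm_act (h \<circ> g) u0) =
        fun_scale (perm_act (inv g) u y) (perm_act h (perm_act g u0))"
      using perm_act_comp'[OF h g] by simp
  qed
  also have "\<dots> = perm_act h (avg_hom n y u0 u)"
    unfolding avg_hom_def by (rule lin_op_sum[OF lin_op_perm_act, symmetric])
  finally show ?thesis .
qed

lemma avg_hom_specht:
  assumes "nu \<in> partitions n" "u0 \<in> specht_module nu" shows "avg_hom n y u0 u \<in> specht_module nu"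
  unfolding avg_hom_def using assms specht_invariant
  by (intro fun_space.subspace_sum specht_subspace fun_space.subspace_scale) auto

lemma chi_inv:
  assumes "lam \<in> partitions n" "g \<in> sym_group n" shows "chi lam (inv g) = chi lam g"
  using assms cycle_type_inv[of g n] sym_group_inv[of g n]
  by (intro chi_cycle_type[OF assms(1)]) (auto simp: sym_group_def)

text \<open>Both characters are sums of diagonal matrix coefficients. As \<open>chi\<close> is
  invariant under inversion, one factor may be taken at \<open>inv g\<close>, which is the shape of
  \<open>avg_hom\<close>.\<close>

lemma sum_chi_avg_hom:
  assumes lam: "lam \<in> partitions n" and nu: "nu \<in> partitions n"
    and Q: "pivot_basis (specht_module lam) Q w" and P: "pivot_basis (specht_module nu) P v"
  shows "of_int (\<Sum>g\<in>sym_group n. chi lam g * chi nu g) = (\<Sum>y\<in>Q. \<Sum>x\<in>P. avg_hom n y (v x) (w y) x)"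
proof -
  have "of_int (\<Sum>g\<in>sym_group n. chi lam g * chi nu g) = (\<Sum>g\<in>sym_group n. irr_character lam (inv g) * irr_character nu g)"
    unfolding of_int_sum of_int_mult
    using irr_character_chi[OF lam] irr_character_chi[OF nu] chi_inv[OF lam] sym_group_inv by (intro sum.cong) auto
  also have "\<dots> = (\<Sum>g\<in>sym_group n. \<Sum>y\<in>Q. \<Sum>x\<in>P. perm_act (inv g) (w y) y * perm_act g (v x) x)"
    using irr_character_pivot[OF lam Q] irr_character_pivot[OF nu P] sym_group_inv
    by (intro sum.cong refl) (simp add: sum_product)
  also have "\<dots> = (\<Sum>y\<in>Q. \<Sum>g\<in>sym_group n. \<Sum>x\<in>P. perm_act (inv g) (w y) y * perm_act g (v x) x)"
    by (rule sum.swap)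
  also have "\<dots> = (\<Sum>y\<in>Q. \<Sum>x\<in>P. avg_hom n y (v x) (w y) x)"
    unfolding avg_hom_apply by (intro sum.cong refl sum.swap)
  finally show ?thesis .
qed

lemma chi_orthogonal_aux:
  assumes lam: "lam \<in> partitions n" and nu: "nu \<in> partitions n"
    and less: "sum_list (take r lam) < sum_list (take r nu)"
  shows "(\<Sum>g\<in>sym_group n. chi lam g * chi nu g) = 0"
proof -
  obtain Q w where Q: "pivot_basis (specht_module lam) Q w" using specht_pivot_basis[OF lam two_is_prime_nat] by blast
  obtain P v where P: "pivot_basis (specht_module nu) P v" using specht_pivot_basis[OF nu two_is_prime_nat] by blast
  have "avg_hom n y (v x) (w y) = 0" if "y \<in> Q" "x \<in> P" for x y
  proof (rule hom_specht_zero[OF lam lin_op_avg_hom avg_hom_equivariant])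
    show "sum_list nu = n" using nu by (simp add: partitions_def)
    have vx: "v x \<in> specht_module nu" using P that by (simp add: pivot_basis_def)
    show "R \<in> tabloids nu" if "avg_hom n y (v x) u R \<noteq> 0" for u R
      using specht_support[OF nu avg_hom_specht[OF nu vx]] that by blast
    show "w y \<in> specht_module lam" using Q that by (simp add: pivot_basis_def)
  qed (use less in auto)
  then have "(\<Sum>y\<in>Q. \<Sum>x\<in>P. avg_hom n y (v x) (w y) x) = 0" by (intro sum.neutral ballI) auto
  then have "(of_int (\<Sum>g\<in>sym_group n. chi lam g * chi nu g) :: complex) = 0"
    using sum_chi_avg_hom[OF lam nu Q P] by simp
  then show ?thesis by (simp only: of_int_eq_0_iff)
qed

text \<open>Each average acts as a scalar; its trace, computed by collapsing g with its inverse, is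
  n! * v x y. So only the d diagonal pairs contribute, each n! / d.\<close>

lemma chi_norm:
  assumes lam: "lam \<in> partitions n"
  shows "(\<Sum>g\<in>sym_group n. chi lam g * chi lam g) = fact n"
proof -
  obtain P v where P: "pivot_basis (specht_module lam) P v" using specht_pivot_basis[OF lam two_is_prime_nat] by blast
  have vV: "v x \<in> specht_module lam" if "x \<in> P" for x using P that by (simp add: pivot_basis_def)
  have vd: "v x y = (if x = y then 1 else 0)" if "x \<in> P" "y \<in> P" for x y
    using P that by (simp add: pivot_basis_def)
  have fin: "finite P" using P by (simp add: pivot_basis_def)
  have ne: "P \<noteq> {}"
  proof
    assume "P = {}"
    then have z: "u R = 0" if "u \<in> specht_module lam" for u R using P that by (simp add: pivot_basis_def)
    obtain t where t: "t \<in> tableaux lam" using exists_tableau by blast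
    show False using z[OF specht_polytabloid[OF t]] polytabloid_at_tabloid[OF lam t] by simp
  qed
  define d :: complex where "d = of_nat (card P)"
  have d: "d \<noteq> 0" using fin ne by (simp add: d_def)
  have diag: "avg_hom n y (v x) (v y) x = (if x = y then fact n / d else 0)" if xy: "x \<in> P" "y \<in> P" for x y
  proof -
    have "\<exists>a. \<forall>u\<in>specht_module lam. avg_hom n y (v x) u = fun_scale a u"
      by (rule hom_specht_scalar[OF lam lin_op_avg_hom avg_hom_equivariant])
        (use specht_support[OF lam avg_hom_specht[OF lam vV[OF xy(1)]]] in blast)+
    then obtain a where a: "\<And>u. u \<in> specht_module lam \<Longrightarrow> avg_hom n y (v x) u = fun_scale a u" by blast
    have "a * d = (\<Sum>z\<in>P. avg_hom n y (v x) (v z) z)"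
      using a[OF vV] vd by (simp add: fun_scale_def d_def)
    also have "\<dots> = (\<Sum>g\<in>sym_group n. \<Sum>z\<in>P. perm_act g (v x) z * perm_act (inv g) (v z) y)"
      unfolding avg_hom_apply by (subst sum.swap) (simp add: mult.commute)
    also have "\<dots> = (\<Sum>g\<in>sym_group n. v x y)"
    proof (intro sum.cong refl)
      fix g assume g: "g \<in> sym_group n"
      have gp: "g permutes {..<n}" using g by (simp add: sym_group_def)
      have "(\<Sum>z\<in>P. perm_act g (v x) z * perm_act (inv g) (v z) y) = perm_act (inv g) (perm_act g (v x)) y"
        by (rule lin_op_pivot[OF lin_op_perm_act P specht_invariant[OF lam g vV[OF xy(1)]], symmetric])
      then show "(\<Sum>z\<in>P. perm_act g (v x) z * perm_act (inv g) (v z) y) = v x y"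
        by (simp add: perm_act_inv[OF gp])
    qed
    also have "\<dots> = fact n * (if x = y then 1 else 0)"
      using vd[OF xy] by (simp add: card_sym_group)
    finally have "a = (if x = y then fact n / d else 0)" using d by (auto simp: field_simps)
    moreover have "avg_hom n y (v x) (v y) x = a * v y x" using a[OF vV[OF xy(2)]] by (simp add: fun_scale_def)
    ultimately show ?thesis using vd[OF xy(2,1)] by auto
  qed
  have "(of_int (\<Sum>g\<in>sym_group n. chi lam g * chi lam g) :: complex) = (\<Sum>y\<in>P. \<Sum>x\<in>P. if x = y then fact n / d else 0)"
    unfolding sum_chi_avg_hom[OF lam lam P P] using diag by (intro sum.cong refl) auto
  also have "\<dots> = fact n" using fin d by (simp add: d_def)
  finally have "(of_int (\<Sum>g\<in>sym_group n. chi lam g * chi lam g) :: complex) = of_int (fact n)" by simp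
  then show ?thesis by (simp only: of_int_eq_iff)
qed

lemma list_eq_if_take_sums_eq:
  fixes xs ys :: "nat list"
  assumes "0 \<notin> set xs" "0 \<notin> set ys" "\<And>r. sum_list (take r xs) = sum_list (take r ys)"
  shows "xs = ys"
  using assms
proof (induction xs arbitrary: ys)
  case Nil
  then show ?case using Nil(3)[of 1] by (cases ys) auto
next
  case (Cons x xs)
  then obtain y ys' where ys: "ys = y # ys'" using Cons.prems(3)[of 1] by (cases ys) auto
  have "x = y" using Cons.prems(3)[of 1] ys by simp
  moreover have "sum_list (take r xs) = sum_list (take r ys')" for r
    using Cons.prems(3)[of "Suc r"] ys \<open>x = y\<close> by simp
  ultimately show ?case using Cons.IH[of ys'] Cons.prems(1,2) ys by auto
qed

text \<open>Distinct partitions differ in some partial sum, so the vanishing result applies to the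
  pair in one of the two orders, and the sum is symmetric in them.\<close>

lemma chi_orthonormal:
  assumes lam: "lam \<in> partitions n" and nu: "nu \<in> partitions n"
  shows "(\<Sum>g\<in>sym_group n. chi lam g * chi nu g) = (if lam = nu then fact n else 0)"
proof (cases "lam = nu")
  case False
  then obtain r where "sum_list (take r lam) \<noteq> sum_list (take r nu)"
    using list_eq_if_take_sums_eq[of lam nu] lam nu by (auto simp: partitions_def)
  then consider "sum_list (take r lam) < sum_list (take r nu)" | "sum_list (take r nu) < sum_list (take r lam)" by linarith
  then show ?thesis
    using chi_orthogonal_aux[OF lam nu] chi_orthogonal_aux[OF nu lam] False by cases (auto simp: mult.commute)
qed (use chi_norm[OF nu] in auto)

section \<open>Restriction to a block cycle\<close>

definition tens :: "('a \<Rightarrow> complex) \<Rightarrow> ('b \<Rightarrow> complex) \<Rightarrow> ('a \<times> 'b \<Rightarrow> complex)" where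
  "tens f g = (\<lambda>(a, b). f a * g b)"

definition pair_act :: "(nat \<Rightarrow> nat) \<Rightarrow> (nat \<Rightarrow> nat) \<Rightarrow> (nat set list \<times> nat set list \<Rightarrow> complex) \<Rightarrow> (nat set list \<times> nat set list \<Rightarrow> complex)" where
  "pair_act g h F = (\<lambda>(a, b). F (act (inv g) a, act (inv h) b))"

lemma lin_op_pair_act: "lin_op (pair_act g h)"
  by (auto simp: lin_op_def pair_act_def fun_scale_def fun_eq_iff)

lemma pair_act_tens: "pair_act g h (tens f f') = tens (perm_act g f) (perm_act h f')"
  by (auto simp: pair_act_def tens_def perm_act_apply fun_eq_iff)

lemma pair_act_comp:
  assumes "g permutes S" "g' permutes S" "h permutes S'" "h' permutes S'"
  shows "pair_act g h (pair_act g' h' F) = pair_act (g \<circ> g') (h \<circ> h') F"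
proof -
  have *: "inv (g \<circ> g') = inv g' \<circ> inv g" "inv (h \<circ> h') = inv h' \<circ> inv h"
    using assms by (auto intro!: o_inv_distrib intro: permutes_bij)
  show ?thesis unfolding pair_act_def * by (auto simp: act_comp)
qed

text \<open>N! times the projection onto the invariants of the diagonal action of S_N.\<close>

definition diag_sum :: "nat \<Rightarrow> (nat set list \<times> nat set list \<Rightarrow> complex) \<Rightarrow> (nat set list \<times> nat set list \<Rightarrow> complex)" where
  "diag_sum N F = (\<Sum>\<tau>\<in>sym_group N. pair_act \<tau> \<tau> F)"

lemma lin_op_sum_family:
  assumes "\<And>i. i \<in> A \<Longrightarrow> lin_op (T i)" shows "lin_op (\<lambda>F. \<Sum>i\<in>A. T i F)"
  using assms unfolding lin_op_def
  by (simp add: sum.distrib fun_space.scale_sum_right)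

lemma lin_op_diag_sum: "lin_op (diag_sum N)"
  unfolding diag_sum_def[abs_def] by (intro lin_op_sum_family lin_op_pair_act)

lemma subspace_vimage:
  assumes "lin_op T" "fun_space.subspace S" shows "fun_space.subspace {F. T F \<in> S}"
  using assms lin_op_sum[OF assms(1), of _ _ "{}"] unfolding fun_space.subspace_def lin_op_def by auto

lemma pair_act_diag_sum:
  assumes \<sigma>: "\<sigma> \<in> sym_group N" shows "pair_act \<sigma> \<sigma> (diag_sum N F) = diag_sum N F"
proof -
  have "pair_act \<sigma> \<sigma> (diag_sum N F) = pair_act \<sigma> \<sigma> (\<Sum>\<tau>\<in>sym_group N. fun_scale 1 (pair_act \<tau> \<tau> F))"
    by (simp add: diag_sum_def)
  also have "\<dots> = (\<Sum>\<tau>\<in>sym_group N. pair_act \<sigma> \<sigma> (pair_act \<tau> \<tau> F))"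
    by (subst lin_op_sum[OF lin_op_pair_act]) simp
  also have "\<dots> = (\<Sum>\<tau>\<in>sym_group N. pair_act (\<sigma> \<circ> \<tau>) (\<sigma> \<circ> \<tau>) F)"
    using \<sigma> by (intro sum.cong refl pair_act_comp) (auto simp: sym_group_def)
  also have "\<dots> = diag_sum N F"
    unfolding diag_sum_def by (rule sum.reindex_bij_betw[OF bij_betw_sym_group_comp[OF \<sigma>]])
  finally show ?thesis .
qed

lemma diag_sum_diag_sum: "diag_sum N (diag_sum N F) = fun_scale (fact N) (diag_sum N F)"
proof -
  have eq: "diag_sum N (diag_sum N F) = (\<Sum>\<tau>\<in>sym_group N. diag_sum N F)"
    unfolding diag_sum_def[of N "diag_sum N F"] by (intro sum.cong refl pair_act_diag_sum)
  show ?thesis unfolding eq by (rule ext, subst sum_fun_apply) (simp add: fun_scale_def card_sym_group)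
qed

lemma sym_group_mono: "N \<le> n \<Longrightarrow> sym_group N \<subseteq> sym_group n"
  unfolding sym_group_def by (auto intro: permutes_subset)

text \<open>The inner product of \<open>\<tau> \<mapsto> chi lam (c \<circ> \<tau>)\<close> with \<open>chi nu\<close> is the trace of the block cycle
  \<open>c\<close> on the invariants of \<open>S\<^sub>N\<close> in the tensor product of the two Specht modules.\<close>

lemma restricted_inner_product_int:
  assumes lam: "lam \<in> partitions n" and nu: "nu \<in> partitions N" and N: "N < n"
  shows "\<exists>k::int. (\<Sum>\<tau>\<in>sym_group N. chi lam (block_cycle N n \<circ> \<tau>) * chi nu \<tau>) = fact N * k"
proof -
  define c where "c = block_cycle N n"
  have cG: "c \<in> sym_group n" unfolding c_def sym_group_def
    by (intro CollectI permutes_subset[OF block_cycle_permutes[OF N]]) auto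
  have sub: "\<tau> \<in> sym_group n" if "\<tau> \<in> sym_group N" for \<tau> using that sym_group_mono[of N n] N by auto
  obtain P v where P: "pivot_basis (specht_module lam) P v" "\<forall>x\<in>P. \<forall>y. v x y \<in> p_integral 2"
    using specht_pivot_basis[OF lam two_is_prime_nat] by blast
  obtain Q w where Q: "pivot_basis (specht_module nu) Q w" "\<forall>x\<in>Q. \<forall>y. w x y \<in> p_integral 2"
    using specht_pivot_basis[OF nu two_is_prime_nat] by blast
  have fin: "finite P" "finite Q" using P(1) Q(1) by (auto simp: pivot_basis_def)
  have vV: "v x \<in> specht_module lam" if "x \<in> P" for x using P(1) that by (simp add: pivot_basis_def)
  have wV: "w x \<in> specht_module nu" if "x \<in> Q" for x using Q(1) that by (simp add: pivot_basis_def)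
  have vd: "v x y = (if x = y then 1 else 0)" if "x \<in> P" "y \<in> P" for x y using P(1) that by (simp add: pivot_basis_def)
  have wd: "w x y = (if x = y then 1 else 0)" if "x \<in> Q" "y \<in> Q" for x y using Q(1) that by (simp add: pivot_basis_def)
  define b where "b = (\<lambda>(x, y). tens (v x) (w y))"
  \<comment> \<open>The tensor product of the two Specht modules, realized by functions on pairs of
    tabloids.\<close>
  define Z where "Z = fun_space.span (b ` (P \<times> Q))"
  have bZ: "b q \<in> Z" if "q \<in> P \<times> Q" for q unfolding Z_def using that by (intro fun_space.span_base) auto
  have Zs: "fun_space.subspace Z" by (simp add: Z_def)
  have tZ: "tens f f' \<in> Z" if f: "f \<in> specht_module lam" "f' \<in> specht_module nu" for f f'
  proof -
    have e1: "f a = (\<Sum>x\<in>P. f x * v x a)" and e2: "f' a = (\<Sum>y\<in>Q. f' y * w y a)" for a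
      using P(1) Q(1) f unfolding pivot_basis_def by blast+
    have "tens f f' = (\<Sum>q\<in>P \<times> Q. fun_scale (f (fst q) * f' (snd q)) (b q))"
    proof (rule ext)
      fix z :: "nat set list \<times> nat set list"
      obtain a a' where z: "z = (a, a')" by (cases z)
      have "tens f f' z = f a * f' a'" by (simp add: tens_def z)
      also have "\<dots> = (\<Sum>x\<in>P. f x * v x a) * (\<Sum>y\<in>Q. f' y * w y a')"
        by (rule arg_cong2[OF e1 e2])
      also have "\<dots> = (\<Sum>q\<in>P \<times> Q. f (fst q) * f' (snd q) * b q z)"
        unfolding sum_product sum.cartesian_product
        by (intro sum.cong refl) (auto simp: b_def tens_def z)
      finally show "tens f f' z = (\<Sum>q\<in>P \<times> Q. fun_scale (f (fst q) * f' (snd q)) (b q)) z"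
        by (simp add: sum_fun_apply fun_scale_def)
    qed
    also have "\<dots> \<in> Z" by (intro fun_space.subspace_sum Zs fun_space.subspace_scale bZ)
    finally show ?thesis .
  qed
  have pZ: "pair_act g h F \<in> Z" if "g \<in> sym_group n" "h \<in> sym_group N" "F \<in> Z" for g h F
  proof -
    have "Z \<subseteq> {F. pair_act g h F \<in> Z}"
      unfolding Z_def
    proof (rule fun_space.span_minimal)
      show "b ` (P \<times> Q) \<subseteq> {F. pair_act g h F \<in> fun_space.span (b ` (P \<times> Q))}"
        using that tZ[unfolded Z_def] specht_invariant[OF lam that(1) vV] specht_invariant[OF nu that(2) wV]
        by (auto simp: b_def pair_act_tens)
    qed (intro subspace_vimage lin_op_pair_act, simp)
    then show ?thesis using that by blast
  qed
  have Zpiv: "pivot_basis Z (P \<times> Q) b"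
  proof -
    have "Z \<subseteq> {F. \<forall>z. F z = (\<Sum>q\<in>P \<times> Q. F q * b q z)}"
      unfolding Z_def
    proof (rule fun_space.span_minimal)
      show "b ` (P \<times> Q) \<subseteq> {F. \<forall>z. F z = (\<Sum>q\<in>P \<times> Q. F q * b q z)}"
      proof (intro subsetI CollectI allI)
        fix F z assume "F \<in> b ` (P \<times> Q)"
        then obtain q0 where q0: "q0 \<in> P \<times> Q" "F = b q0" by blast
        have "(\<Sum>q\<in>P \<times> Q. F q * b q z) = (\<Sum>q\<in>P \<times> Q. if q = q0 then b q0 z else 0)"
          using q0 by (intro sum.cong refl) (auto simp: b_def tens_def vd wd split: if_splits)
        also have "\<dots> = F z" using q0 fin by simp
        finally show "F z = (\<Sum>q\<in>P \<times> Q. F q * b q z)" ..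
      qed
    qed (rule subspace_pivot_expansion)
    moreover have "b q q' = (if q = q' then 1 else 0)" if "q \<in> P \<times> Q" "q' \<in> P \<times> Q" for q q'
      using that vd wd by (auto simp: b_def tens_def split: if_splits)
    ultimately show ?thesis unfolding pivot_basis_def using fin bZ by blast
  qed
  \<comment> \<open>The S_N-invariants in \<open>Z\<close>, generated by the symmetrized basis
    tensors.\<close>
  define U where "U = fun_space.span (diag_sum N ` b ` (P \<times> Q))"
  have Us: "fun_space.subspace U" by (simp add: U_def)
  have dU: "diag_sum N F \<in> U" if "F \<in> Z" for F
  proof -
    have "Z \<subseteq> {F. diag_sum N F \<in> U}"
      unfolding Z_def
      by (rule fun_space.span_minimal) (auto simp: U_def intro: fun_space.span_base intro!: subspace_vimage lin_op_diag_sum)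
    then show ?thesis using that by blast
  qed
  have dZ: "diag_sum N F \<in> Z" if "F \<in> Z" for F
    unfolding diag_sum_def using that sub by (intro fun_space.subspace_sum Zs pZ) auto
  have UZ: "U \<subseteq> Z"
    unfolding U_def using dZ bZ by (intro fun_space.span_minimal Zs) auto
  have idem: "diag_sum N u = fun_scale (fact N) u" if "u \<in> U" for u
  proof -
    have "U \<subseteq> {u. diag_sum N u = fun_scale (fact N) u}"
      unfolding U_def
    proof (rule fun_space.span_minimal)
      show "fun_space.subspace {u. diag_sum N u = fun_scale (fact N) u}"
        using lin_op_diag_sum[of N] lin_op_sum[OF lin_op_diag_sum, of N _ _ "{}"]
        by (auto simp: fun_space.subspace_def lin_op_def fun_space.scale_right_distrib fun_space.scale_left_commute)
    qed (auto simp: diag_sum_diag_sum)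
    then show ?thesis using that by blast
  qed
  \<comment> \<open>On \<open>Z\<close> the trace of \<open>T\<close> is the sum in question; on
    \<open>U\<close> it is N! times the trace of c. Since \<open>T\<close> maps \<open>Z\<close>
    into \<open>U\<close>, the two coincide.\<close>
  define T where "T = (\<lambda>F. pair_act c id (diag_sum N F))"
  have Tlin: "lin_op T" unfolding T_def using lin_op_pair_act[of c id] lin_op_diag_sum[of N] by (simp add: lin_op_def)
  have Tsum: "T F = (\<Sum>\<tau>\<in>sym_group N. pair_act (c \<circ> \<tau>) \<tau> F)" for F
  proof -
    have "T F = pair_act c id (\<Sum>\<tau>\<in>sym_group N. fun_scale 1 (pair_act \<tau> \<tau> F))"
      by (simp add: T_def diag_sum_def)
    also have "\<dots> = (\<Sum>\<tau>\<in>sym_group N. pair_act c id (pair_act \<tau> \<tau> F))"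
      by (subst lin_op_sum[OF lin_op_pair_act]) simp
    also have "\<dots> = (\<Sum>\<tau>\<in>sym_group N. pair_act (c \<circ> \<tau>) \<tau> F)"
    proof (intro sum.cong refl)
      fix \<tau> assume \<tau>: "\<tau> \<in> sym_group N"
      have "pair_act c id (pair_act \<tau> \<tau> F) = pair_act (c \<circ> \<tau>) (id \<circ> \<tau>) F"
        using cG \<tau> sub[OF \<tau>] by (intro pair_act_comp[of _ "{..<n}" _ _ "{..<N}"]) (auto simp: sym_group_def)
      then show "pair_act c id (pair_act \<tau> \<tau> F) = pair_act (c \<circ> \<tau>) \<tau> F" by simp
    qed
    finally show ?thesis .
  qed
  \<comment> \<open>c commutes with S_N, so the symmetrization may be performed last.\<close>
  have TU: "T F \<in> U" if "F \<in> Z" for F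
  proof -
    have "diag_sum N (pair_act c id F) = (\<Sum>\<tau>\<in>sym_group N. pair_act (c \<circ> \<tau>) \<tau> F)"
      unfolding diag_sum_def
    proof (intro sum.cong refl)
      fix \<tau> assume \<tau>: "\<tau> \<in> sym_group N"
      have "pair_act \<tau> \<tau> (pair_act c id F) = pair_act (\<tau> \<circ> c) (\<tau> \<circ> id) F"
        using cG \<tau> sub[OF \<tau>] by (intro pair_act_comp[of _ "{..<n}" _ _ "{..<N}"]) (auto simp: sym_group_def)
      then show "pair_act \<tau> \<tau> (pair_act c id F) = pair_act (c \<circ> \<tau>) \<tau> F"
        using block_cycle_commute[OF N, of \<tau>] \<tau> by (simp add: c_def sym_group_def)
    qed
    then have "T F = diag_sum N (pair_act c id F)" by (simp add: Tsum)
    moreover have "pair_act c id F \<in> Z" using that cG by (intro pZ) (auto simp: sym_group_def)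
    ultimately show ?thesis using dU by simp
  qed
  have trZ: "(\<Sum>q\<in>P \<times> Q. T (b q) q) = of_int (\<Sum>\<tau>\<in>sym_group N. chi lam (c \<circ> \<tau>) * chi nu \<tau>)"
  proof -
    have "(\<Sum>q\<in>P \<times> Q. T (b q) q) = (\<Sum>\<tau>\<in>sym_group N. \<Sum>q\<in>P \<times> Q. pair_act (c \<circ> \<tau>) \<tau> (b q) q)"
      unfolding Tsum sum_fun_apply by (rule sum.swap)
    also have "\<dots> = (\<Sum>\<tau>\<in>sym_group N. irr_character lam (c \<circ> \<tau>) * irr_character nu \<tau>)"
    proof (intro sum.cong refl)
      fix \<tau> assume \<tau>: "\<tau> \<in> sym_group N"
      have ct: "c \<circ> \<tau> \<in> sym_group n" by (rule sym_group_comp[OF cG sub[OF \<tau>]])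
      show "(\<Sum>q\<in>P \<times> Q. pair_act (c \<circ> \<tau>) \<tau> (b q) q) = irr_character lam (c \<circ> \<tau>) * irr_character nu \<tau>"
        unfolding irr_character_pivot[OF lam P(1) ct] irr_character_pivot[OF nu Q(1) \<tau>] sum_product sum.cartesian_product
        by (intro sum.cong refl) (auto simp: b_def pair_act_tens, simp add: tens_def)
    qed
    also have "\<dots> = of_int (\<Sum>\<tau>\<in>sym_group N. chi lam (c \<circ> \<tau>) * chi nu \<tau>)"
      unfolding of_int_sum of_int_mult
      using irr_character_chi[OF lam] irr_character_chi[OF nu] sym_group_comp[OF cG sub] by (intro sum.cong) auto
    finally show ?thesis .
  qed
  define S :: complex where "S = of_int (\<Sum>\<tau>\<in>sym_group N. chi lam (c \<circ> \<tau>) * chi nu \<tau>)"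
  have "S / fact N \<in> \<int>"
  proof (rule Ints_if_p_integral)
    \<comment> \<open>\<open>P\<close> and \<open>Q\<close> supply rational generators of
      \<open>U\<close>; its echelon basis is chosen anew at each prime, which makes the trace of c
      on \<open>U\<close> integral there.\<close>
    fix p :: nat assume p: "prime p"
    have "\<exists>P' u. P' \<subseteq> tabloids lam \<times> tabloids nu \<and> pivot_basis U P' u \<and> (\<forall>x\<in>P'. \<forall>y. u x y \<in> p_integral p)"
      unfolding U_def
    proof (rule exists_pivot_basis[OF p])
      show "finite (tabloids lam \<times> tabloids nu)" by (simp add: finite_tabloids)
      show "finite (diag_sum N ` b ` (P \<times> Q))" using fin by simp
      show "f z \<in> \<rat>" if "f \<in> diag_sum N ` b ` (P \<times> Q)" for f z
        using that P(2) Q(2) p_integral_Rats[OF two_is_prime_nat]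
        by (auto simp: diag_sum_def sum_fun_apply b_def pair_act_def tens_def split: prod.splits intro!: Rats_sum Rats_mult)
      show "f z = 0" if fz: "f \<in> diag_sum N ` b ` (P \<times> Q)" "z \<notin> tabloids lam \<times> tabloids nu" for f z
      proof -
        obtain q where q: "q \<in> P \<times> Q" "f = diag_sum N (b q)" using fz(1) by blast
        obtain x y where xy: "q = (x, y)" "x \<in> P" "y \<in> Q" using q by (cases q) auto
        obtain a a' where z: "z = (a, a')" by (cases z)
        have "pair_act \<tau> \<tau> (b q) z = 0" if \<tau>: "\<tau> \<in> sym_group N" for \<tau>
        proof -
          have "perm_act \<tau> (v x) a = 0 \<or> perm_act \<tau> (w y) a' = 0"
            using fz(2) z
              specht_support[OF lam specht_invariant[OF lam sub[OF \<tau>] vV[OF xy(2)]]]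
              specht_support[OF nu specht_invariant[OF nu \<tau> wV[OF xy(3)]]] by blast
          moreover have "pair_act \<tau> \<tau> (b q) z = perm_act \<tau> (v x) a * perm_act \<tau> (w y) a'"
            by (simp add: b_def xy(1) pair_act_tens z) (simp add: tens_def)
          ultimately show ?thesis by auto
        qed
        then show ?thesis unfolding q(2) diag_sum_def sum_fun_apply by (intro sum.neutral ballI) auto
      qed
    qed
    then obtain P' u where u: "pivot_basis U P' u" "\<forall>x\<in>P'. \<forall>y. u x y \<in> p_integral p" by blast
    have uU: "u q \<in> U" if "q \<in> P'" for q using u(1) that by (simp add: pivot_basis_def)
    have "S = (\<Sum>q\<in>P'. T (u q) q)"
      unfolding S_def trZ[symmetric] by (rule pivot_trace_subspace[OF Tlin Zpiv u(1) UZ TU])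
    also have "\<dots> = (\<Sum>q\<in>P'. fact N * pair_act c id (u q) q)"
    proof (intro sum.cong refl)
      fix q assume "q \<in> P'"
      have "T (u q) = fun_scale (fact N) (pair_act c id (u q))"
        unfolding T_def idem[OF uU[OF \<open>q \<in> P'\<close>]] using lin_op_pair_act[of c id] by (simp add: lin_op_def)
      then show "T (u q) q = fact N * pair_act c id (u q) q" by (simp add: fun_scale_def)
    qed
    finally have "S / fact N = (\<Sum>q\<in>P'. pair_act c id (u q) q)" by (simp add: sum_distrib_left[symmetric])
    then show "S / fact N \<in> p_integral p"
      using u(2) by (auto simp: pair_act_def split: prod.splits intro!: p_integral_sum[OF p])
  qed
  then obtain k where "S / fact N = of_int k" by (auto elim: Ints_cases)
  then have "S = of_int (fact N * k)" by (simp add: field_simps)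
  then have "(\<Sum>\<tau>\<in>sym_group N. chi lam (c \<circ> \<tau>) * chi nu \<tau>) = fact N * k" unfolding S_def by (simp only: of_int_eq_iff)
  then show ?thesis unfolding c_def by blast
qed

section \<open>Column orthogonality and completeness\<close>

lemma cyc_class_nonempty: "M \<in> mset_partitions n \<Longrightarrow> card (cyc_class n M) > 0"
  using exists_cycle_type[of M n] finite_cyc_class[of n M]
  by (auto simp: cyc_class_def sym_group_def card_gt_0_iff)

lemma sum_over_classes:
  fixes \<phi> :: "nat multiset \<Rightarrow> real"
  shows "(\<Sum>g\<in>sym_group n. \<phi> (cycle_type n g) / real (card (cyc_class n (cycle_type n g)))) = (\<Sum>M\<in>mset_partitions n. \<phi> M)"
proof -
  have "(\<Sum>g\<in>sym_group n. \<phi> (cycle_type n g) / real (card (cyc_class n (cycle_type n g)))) =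
      (\<Sum>M\<in>mset_partitions n. \<Sum>g\<in>{g \<in> sym_group n. cycle_type n g = M}. \<phi> (cycle_type n g) / real (card (cyc_class n (cycle_type n g))))"
    by (rule sum.group[symmetric, OF finite_sym_group finite_mset_partitions])
      (auto simp: sym_group_def intro: cycle_type_mset_partitions)
  also have "\<dots> = (\<Sum>M\<in>mset_partitions n. \<Sum>g\<in>cyc_class n M. \<phi> M / real (card (cyc_class n M)))"
    by (intro sum.cong) (auto simp: cyc_class_def)
  also have "\<dots> = (\<Sum>M\<in>mset_partitions n. \<phi> M)"
  proof (intro sum.cong refl)
    fix M assume "M \<in> mset_partitions n"
    then have "real (card (cyc_class n M)) \<noteq> 0" using cyc_class_nonempty[of M n] by simp
    then show "(\<Sum>g\<in>cyc_class n M. \<phi> M / real (card (cyc_class n M))) = \<phi> M"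
      by simp
  qed
  finally show ?thesis .
qed

lemma chi_orthonormal_real:
  assumes "lam \<in> partitions n" "nu \<in> partitions n"
  shows "(\<Sum>g\<in>sym_group n. real_of_int (chi lam g) * real_of_int (chi nu g)) = (if lam = nu then fact n else 0)"
proof -
  have "(\<Sum>g\<in>sym_group n. real_of_int (chi lam g) * real_of_int (chi nu g)) = real_of_int (\<Sum>g\<in>sym_group n. chi lam g * chi nu g)"
    by simp
  also have "\<dots> = (if lam = nu then fact n else 0)" unfolding chi_orthonormal[OF assms] by simp
  finally show ?thesis .
qed

text \<open>Bessel's inequality for the indicator function of a conjugacy class; summed over all classes it
  becomes an equality because there are as many classes as irreducible characters.\<close>

lemma chi_class_residual:
  assumes g: "g \<in> sym_group n"
  defines "s \<equiv> real (card (cyc_class n (cycle_type n g)))"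
  shows "(\<Sum>h\<in>sym_group n. ((if cycle_type n h = cycle_type n g then 1 else 0)
      - (\<Sum>nu\<in>partitions n. s / fact n * real_of_int (chi nu g) * real_of_int (chi nu h))) ^ 2)
    = s - s ^ 2 / fact n * (\<Sum>nu\<in>partitions n. real_of_int (chi nu g) ^ 2)"
proof -
  define a where "a = (\<lambda>nu. s / fact n * real_of_int (chi nu g))"
  define \<delta> where "\<delta> = (\<lambda>h. if cycle_type n h = cycle_type n g then 1 else (0::real))"
  define X where "X = (\<lambda>nu h. real_of_int (chi nu h))"
  define E where "E = (\<lambda>h. \<Sum>nu\<in>partitions n. a nu * X nu h)"
  have s1: "(\<Sum>h\<in>sym_group n. \<delta> h * \<delta> h) = s"
  proof -
    have "(\<Sum>h\<in>sym_group n. \<delta> h * \<delta> h) = (\<Sum>h\<in>sym_group n. if cycle_type n h = cycle_type n g then 1 else 0)"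
      by (intro sum.cong) (auto simp: \<delta>_def)
    also have "\<dots> = s" using finite_sym_group[of n] by (simp add: sum.If_cases s_def cyc_class_def Int_def)
    finally show ?thesis .
  qed
  have dX: "(\<Sum>h\<in>sym_group n. \<delta> h * X nu h) = s * X nu g" if "nu \<in> partitions n" for nu
  proof -
    have "(\<Sum>h\<in>sym_group n. \<delta> h * X nu h) = (\<Sum>h\<in>sym_group n. \<delta> h * \<delta> h * X nu g)"
    proof (intro sum.cong refl)
      fix h assume h: "h \<in> sym_group n"
      show "\<delta> h * X nu h = \<delta> h * \<delta> h * X nu g"
        using chi_cycle_type[OF that h g] by (simp add: \<delta>_def X_def)
    qed
    then show ?thesis by (simp add: sum_distrib_right[symmetric] s1)
  qed
  have dE: "(\<Sum>h\<in>sym_group n. \<delta> h * E h) = (\<Sum>nu\<in>partitions n. a nu * (s * X nu g))"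
  proof -
    have "(\<Sum>h\<in>sym_group n. \<delta> h * E h) = (\<Sum>h\<in>sym_group n. \<Sum>nu\<in>partitions n. a nu * (\<delta> h * X nu h))"
      by (simp add: E_def sum_distrib_left mult.left_commute)
    also have "\<dots> = (\<Sum>nu\<in>partitions n. \<Sum>h\<in>sym_group n. a nu * (\<delta> h * X nu h))" by (rule sum.swap)
    also have "\<dots> = (\<Sum>nu\<in>partitions n. a nu * (s * X nu g))"
      using dX by (simp add: sum_distrib_left[symmetric])
    finally show ?thesis .
  qed
  have EE: "(\<Sum>h\<in>sym_group n. E h * E h) = (\<Sum>nu\<in>partitions n. a nu * a nu * fact n)"
  proof -
    have "(\<Sum>h\<in>sym_group n. E h * E h) = (\<Sum>h\<in>sym_group n. \<Sum>nu\<in>partitions n. \<Sum>mu\<in>partitions n. a nu * a mu * (X nu h * X mu h))"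
      unfolding E_def sum_product by (intro sum.cong refl) (simp add: mult_ac)
    also have "\<dots> = (\<Sum>nu\<in>partitions n. \<Sum>h\<in>sym_group n. \<Sum>mu\<in>partitions n. a nu * a mu * (X nu h * X mu h))"
      by (rule sum.swap)
    also have "\<dots> = (\<Sum>nu\<in>partitions n. \<Sum>mu\<in>partitions n. \<Sum>h\<in>sym_group n. a nu * a mu * (X nu h * X mu h))"
      by (intro sum.cong refl sum.swap)
    also have "\<dots> = (\<Sum>nu\<in>partitions n. \<Sum>mu\<in>partitions n. if mu = nu then a nu * a nu * fact n else 0)"
      unfolding sum_distrib_left[symmetric] X_def
      by (intro sum.cong refl) (simp add: chi_orthonormal_real)
    also have "\<dots> = (\<Sum>nu\<in>partitions n. a nu * a nu * fact n)" using finite_partitions[of n] by simp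
    finally show ?thesis .
  qed
  have "(\<Sum>h\<in>sym_group n. (\<delta> h - E h) ^ 2) = (\<Sum>h\<in>sym_group n. \<delta> h * \<delta> h) - 2 * (\<Sum>h\<in>sym_group n. \<delta> h * E h) + (\<Sum>h\<in>sym_group n. E h * E h)"
    by (simp add: power2_eq_square algebra_simps sum.distrib sum_subtractf sum_distrib_left)
  also have "\<dots> = s - 2 * (\<Sum>nu\<in>partitions n. a nu * (s * X nu g)) + (\<Sum>nu\<in>partitions n. a nu * a nu * fact n)"
    unfolding s1 dE EE ..
  also have "(\<Sum>nu\<in>partitions n. a nu * (s * X nu g)) = s ^ 2 / fact n * (\<Sum>nu\<in>partitions n. X nu g ^ 2)"
    by (simp add: a_def X_def sum_distrib_left power2_eq_square mult_ac)
  also have "(\<Sum>nu\<in>partitions n. a nu * a nu * fact n) = s ^ 2 / fact n * (\<Sum>nu\<in>partitions n. X nu g ^ 2)"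
    by (simp add: a_def X_def sum_distrib_left power2_eq_square mult_ac)
  finally show ?thesis by (simp add: \<delta>_def E_def a_def X_def)
qed

lemma chi_column_norm:
  assumes g: "g \<in> sym_group n"
  shows "(\<Sum>nu\<in>partitions n. real_of_int (chi nu g) ^ 2) = fact n / real (card (cyc_class n (cycle_type n g)))"
proof -
  define S where "S = (\<lambda>g. real (card (cyc_class n (cycle_type n g))))"
  define b where "b = (\<lambda>g. \<Sum>nu\<in>partitions n. real_of_int (chi nu g) ^ 2)"
  have S: "S h > 0" if "h \<in> sym_group n" for h
    using cyc_class_nonempty[OF cycle_type_mset_partitions[of h n]] that by (simp add: S_def sym_group_def)
  have le: "b h \<le> fact n / S h" if h: "h \<in> sym_group n" for h
  proof -
    have "0 \<le> S h - (S h) ^ 2 / fact n * b h"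
      unfolding S_def b_def chi_class_residual[OF h, symmetric] by (intro sum_nonneg) simp
    then have "S h * (S h * b h) \<le> S h * fact n" by (simp add: field_simps power2_eq_square)
    then have "S h * b h \<le> fact n" using S[OF h] by simp
    then show ?thesis using S[OF h] by (simp add: field_simps)
  qed
  have "(\<Sum>h\<in>sym_group n. b h) = (\<Sum>nu\<in>partitions n. \<Sum>h\<in>sym_group n. real_of_int (chi nu h) * real_of_int (chi nu h))"
    unfolding b_def power2_eq_square by (rule sum.swap)
  also have "\<dots> = (\<Sum>nu\<in>partitions n. fact n)" by (intro sum.cong refl) (simp add: chi_orthonormal_real)
  also have "\<dots> = fact n * real (num_partitions n)" by (simp add: card_partitions)
  also have "\<dots> = (\<Sum>M\<in>mset_partitions n. fact n)" by (simp add: num_partitions_def)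
  also have "\<dots> = (\<Sum>h\<in>sym_group n. fact n / S h)"
    unfolding S_def by (rule sum_over_classes[symmetric])
  finally have eq: "(\<Sum>h\<in>sym_group n. b h) = (\<Sum>h\<in>sym_group n. fact n / S h)" .
  have "b g = fact n / S g"
  proof (rule ccontr)
    assume "b g \<noteq> fact n / S g"
    then have "b g < fact n / S g" using le[OF g] by simp
    then have "(\<Sum>h\<in>sym_group n. b h) < (\<Sum>h\<in>sym_group n. fact n / S h)"
      using g le by (intro sum_strict_mono_ex1 finite_sym_group) auto
    with eq show False by simp
  qed
  then show ?thesis by (simp add: b_def S_def)
qed

text \<open>With the column norm the Bessel residual is zero, so the class indicator equals its
  character expansion at every point.\<close>

lemma chi_column_orthogonality:
  assumes g: "g \<in> sym_group n" and h: "h \<in> sym_group n"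
  shows "(\<Sum>nu\<in>partitions n. real_of_int (chi nu g) * real_of_int (chi nu h)) =
    (if cycle_type n h = cycle_type n g then fact n / real (card (cyc_class n (cycle_type n g))) else 0)"
proof -
  define s where "s = real (card (cyc_class n (cycle_type n g)))"
  have s: "s > 0"
    using cyc_class_nonempty[OF cycle_type_mset_partitions[of g n]] g by (simp add: s_def sym_group_def)
  have "s - s ^ 2 / fact n * (\<Sum>nu\<in>partitions n. real_of_int (chi nu g) ^ 2) = 0"
    unfolding chi_column_norm[OF g] using s by (simp add: s_def[symmetric] power2_eq_square)
  then have z: "(\<Sum>h\<in>sym_group n. ((if cycle_type n h = cycle_type n g then 1 else 0)
      - (\<Sum>nu\<in>partitions n. s / fact n * real_of_int (chi nu g) * real_of_int (chi nu h))) ^ 2) = 0"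
    using chi_class_residual[OF g] unfolding s_def by simp
  have "((if cycle_type n h = cycle_type n g then 1 else 0)
      - (\<Sum>nu\<in>partitions n. s / fact n * real_of_int (chi nu g) * real_of_int (chi nu h))) ^ 2 = 0"
    using z h by (subst (asm) sum_nonneg_eq_0_iff[OF finite_sym_group]) auto
  then have "(if cycle_type n h = cycle_type n g then 1 else 0) =
      s / fact n * (\<Sum>nu\<in>partitions n. real_of_int (chi nu g) * real_of_int (chi nu h))"
    by (simp add: sum_distrib_left mult.assoc)
  then show ?thesis using s unfolding s_def[symmetric] by (auto simp: field_simps split: if_splits)
qed

text \<open>Completeness of the characters among class functions, in Parseval form: after expanding
  the square, column orthogonality leaves only pairs within one class.\<close>

lemma class_function_parseval:
  fixes f :: "(nat \<Rightarrow> nat) \<Rightarrow> real"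
  assumes f: "\<And>g h. g \<in> sym_group n \<Longrightarrow> h \<in> sym_group n \<Longrightarrow> cycle_type n g = cycle_type n h \<Longrightarrow> f g = f h"
  shows "(\<Sum>nu\<in>partitions n. (\<Sum>g\<in>sym_group n. f g * real_of_int (chi nu g)) ^ 2) = fact n * (\<Sum>g\<in>sym_group n. f g ^ 2)"
proof -
  have "(\<Sum>nu\<in>partitions n. (\<Sum>g\<in>sym_group n. f g * real_of_int (chi nu g)) ^ 2) =
      (\<Sum>nu\<in>partitions n. \<Sum>g\<in>sym_group n. \<Sum>h\<in>sym_group n. f g * f h * (real_of_int (chi nu g) * real_of_int (chi nu h)))"
    unfolding power2_eq_square sum_product by (intro sum.cong refl) (simp add: mult_ac)
  also have "\<dots> = (\<Sum>g\<in>sym_group n. \<Sum>nu\<in>partitions n. \<Sum>h\<in>sym_group n. f g * f h * (real_of_int (chi nu g) * real_of_int (chi nu h)))"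
    by (rule sum.swap)
  also have "\<dots> = (\<Sum>g\<in>sym_group n. \<Sum>h\<in>sym_group n. \<Sum>nu\<in>partitions n. f g * f h * (real_of_int (chi nu g) * real_of_int (chi nu h)))"
    by (intro sum.cong refl sum.swap)
  also have "\<dots> = (\<Sum>g\<in>sym_group n. fact n * f g ^ 2)"
  proof (intro sum.cong refl)
    fix g assume g: "g \<in> sym_group n"
    define s where "s = real (card (cyc_class n (cycle_type n g)))"
    have s: "s > 0"
      using cyc_class_nonempty[OF cycle_type_mset_partitions[of g n]] g by (simp add: s_def sym_group_def)
    have "(\<Sum>h\<in>sym_group n. \<Sum>nu\<in>partitions n. f g * f h * (real_of_int (chi nu g) * real_of_int (chi nu h))) =
        (\<Sum>h\<in>sym_group n. if cycle_type n h = cycle_type n g then f g ^ 2 * (fact n / s) else 0)"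
      unfolding sum_distrib_left[symmetric] s_def
      using f[OF _ g] by (intro sum.cong refl) (simp add: chi_column_orthogonality[OF g] power2_eq_square)
    also have "\<dots> = s * (f g ^ 2 * (fact n / s))"
      using finite_sym_group[of n] by (simp add: sum.If_cases s_def cyc_class_def Int_def)
    finally show "(\<Sum>h\<in>sym_group n. \<Sum>nu\<in>partitions n. f g * f h * (real_of_int (chi nu g) * real_of_int (chi nu h))) = fact n * f g ^ 2"
      using s by simp
  qed
  finally show ?thesis by (simp add: sum_distrib_left)
qed

text \<open>The Fourier coefficients are integers, so the normalized squared norm is a sum of
  integer squares and, unless 0, at least 1.\<close>

lemma restricted_norm_ge:
  assumes lam: "lam \<in> partitions n" and N: "N < n"
    and nz: "\<exists>\<tau>\<in>sym_group N. chi lam (block_cycle N n \<circ> \<tau>) \<noteq> 0"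
  shows "(\<Sum>\<tau>\<in>sym_group N. real_of_int (chi lam (block_cycle N n \<circ> \<tau>)) ^ 2) \<ge> fact N"
proof -
  define f where "f = (\<lambda>\<tau>. real_of_int (chi lam (block_cycle N n \<circ> \<tau>)))"
  have G: "block_cycle N n \<circ> \<tau> \<in> sym_group n" if "\<tau> \<in> sym_group N" for \<tau>
    using block_cycle_comp_permutes[OF N] that by (simp add: sym_group_def)
  have cls: "f g = f h" if "g \<in> sym_group N" "h \<in> sym_group N" "cycle_type N g = cycle_type N h" for g h
  proof -
    have "cycle_type n (block_cycle N n \<circ> g) = cycle_type n (block_cycle N n \<circ> h)"
      using that cycle_type_block_cycle[OF N] by (simp add: sym_group_def)
    then show ?thesis unfolding f_def using chi_cycle_type[OF lam G[OF that(1)] G[OF that(2)]] by simp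
  qed
  define k :: "nat list \<Rightarrow> int" where
    "k = (\<lambda>nu. SOME k. (\<Sum>\<tau>\<in>sym_group N. chi lam (block_cycle N n \<circ> \<tau>) * chi nu \<tau>) = fact N * k)"
  have k: "(\<Sum>\<tau>\<in>sym_group N. chi lam (block_cycle N n \<circ> \<tau>) * chi nu \<tau>) = fact N * k nu" if "nu \<in> partitions N" for nu
    unfolding k_def by (rule someI_ex[OF restricted_inner_product_int[OF lam that N]])
  have kr: "(\<Sum>\<tau>\<in>sym_group N. f \<tau> * real_of_int (chi nu \<tau>)) = fact N * real_of_int (k nu)" if "nu \<in> partitions N" for nu
    using arg_cong[OF k[OF that], of real_of_int] by (simp add: f_def)
  define K where "K = (\<Sum>nu\<in>partitions N. (k nu) ^ 2)"
  have "fact N * (\<Sum>\<tau>\<in>sym_group N. f \<tau> ^ 2) = (\<Sum>nu\<in>partitions N. (\<Sum>\<tau>\<in>sym_group N. f \<tau> * real_of_int (chi nu \<tau>)) ^ 2)"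
    by (rule class_function_parseval[OF cls, symmetric])
  also have "\<dots> = (\<Sum>nu\<in>partitions N. fact N * (fact N * real_of_int (k nu ^ 2)))"
    by (intro sum.cong refl, subst kr) (auto simp: power2_eq_square)
  also have "\<dots> = fact N * (fact N * real_of_int K)"
    unfolding K_def of_int_sum sum_distrib_left ..
  finally have eq: "(\<Sum>\<tau>\<in>sym_group N. f \<tau> ^ 2) = fact N * real_of_int K" by simp
  have "(\<Sum>\<tau>\<in>sym_group N. f \<tau> ^ 2) > 0"
  proof -
    obtain \<tau> where "\<tau> \<in> sym_group N" "f \<tau> \<noteq> 0" using nz by (auto simp: f_def)
    then show ?thesis by (intro sum_pos2[OF finite_sym_group, of \<tau>]) auto
  qed
  then have "K > 0" unfolding eq by (simp add: zero_less_mult_iff)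
  then have "fact N * 1 \<le> fact N * real_of_int K" by (intro mult_left_mono) auto
  then show ?thesis using eq by (simp add: f_def)
qed

text \<open>Each nonvanishing row uses up at least N! of the total squared norm. Columnwise that
  total consists of centralizer orders n! / class size, which exceed those in S_N by at most the
  factor t * (multiplicity + 1), t = n - N.\<close>

lemma card_nonvanishing:
  assumes N: "N < n"
  shows "real (card {lam \<in> partitions n. \<exists>\<tau>\<in>sym_group N. chi lam (block_cycle N n \<circ> \<tau>) \<noteq> 0})
    \<le> (\<Sum>M\<in>mset_partitions N. real ((n - N) * (count M (n - N) + 1)))"
proof -
  define L where "L = {lam \<in> partitions n. \<exists>\<tau>\<in>sym_group N. chi lam (block_cycle N n \<circ> \<tau>) \<noteq> 0}"
  define t where "t = n - N"
  have G: "block_cycle N n \<circ> \<tau> \<in> sym_group n" if "\<tau> \<in> sym_group N" for \<tau>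
    using block_cycle_comp_permutes[OF N] that by (simp add: sym_group_def)
  have "fact N * real (card L) = (\<Sum>lam\<in>L. fact N)" by simp
  also have "\<dots> \<le> (\<Sum>lam\<in>L. \<Sum>\<tau>\<in>sym_group N. real_of_int (chi lam (block_cycle N n \<circ> \<tau>)) ^ 2)"
    by (intro sum_mono restricted_norm_ge[OF _ N]) (auto simp: L_def)
  also have "\<dots> \<le> (\<Sum>lam\<in>partitions n. \<Sum>\<tau>\<in>sym_group N. real_of_int (chi lam (block_cycle N n \<circ> \<tau>)) ^ 2)"
    by (intro sum_mono2 finite_partitions) (auto simp: L_def intro: sum_nonneg)
  also have "\<dots> = (\<Sum>\<tau>\<in>sym_group N. \<Sum>lam\<in>partitions n. real_of_int (chi lam (block_cycle N n \<circ> \<tau>)) ^ 2)"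
    by (rule sum.swap)
  also have "\<dots> \<le> (\<Sum>\<tau>\<in>sym_group N. (fact N * real (t * (count (cycle_type N \<tau>) t + 1))) / real (card (cyc_class N (cycle_type N \<tau>))))"
  proof (intro sum_mono)
    fix \<tau> assume \<tau>: "\<tau> \<in> sym_group N"
    then have tp: "\<tau> permutes {..<N}" by (simp add: sym_group_def)
    define A where "A = card (cyc_class n (cycle_type n (block_cycle N n \<circ> \<tau>)))"
    define B where "B = card (cyc_class N (cycle_type N \<tau>))"
    have A: "A > 0"
      using cyc_class_nonempty[OF cycle_type_mset_partitions] G[OF \<tau>] by (simp add: A_def sym_group_def)
    have B: "B > 0"
      using cyc_class_nonempty[OF cycle_type_mset_partitions] tp by (simp add: B_def)
    have "fact n * B \<le> fact N * (A * (t * (count (cycle_type N \<tau>) t + 1)))"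
      using card_cyc_class_block_cycle[OF N tp] by (simp add: A_def B_def t_def)
    then have "real (fact n * B) \<le> real (fact N * (A * (t * (count (cycle_type N \<tau>) t + 1))))"
      by (simp only: of_nat_le_iff)
    then have "fact n * real B \<le> (fact N * real (t * (count (cycle_type N \<tau>) t + 1))) * real A"
      by (simp only: of_nat_mult of_nat_fact mult_ac)
    then have "fact n / real A \<le> (fact N * real (t * (count (cycle_type N \<tau>) t + 1))) / real B"
      using A B by (simp only: divide_le_eq le_divide_eq of_nat_0_less_iff mult.commute times_divide_eq_left if_True) (simp add: field_simps)
    then show "(\<Sum>lam\<in>partitions n. real_of_int (chi lam (block_cycle N n \<circ> \<tau>)) ^ 2) \<le>
        (fact N * real (t * (count (cycle_type N \<tau>) t + 1))) / real (card (cyc_class N (cycle_type N \<tau>)))"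
      unfolding chi_column_norm[OF G[OF \<tau>]] A_def B_def .
  qed
  also have "\<dots> = (\<Sum>M\<in>mset_partitions N. fact N * real (t * (count M t + 1)))"
    by (rule sum_over_classes)
  also have "\<dots> = fact N * (\<Sum>M\<in>mset_partitions N. real (t * (count M t + 1)))"
    by (rule sum_distrib_left[symmetric])
  finally show ?thesis unfolding L_def t_def by simp
qed

text \<open>Summed over the partitions of n - t, the multiplicity of t is a sum of at most (n - t) /
  t shifted partition numbers, each at most p (n - 2 * t); multiplying by t gives the second
  term.\<close>

lemma card_nonvanishing_bound:
  assumes t: "t > 0" "2 * t \<le> n"
  shows "real (card {lam \<in> partitions n. \<exists>\<tau>\<in>sym_group (n - t). chi lam (block_cycle (n - t) n \<circ> \<tau>) \<noteq> 0})
    \<le> real t * real (num_partitions (n - t)) + real n * real (num_partitions (n - 2 * t))"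
proof -
  define N where "N = n - t"
  have N: "N < n" "n - N = t" "N - t = n - 2 * t" using t by (auto simp: N_def)
  have "(\<Sum>M\<in>mset_partitions N. real (count M t)) = (\<Sum>r=1..N. partitions_shift N (r * t))"
    by (rule sum_multiplicity[OF t(1)])
  also have "\<dots> = (\<Sum>r\<in>{1..N div t}. partitions_shift N (r * t))"
  proof (rule sum.mono_neutral_right)
    show "{1..N div t} \<subseteq> {1..N}" using div_le_dividend[of N t] by auto
    show "\<forall>r\<in>{1..N} - {1..N div t}. partitions_shift N (r * t) = 0"
    proof
      fix r assume "r \<in> {1..N} - {1..N div t}"
      then have "N div t < r" by auto
      then have "N < r * t" using t(1) by (simp add: div_less_iff_less_mult)
      then show "partitions_shift N (r * t) = 0" by (simp add: partitions_shift_def)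
    qed
  qed simp
  also have "\<dots> \<le> (\<Sum>r\<in>{1..N div t}. partitions_shift N t)"
    using t(1) by (intro sum_mono partitions_shift_antimono) auto
  also have "\<dots> = real (N div t) * partitions_shift N t" by simp
  finally have "real t * (\<Sum>M\<in>mset_partitions N. real (count M t)) \<le> real t * (real (N div t) * partitions_shift N t)"
    by (intro mult_left_mono) auto
  also have "\<dots> = real (t * (N div t)) * partitions_shift N t" by simp
  also have "\<dots> \<le> real n * real (num_partitions (n - 2 * t))"
  proof (intro mult_mono)
    have "t * (N div t) \<le> N" by simp
    then show "real (t * (N div t)) \<le> real n" using N(1) by (simp only: of_nat_le_iff)
    show "partitions_shift N t \<le> real (num_partitions (n - 2 * t))" by (simp add: partitions_shift_def N(3))
  qed (auto simp: partitions_shift_nonneg)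
  finally have "(\<Sum>M\<in>mset_partitions N. real (t * (count M t + 1))) \<le> real t * real (num_partitions N) + real n * real (num_partitions (n - 2 * t))"
    by (simp add: distrib_left sum.distrib sum_distrib_left num_partitions_def mult.commute)
  then show ?thesis using card_nonvanishing[OF N(1), unfolded N(2)] unfolding N_def by linarith
qed

section \<open>Parity of character values\<close>

definition square_iter :: "nat \<Rightarrow> (nat \<Rightarrow> nat) \<Rightarrow> (nat \<Rightarrow> nat)" where
  "square_iter j = (\<lambda>h. h \<circ> h) ^^ j"

lemma square_iter_props:
  assumes g: "g \<in> sym_group n"
  shows "square_iter j g \<in> sym_group n"
    and "cycle_type n (square_iter j g) = (split_even ^^ j) (cycle_type n g)"
    and "lam \<in> partitions n \<Longrightarrow> even (chi lam (square_iter j g)) \<longleftrightarrow> even (chi lam g)"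
proof (induction j)
  case 0
  { case 1 show ?case using g by (simp add: square_iter_def) }
  { case 2 show ?case by (simp add: square_iter_def) }
  { case 3 show ?case by (simp add: square_iter_def) }
next
  case (Suc j)
  have eq: "square_iter (Suc j) g = square_iter j g \<circ> square_iter j g" by (simp add: square_iter_def)
  { case 1 show ?case unfolding eq by (rule sym_group_comp[OF Suc(1) Suc(1)]) }
  have sq: "square_iter j g permutes {..<n}" using Suc(1) by (simp add: sym_group_def)
  { case 2 show ?case unfolding eq cycle_type_square[OF sq] Suc(2) by simp }
  { case 3 show ?case unfolding eq chi_square_parity[OF 3 Suc(1)] by (rule Suc(3)[OF 3]) }
qed

lemma split_even_replicate:
  "split_even (replicate_mset a (2 * x)) = replicate_mset (2 * a) x"
  "odd m \<Longrightarrow> split_even (replicate_mset a m) = replicate_mset a m"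
  by (induction a) (auto simp: split_even_def)

lemma funpow_split_even_add: "(split_even ^^ j) (M + M') = (split_even ^^ j) M + (split_even ^^ j) M'"
  by (induction j) (auto simp: split_even_add)

text \<open>After k halvings a part 2^k * m has become 2^k copies of the odd number m, which the
  remaining j - k steps leave alone.\<close>

lemma funpow_split_even_replicate:
  assumes "odd m" "k \<le> j"
  shows "(split_even ^^ j) (replicate_mset a (2 ^ k * m)) = replicate_mset (a * 2 ^ k) m"
  using assms(2)
proof (induction j arbitrary: a k)
  case 0
  then show ?case by simp
next
  case (Suc j)
  show ?case
  proof (cases k)
    case 0
    then show ?thesis using Suc.IH[of 0 a] split_even_replicate(2)[OF assms(1), of a]
      by (simp add: funpow_Suc_right del: funpow.simps)
  next
    case (Suc k')
    have "split_even (replicate_mset a (2 ^ k * m)) = replicate_mset (2 * a) (2 ^ k' * m)"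
      using split_even_replicate(1)[of a "2 ^ k' * m"] Suc by (simp add: mult.assoc)
    then show ?thesis using Suc.IH[of k' "2 * a"] Suc.prems Suc
      by (simp add: funpow_Suc_right mult.assoc mult.left_commute del: funpow.simps)
  qed
qed

text \<open>After j squarings only the total of the block is visible, not its division into
  parts.\<close>

lemma funpow_split_even_block:
  assumes "odd m" "\<forall>x\<in>#A. \<exists>k\<le>j. x = 2 ^ k * m"
  shows "\<exists>r. (split_even ^^ j) A = replicate_mset r m \<and> sum_mset A = r * m"
  using assms(2)
proof (induction A)
  case empty
  have "(split_even ^^ j) {#} = {#}" by (induction j) (auto simp: split_even_def)
  then show ?case by (intro exI[of _ 0]) simp
next
  case (add x A)
  then obtain r where r: "(split_even ^^ j) A = replicate_mset r m" "sum_mset A = r * m" by auto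
  obtain k where k: "k \<le> j" "x = 2 ^ k * m" using add.prems by auto
  have "(split_even ^^ j) (add_mset x A) = (split_even ^^ j) {#x#} + (split_even ^^ j) A"
    using funpow_split_even_add[of j "{#x#}" A] by simp
  also have "(split_even ^^ j) {#x#} = replicate_mset (2 ^ k) m"
    using funpow_split_even_replicate[OF assms(1) k(1), of 1] k(2) by simp
  finally have "(split_even ^^ j) (add_mset x A) = replicate_mset (2 ^ k + r) m"
    using r(1) by (simp add: multiset_eq_iff)
  then show ?case using r(2) k(2) by (intro exI[of _ "2 ^ k + r"]) (simp add: algebra_simps)
qed

text \<open>Merging the block into one part gives a permutation of the form block cycle times
  \<tau>. After j squarings it has the same cycle type as the representative of mu squared j times,
  so oddness carries over and excludes the value 0.\<close>

lemma odd_char_value_imp_nonvanishing: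
  assumes lam: "lam \<in> partitions n" and mu: "mu \<in> partitions n" and m: "odd m"
    and block: "has_doubling_block m j (mset mu)" and odd: "odd_value (char_value lam mu)"
  defines "N \<equiv> n - 2 ^ j * m"
  shows "\<exists>\<tau>\<in>sym_group N. chi lam (block_cycle N n \<circ> \<tau>) \<noteq> 0"
proof -
  have n: "sum_list mu = n" using mu by (simp add: partitions_def)
  have M: "mset mu \<in> mset_partitions n" using bij_betwE[OF bij_betw_mset_partitions] mu by blast
  define \<sigma> where "\<sigma> = (SOME p. p permutes {..<n} \<and> cycle_type n p = mset mu)"
  have "\<sigma> permutes {..<n} \<and> cycle_type n \<sigma> = mset mu"
    unfolding \<sigma>_def by (rule someI_ex[OF exists_cycle_type[OF M]])
  then have \<sigma>: "\<sigma> \<in> sym_group n" "cycle_type n \<sigma> = mset mu" by (auto simp: sym_group_def)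
  have "char_value lam mu = of_int (chi lam \<sigma>)"
    using irr_character_chi[OF lam \<sigma>(1)] by (simp add: char_value_def n \<sigma>_def)
  then have odd\<sigma>: "odd (chi lam \<sigma>)" using odd by (auto simp: odd_value_def)
  define t where "t = 2 ^ j * m"
  obtain A where A: "A \<subseteq># mset mu" "sum_mset A = t" "\<forall>x\<in>#A. \<exists>k\<le>j. x = 2 ^ k * m"
    using block unfolding has_doubling_block_def t_def by blast
  define B where "B = mset mu - A"
  have AB: "mset mu = A + B" using A(1) by (simp add: B_def)
  have "m > 0" using m by (cases m) auto
  then have t: "t > 0" by (simp add: t_def)
  have sum: "t + sum_mset B = n" using M A(2) unfolding AB mset_partitions_def by simp
  then have N: "N < n" "n - N = t" "sum_mset B = N" using t by (auto simp: N_def t_def)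
  have "B \<in> mset_partitions N" using M N(3) unfolding AB mset_partitions_def by auto
  then obtain \<tau> where \<tau>: "\<tau> permutes {..<N}" "cycle_type N \<tau> = B" using exists_cycle_type by blast
  define h where "h = block_cycle N n \<circ> \<tau>"
  have h: "h \<in> sym_group n" unfolding h_def sym_group_def using block_cycle_comp_permutes[OF N(1) \<tau>(1)] by blast
  have hty: "cycle_type n h = {#t#} + B"
    unfolding h_def cycle_type_block_cycle[OF N(1) \<tau>(1)] N(2) \<tau>(2) by simp
  obtain r where r: "(split_even ^^ j) A = replicate_mset r m" "t = r * m"
    using funpow_split_even_block[OF m A(3)] A(2) by auto
  \<comment> \<open>The block and the single part t both end as 2^j copies of m.\<close>
  have "r = 2 ^ j" using r(2) \<open>m > 0\<close> by (simp add: t_def)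
  then have "(split_even ^^ j) A = (split_even ^^ j) {#t#}"
    using r(1) funpow_split_even_replicate[OF m order.refl, of j 1] by (simp add: t_def)
  then have "cycle_type n (square_iter j \<sigma>) = cycle_type n (square_iter j h)"
    unfolding square_iter_props(2)[OF \<sigma>(1)] square_iter_props(2)[OF h] \<sigma>(2) AB hty funpow_split_even_add by simp
  then have "chi lam (square_iter j \<sigma>) = chi lam (square_iter j h)"
    by (rule chi_cycle_type[OF lam square_iter_props(1)[OF \<sigma>(1)] square_iter_props(1)[OF h]])
  then have "odd (chi lam h)"
    using odd\<sigma> square_iter_props(3)[OF \<sigma>(1) lam] square_iter_props(3)[OF h lam] by metis
  then have "chi lam h \<noteq> 0" by auto
  then show ?thesis unfolding h_def using \<tau>(1) by (auto simp: sym_group_def)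
qed

theorem theorem1p1:
  shows "D2 \<longlonglongrightarrow> 0"
proof (rule tendstoI)
  fix e :: real assume e: "e > 0"
  \<comment> \<open>Columns without the block and nonvanishing rows each take up a proportion of at
    most \<epsilon>, and 2 * \<epsilon> < e.\<close>
  define \<epsilon> where "\<epsilon> = e / 3"
  have \<epsilon>: "\<epsilon> > 0" using e by (simp add: \<epsilon>_def)
  show "\<forall>\<^sub>F n in sequentially. dist (D2 n) 0 < e"
    using eventually_doubling_block[OF \<epsilon>]
  proof eventually_elim
    case (elim n)
    then obtain m j where m: "odd m" and tn: "2 * (2 ^ j * m) \<le> n"
      and bad: "real (card {M \<in> mset_partitions n. \<not> has_doubling_block m j M}) \<le> \<epsilon> * real (num_partitions n)"
      and small: "real (2 ^ j * m) * real (num_partitions (n - 2 ^ j * m)) + real n * real (num_partitions (n - 2 * (2 ^ j * m)))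
        \<le> \<epsilon> * real (num_partitions n)" by blast
    define t where "t = 2 ^ j * m"
    have t: "t > 0" using m by (cases m) (auto simp: t_def)
    define p where "p = real (num_partitions n)"
    have p: "p > 0" using num_partitions_pos by (simp add: p_def)
    define Bad where "Bad = {mu \<in> partitions n. \<not> has_doubling_block m j (mset mu)}"
    define L where "L = {lam \<in> partitions n. \<exists>\<tau>\<in>sym_group (n - t). chi lam (block_cycle (n - t) n \<circ> \<tau>) \<noteq> 0}"
    define S where "S = {(lam, mu). lam \<in> partitions n \<and> mu \<in> partitions n \<and> odd_value (char_value lam mu)}"
    have finB: "finite Bad" "finite L" using finite_partitions by (auto simp: Bad_def L_def)
    have "bij_betw mset Bad {M \<in> mset_partitions n. \<not> has_doubling_block m j M}"
      using bij_betw_mset_partitions[of n] unfolding Bad_def bij_betw_def by (auto simp: inj_on_def)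
    then have cB: "real (card Bad) \<le> \<epsilon> * p" using bad by (simp add: bij_betw_same_card p_def)
    have cL: "real (card L) \<le> \<epsilon> * p"
      using card_nonvanishing_bound[OF t, of n] tn small unfolding L_def p_def t_def by linarith
    \<comment> \<open>An odd entry lies in a column without the block or in a row that is nonzero
      somewhere on the merged permutations.\<close>
    have "S \<subseteq> partitions n \<times> Bad \<union> L \<times> partitions n"
      using odd_char_value_imp_nonvanishing[OF _ _ m] unfolding S_def Bad_def L_def t_def by blast
    then have "card S \<le> card (partitions n \<times> Bad \<union> L \<times> partitions n)"
      using finB finite_partitions by (intro card_mono) auto
    also have "\<dots> \<le> card (partitions n \<times> Bad) + card (L \<times> partitions n)" by (rule card_Un_le)
    finally have "real (card S) \<le> real (card (partitions n \<times> Bad) + card (L \<times> partitions n))" by (simp only: of_nat_le_iff)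
    also have "\<dots> = p * real (card Bad) + real (card L) * p"
      by (simp add: card_cartesian_product card_partitions p_def)
    also have "\<dots> \<le> p * (\<epsilon> * p) + (\<epsilon> * p) * p"
      using cB cL p by (intro add_mono mult_left_mono mult_right_mono) auto
    finally have cS: "real (card S) \<le> 2 * \<epsilon> * (p * p)" by (simp add: mult_ac)
    have D: "D2 n = real (card S) / (p * p)"
      by (simp add: D2_def S_def card_cartesian_product card_partitions p_def)
    have "D2 n \<le> 2 * \<epsilon>" unfolding D using cS p by (simp add: pos_divide_le_eq)
    moreover have "D2 n \<ge> 0" unfolding D by simp
    ultimately show ?case using e by (simp add: \<epsilon>_def)
  qed
qed

end
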